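(* Let $\Omega\subset\mathbb{C}^n$ be a smoothly bounded strongly pseudoconvex domain, $0<r<1$, $1\le p\le\infty$, $\alpha>-1$. There exist $C,q>0$ such that for all $0<\gamma<1$ and all measurable $E\subset\Omega$ satisfying $$\frac{|E\cap Y(z,r)|}{|Y(z,r)|}\ge\gamma\quad\text{for all } z\in\Omega,$$ one has $$\|f\|_{L^p_\alpha(\Omega)}\le C\gamma^{-q}\|f\|_{L^p_\alpha(E)}\quad\text{for all } f\in A^p_\alpha(\Omega).$$
   Context: Domain: $\Omega\subset\mathbb{C}^n$ is a bounded domain with smooth defining function $\rho$, i.e. $\Omega=\{\rho<0\}$, $\nabla\rho\ne0$ on $\partial\Omega$, and $\rho$ is strictly plurisubharmonic; $\rho$ is fixed. $|\cdot|$ of a set is Lebesgue measure on $\mathbb{C}^n\equiv\mathbb{R}^{2n}$, $dA$ the volume element. Kobayashi distance: $F_K(z,\xi)=\inf\{\alpha>0:\exists\,\phi:\mathbb{D}\to\Omega \text{ holomorphic},\ \phi(0)=z,\ \phi'(0)=\xi/\alpha\}$ and $d(z,w)=\inf\int_0^1F_K(\gamma(t),\gamma'(t))\,dt$ over $C^1$ curves $\gamma:[0,1]\to\Omega$ from $z$ to $w$ (on the unit disc this is the Poincaré distance with $d(0,\zeta)=\tanh^{-1}|\zeta|$). $Y(w,r)=\{z\in\Omega:d(z,w)<\tanh^{-1}r\}$, $0<r<1$. Spaces: for measurable $F\subset\Omega$, $L^p_\alpha(F)=L^p(F,|\rho|^\alpha dA)$ (essential supremum norm if $p=\infty$); $A^p_\alpha(\Omega)$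 is the space of holomorphic functions in $L^p_\alpha(\Omega)$. *)

theory Defs
  imports "HOL-Probability.Essential_Supremum"
begin

text \<open>Points of \<open>\<complex>\<^sup>n\<close> are elements of \<^typ>\<open>complex ^ 'n\<close>; the measure \<^term>\<open>lebesgue\<close> on
  this Euclidean space is Lebesgue measure on \<open>\<real>\<^sup>2\<^sup>n\<close>.\<close>

section \<open>Smoothness, Wirtinger derivatives, strict plurisubharmonicity\<close>

text \<open>\<open>C\<^sup>k\<close> on an open set, through differentiability of all iterated directional derivatives.\<close>

fun Ck_on :: "nat \<Rightarrow> 'a::real_normed_vector set \<Rightarrow> ('a \<Rightarrow> 'b::real_normed_vector) \<Rightarrow> bool" where
  "Ck_on 0 U f \<longleftrightarrow> continuous_on U f"
| "Ck_on (Suc k) U f \<longleftrightarrow>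
     (\<forall>x\<in>U. f differentiable (at x)) \<and> (\<forall>v. Ck_on k U (\<lambda>x. frechet_derivative f (at x) v))"

definition smooth_on :: "'a::real_normed_vector set \<Rightarrow> ('a \<Rightarrow> 'b::real_normed_vector) \<Rightarrow> bool" where
  "smooth_on U f \<longleftrightarrow> (\<forall>k. Ck_on k U f)"

text \<open>\<open>\<partial>/\<partial>z\<^sub>j = (\<partial>/\<partial>x\<^sub>j - \<i> \<partial>/\<partial>y\<^sub>j) / 2\<close> and its conjugate.\<close>

definition wirt :: "'n::finite \<Rightarrow> (complex ^ 'n \<Rightarrow> complex) \<Rightarrow> complex ^ 'n \<Rightarrow> complex" where
  "wirt j f z = (frechet_derivative f (at z) (axis j 1)
                 - \<i> * frechet_derivative f (at z) (axis j \<i>)) / 2"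

definition wirt_bar :: "'n::finite \<Rightarrow> (complex ^ 'n \<Rightarrow> complex) \<Rightarrow> complex ^ 'n \<Rightarrow> complex" where
  "wirt_bar j f z = (frechet_derivative f (at z) (axis j 1)
                     + \<i> * frechet_derivative f (at z) (axis j \<i>)) / 2"

text \<open>The Hermitian sum is real for \<open>C\<^sup>2\<close> functions; \<^const>\<open>Re\<close> only changes its type.\<close>

definition levi_form :: "(complex ^ 'n::finite \<Rightarrow> real) \<Rightarrow> complex ^ 'n \<Rightarrow> complex ^ 'n \<Rightarrow> real" where
  "levi_form \<rho> z \<xi> =
     Re (\<Sum>j\<in>UNIV. \<Sum>k\<in>UNIV.
           wirt j (wirt_bar k (\<lambda>w. complex_of_real (\<rho> w))) z * (\<xi> $ j) * cnj (\<xi> $ k))"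

definition strictly_psh_on :: "(complex ^ 'n::finite) set \<Rightarrow> (complex ^ 'n \<Rightarrow> real) \<Rightarrow> bool" where
  "strictly_psh_on U \<rho> \<longleftrightarrow> (\<forall>z\<in>U. \<forall>\<xi>. \<xi> \<noteq> 0 \<longrightarrow> levi_form \<rho> z \<xi> > 0)"

text \<open>The defining function lives on some neighbourhood \<open>U\<close> of the closure (possibly all of
  \<open>\<complex>\<^sup>n\<close>); its values elsewhere are irrelevant.\<close>

definition strongly_pseudoconvex_domain ::
    "(complex ^ 'n::finite) set \<Rightarrow> (complex ^ 'n \<Rightarrow> real) \<Rightarrow> bool" where
  "strongly_pseudoconvex_domain \<Omega> \<rho> \<longleftrightarrow>
     open \<Omega> \<and> connected \<Omega> \<and> \<Omega> \<noteq> {} \<and> bounded \<Omega> \<and>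
     (\<exists>U. open U \<and> closure \<Omega> \<subseteq> U \<and> smooth_on U \<rho> \<and> strictly_psh_on U \<rho> \<and>
          \<Omega> = {z \<in> U. \<rho> z < 0} \<and>
          (\<forall>z\<in>frontier \<Omega>. frechet_derivative \<rho> (at z) \<noteq> (\<lambda>v. 0)))"

section \<open>Kobayashi metric, distance and balls\<close>

definition kobayashi_metric ::
    "(complex ^ 'n::finite) set \<Rightarrow> complex ^ 'n \<Rightarrow> complex ^ 'n \<Rightarrow> real" where
  "kobayashi_metric \<Omega> z \<xi> =
     Inf {\<alpha>. \<alpha> > 0 \<and>
       (\<exists>\<phi> :: complex \<Rightarrow> complex ^ 'n.
          (\<forall>i. (\<lambda>\<zeta>. \<phi> \<zeta> $ i) holomorphic_on ball 0 1) \<and> \<phi> ` ball 0 1 \<subseteq> \<Omega> \<and>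
          \<phi> 0 = z \<and> (\<forall>i. deriv (\<lambda>\<zeta>. \<phi> \<zeta> $ i) 0 = \<xi> $ i / complex_of_real \<alpha>))}"

text \<open>The length of a curve is a nonnegative Lebesgue integral, so the distance is
  \<^typ>\<open>ennreal\<close>-valued and no integrability side condition is needed.\<close>

definition kobayashi_dist ::
    "(complex ^ 'n::finite) set \<Rightarrow> complex ^ 'n \<Rightarrow> complex ^ 'n \<Rightarrow> ennreal" where
  "kobayashi_dist \<Omega> z w =
     Inf {(\<integral>\<^sup>+ t\<in>{0..1}. ennreal (kobayashi_metric \<Omega> (\<gamma> t) (\<gamma>' t)) \<partial>lborel) | \<gamma> \<gamma>'.
       (\<forall>t\<in>{0..1::real}. (\<gamma> has_vector_derivative \<gamma>' t) (at t within {0..1})) \<and>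
       continuous_on {0..1} \<gamma>' \<and> \<gamma> ` {0..1} \<subseteq> \<Omega> \<and> \<gamma> 0 = z \<and> \<gamma> 1 = w}"

definition kobayashi_ball ::
    "(complex ^ 'n::finite) set \<Rightarrow> complex ^ 'n \<Rightarrow> real \<Rightarrow> (complex ^ 'n) set" where
  "kobayashi_ball \<Omega> w r = {z \<in> \<Omega>. kobayashi_dist \<Omega> z w < ennreal (artanh r)}"

section \<open>Weighted Lebesgue and Bergman spaces\<close>

definition weighted_measure ::
    "(complex ^ 'n::finite \<Rightarrow> real) \<Rightarrow> real \<Rightarrow> (complex ^ 'n) set \<Rightarrow> (complex ^ 'n) measure" where
  "weighted_measure \<rho> \<alpha> F =
     density (restrict_space lebesgue F) (\<lambda>z. ennreal (\<bar>\<rho> z\<bar> powr \<alpha>))"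

text \<open>The exponent ranges over \<open>[1, \<infinity>]\<close>; the norm of a measurable function is \<open>\<infinity>\<close> when it does
  not belong to the space.\<close>

definition Lp_norm :: "ennreal \<Rightarrow> 'a measure \<Rightarrow> ('a \<Rightarrow> complex) \<Rightarrow> ennreal" where
  "Lp_norm p M f =
     (if p = \<infinity> then esssup M (\<lambda>z. ennreal (norm (f z)))
      else let I = (\<integral>\<^sup>+ z. ennreal (norm (f z) powr enn2real p) \<partial>M)
           in if I = \<infinity> then \<infinity> else ennreal (enn2real I powr (1 / enn2real p)))"

definition Lp_space :: "ennreal \<Rightarrow> 'a measure \<Rightarrow> ('a \<Rightarrow> complex) set" where
  "Lp_space p M = {f \<in> borel_measurable M. Lp_norm p M f < \<infinity>}"

text \<open>Holomorphy in several variables: the real Frechet derivative exists and is complex linear.\<close>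

definition holomorphic_on_Cn ::
    "(complex ^ 'n::finite \<Rightarrow> complex) \<Rightarrow> (complex ^ 'n) set \<Rightarrow> bool" where
  "holomorphic_on_Cn f \<Omega> \<longleftrightarrow>
     (\<forall>z\<in>\<Omega>. \<exists>f'. (f has_derivative f') (at z) \<and> (\<forall>c v. f' (c *s v) = c * f' v))"

definition bergman_space ::
    "(complex ^ 'n::finite) set \<Rightarrow> (complex ^ 'n \<Rightarrow> real) \<Rightarrow> ennreal \<Rightarrow> real \<Rightarrow>
     (complex ^ 'n \<Rightarrow> complex) set" where
  "bergman_space \<Omega> \<rho> p \<alpha> =
     {f \<in> Lp_space p (weighted_measure \<rho> \<alpha> \<Omega>). holomorphic_on_Cn f \<Omega>}"

end

theory Submission
  imports Defs "HOL-Complex_Analysis.Complex_Analysis"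
begin

text \<open>With \<open>\<delta> = - \<rho>\<close> and \<open>T z = 2 \<partial>\<rho>(z)\<close>, the norms \<open>N z v\<close> comparable to \<open>|v| / \<surd>\<delta>(z) + |T z v| / \<delta>(z)\<close> vary slowly on
  their own unit balls and are bounded by a multiple of the Kobayashi metric. The lower bound is global: sub-mean
  value inequalities for \<open>\<rho>\<close> along analytic discs replace localisation near the boundary. Hence a Kobayashi ball
  contains one ball of \<open>N z\<close>, and each of its points is joined to the centre by a bounded number of short steps.

  On a ball of \<open>N z\<close>, a holomorphic function with \<open>|f| \<le> M\<close> that is at most \<open>m\<close> on a subset of density \<open>\<gamma>\<close> satisfies
  \<open>|f(z)| \<le> K \<gamma>\<^sup>-\<^sup>q m + \<epsilon> M\<close> with \<open>K\<close> and \<open>q\<close> depending on \<open>\<epsilon>\<close> only; on a disc this follows by dividing out the zeros.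
  Propagating this along chains and integrating over \<open>\<Omega>\<close> bounds the norm over \<open>\<Omega>\<close> by a multiple of \<open>\<gamma>\<^sup>-\<^sup>q\<close> times the norm
  over \<open>E\<close> plus an arbitrarily small multiple of the norm over \<open>\<Omega>\<close>, which is finite and is absorbed.\<close>


section \<open>Propagation of smallness in one variable\<close>

text \<open>Estimates have the linear form
  \<open>K * \<gamma> powr (-q) * m + \<epsilon> * M\<close> instead of a Hadamard product of powers
  of m and M: this form survives p-th powers, integration and iteration, and its second term can be
  absorbed. Since K and q depend on \<epsilon>, the size of \<epsilon> has to be fixed by the
  geometry before \<gamma> and E are known. The obstacle is that the radius r is arbitrary: the part
  of E seen from a centre z may lie many steps away from z and be spread over the whole Kobayashi
  ball. It is first concentrated, at the cost of a constant, in one small ball around one of its own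
  points. Only the step leaving that ball sees \<gamma>; all further steps start from a full ball,
  so negative powers of \<gamma> do not multiply up along the chain. The norms have to be
  homogeneous over the complex numbers, since smallness travels along complex lines. The locale
  \<open>complex_norm_field\<close> separates this argument from pseudoconvexity, which serves only
  to build the norms and to bound the Kobayashi metric below; for the opposite inclusion affine
  discs suffice.\<close>

lemma Harnack_norm_lower_bound:
  fixes G :: "complex \<Rightarrow> complex"
  assumes hol: "G holomorphic_on ball 0 2" and nz: "\<And>z. z \<in> ball 0 2 \<Longrightarrow> G z \<noteq> 0"
    and le1: "\<And>z. z \<in> ball 0 2 \<Longrightarrow> norm (G z) \<le> 1" and z: "norm z \<le> 1"
  shows "norm (G 0) ^ 3 / 4 \<le> norm (G z)"
proof -
  \<comment> \<open>Halving turns the bound 1 into a strict one, so a logarithm of the quotient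
    takes values in the open left half-plane.\<close>
  have "(\<lambda>z. G z / 2) holomorphic_on ball 0 2" using hol by (intro holomorphic_intros) auto
  then obtain g where g: "g holomorphic_on ball 0 2" "\<And>x. x \<in> ball 0 2 \<Longrightarrow> exp (g x) = G x / 2"
    using holomorphic_logarithm_exists[of "ball 0 2" "\<lambda>z. G z / 2" 0] nz by auto
  have nexp: "exp (Re (g x)) = norm (G x) / 2" if "x \<in> ball 0 2" for x
    unfolding norm_exp_eq_Re[symmetric] g(2)[OF that] by (simp add: norm_divide)
  have Reneg: "Re (g x) < 0" if "x \<in> ball 0 2" for x
  proof -
    have "exp (Re (g x)) < 1" unfolding nexp[OF that] using le1[OF that] by simp
    thus ?thesis by (simp only: exp_less_one_iff)
  qed
  have sq: "(norm (u + cnj v))^2 = (norm (u - v))^2 + 4 * Re u * Re v" for u v :: complex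
    unfolding cmod_power2 by (simp add: power2_eq_square algebra_simps)
  \<comment> \<open>\<open>w\<close> is \<open>g\<close> on the disc of radius 2, rescaled, followed
    by the Cayley transform of the left half-plane that sends \<open>g 0\<close> to 0. The Schwarz
    lemma at \<open>z / 2\<close> bounds it by 1/2, which is Harnack's inequality with factor (1 +
    1/2) / (1 - 1/2) = 3.\<close>
  define w where "w = (\<lambda>\<zeta>. (g (2*\<zeta>) - g 0) / (g (2*\<zeta>) + cnj (g 0)))"
  have ball2: "2 * \<zeta> \<in> ball 0 2" if "norm \<zeta> < 1" for \<zeta> :: complex
    using that by (simp add: norm_mult)
  have lt: "norm (g (2*\<zeta>) - g 0) < norm (g (2*\<zeta>) + cnj (g 0))" if "norm \<zeta> < 1" for \<zeta>
  proof -
    have "0 < 4 * Re (g (2*\<zeta>)) * Re (g 0)"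
      using Reneg[OF ball2[OF that]] Reneg[of 0] by (simp add: mult_neg_neg)
    hence "(norm (g (2*\<zeta>) - g 0))^2 < (norm (g (2*\<zeta>) + cnj (g 0)))^2"
      using sq[of "g (2*\<zeta>)" "g 0"] by linarith
    thus ?thesis using power2_less_imp_less norm_ge_zero by blast
  qed
  have "(\<lambda>\<zeta>. g (2*\<zeta>)) holomorphic_on ball 0 1"
    using holomorphic_on_compose_gen[of "\<lambda>\<zeta>. 2*\<zeta>" "ball 0 1" g "ball 0 2"] g(1) ball2
    by (force simp: o_def intro!: holomorphic_intros)
  moreover have "g (2*\<zeta>) + cnj (g 0) \<noteq> 0" if "norm \<zeta> < 1" for \<zeta>
    using lt[OF that] by force
  ultimately have wh: "w holomorphic_on ball 0 1"
    unfolding w_def by (intro holomorphic_intros) auto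
  have "norm (w (z/2)) \<le> norm (z/2)"
  proof (rule Schwarz_Lemma(1)[OF wh])
    show "w 0 = 0" by (simp add: w_def)
    show "norm (w \<zeta>) < 1" if "norm \<zeta> < 1" for \<zeta>
    proof -
      have "0 < norm (g (2*\<zeta>) + cnj (g 0))" using lt[OF that] norm_ge_zero le_less_trans by blast
      thus ?thesis using lt[OF that] by (simp add: w_def norm_divide divide_less_eq)
    qed
    show "norm (z/2) < 1" using z by (simp add: norm_divide)
  qed
  also have "\<dots> \<le> 1/2" using z by (simp add: norm_divide)
  finally have "norm (g z - g 0) / norm (g z + cnj (g 0)) \<le> 1/2"
    by (simp add: w_def norm_divide)
  moreover have "norm (g z - g 0) < norm (g z + cnj (g 0))" using lt[of "z/2"] z by (simp add: norm_divide)
  ultimately have "norm (g z - g 0) \<le> 1/2 * norm (g z + cnj (g 0))"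
    by (simp add: divide_le_eq split: if_splits)
  hence "(norm (g z - g 0))^2 \<le> (1/2 * norm (g z + cnj (g 0)))^2" by (intro power_mono) auto
  hence "4 * (norm (g z - g 0))^2 \<le> (norm (g z - g 0))^2 + 4 * Re (g z) * Re (g 0)"
    unfolding power_mult_distrib sq[symmetric] by (simp add: power2_eq_square)
  moreover have "(Re (g z) - Re (g 0))^2 \<le> (norm (g z - g 0))^2"
    by (simp add: cmod_power2)
  ultimately have q: "3 * (Re (g z) - Re (g 0))^2 \<le> 4 * Re (g z) * Re (g 0)" by linarith
  have zb: "z \<in> ball 0 2" using z by simp
  \<comment> \<open>With a = \<open>Re (g z)\<close> and b = \<open>Re (g 0)\<close>, the inequality
    \<open>q\<close> says (a - 3 b) (3 a - b) \<le> 0; since b is negative, a < 3 b would make both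
    factors negative.\<close>
  have "3 * Re (g 0) \<le> Re (g z)"
  proof (rule ccontr)
    assume "\<not> ?thesis"
    hence "Re (g z) - 3 * Re (g 0) < 0" "3 * Re (g z) - Re (g 0) < 0"
      using Reneg[OF zb] Reneg[of 0] by auto
    hence "0 < (Re (g z) - 3 * Re (g 0)) * (3 * Re (g z) - Re (g 0))" by (rule mult_neg_neg)
    thus False using q by (simp add: power2_eq_square algebra_simps)
  qed
  hence "exp (3 * Re (g 0)) \<le> exp (Re (g z))" by simp
  moreover have "exp (3 * Re (g 0)) = exp (Re (g 0)) ^ 3"
    using exp_of_nat_mult[of 3 "Re (g 0)"] by simp
  ultimately have "(norm (G 0) / 2)^3 \<le> norm (G z) / 2"
    unfolding nexp[OF zb, symmetric] nexp[of 0, simplified, symmetric] by simp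
  thus ?thesis by (simp add: power3_eq_cube)
qed

text \<open>Each zero in \<open>ball 0 2\<close> that is divided out doubles the value at the origin, which replaces
  Jensen's formula.\<close>

lemma divide_out_zeros:
  fixes F :: "complex \<Rightarrow> complex"
  assumes "F holomorphic_on ball 0 8" "\<And>z. z \<in> cball 0 6 \<Longrightarrow> norm (F z) \<le> 1"
    and "(1/2)^N \<le> norm (F 0)"
  shows "\<exists>as G. length as \<le> N \<and> G holomorphic_on ball 0 8 \<and>
    (\<forall>z\<in>cball 0 6. norm (G z) \<le> 1) \<and> (\<forall>z\<in>ball 0 2. G z \<noteq> 0) \<and> (1/2)^N \<le> norm (G 0) \<and>
    (\<forall>z\<in>ball 0 8. F z = (\<Prod>i<length as. (z - as ! i) / 4) * G z)"
  using assms
proof (induction N arbitrary: F)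
  case (0 F)
  show ?case
  proof (cases "\<exists>a\<in>ball 0 2. F a = 0")
    case False
    thus ?thesis using 0 by (intro exI[of _ "[]"] exI[of _ F]) auto
  next
    case True
    then obtain a where a: "a \<in> ball 0 2" "F a = 0" by auto
    \<comment> \<open>For exponent 0 the modulus at the origin attains the maximal value 1, so the
      maximum principle leaves no room for a zero.\<close>
    have "F constant_on ball 0 6"
    proof (rule maximum_modulus_principle[of F "ball 0 6" "ball 0 6" 0])
      show "F holomorphic_on ball 0 6" using 0(1) by (rule holomorphic_on_subset) auto
      show "norm (F z) \<le> norm (F 0)" if "z \<in> ball 0 6" for z
        using 0(2)[of z] 0(3) that by simp
    qed auto
    then obtain c where "\<And>z. z \<in> ball 0 6 \<Longrightarrow> F z = c" by (auto simp: constant_on_def)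
    hence "F 0 = F a" using a by simp
    thus ?thesis using 0(3) a by simp
  qed
next
  case (Suc N F)
  show ?case
  proof (cases "\<exists>a\<in>ball 0 2. F a = 0")
    case False
    thus ?thesis using Suc.prems by (intro exI[of _ "[]"] exI[of _ F]) auto
  next
    case True
    then obtain a where a: "a \<in> ball 0 2" "F a = 0" by auto
    \<comment> \<open>For \<open>a\<close> in \<open>ball 0 2\<close> the factor
      \<open>(z - a) / 4\<close> has modulus at least 1 on the circle of radius 6 and less than 1/2
      at the origin: dividing by it keeps the bound 1 and at least doubles the value at 0.\<close>
    define H where "H = (\<lambda>z. 4 * (if z = a then deriv F a else (F z - F a) / (z - a)))"
    have Hh: "H holomorphic_on ball 0 8"
      unfolding H_def using Suc.prems(1) by (intro holomorphic_intros pole_lemma_open) auto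
    have FH: "F z = (z - a) / 4 * H z" for z
      using a by (auto simp: H_def)
    have H1: "norm (H z) \<le> 1" if "z \<in> cball 0 6" for z
    proof (rule maximum_modulus_frontier[of H "cball 0 6"])
      show "H holomorphic_on interior (cball 0 6)"
        using Hh by (rule holomorphic_on_subset) auto
      show "continuous_on (closure (cball 0 6)) H"
        by (rule continuous_on_subset[OF holomorphic_on_imp_continuous_on[OF Hh]]) auto
      show "norm (H x) \<le> 1" if "x \<in> frontier (cball 0 6)" for x
      proof -
        have x: "norm x = 6" using that by simp
        have "norm (x - a) \<ge> 4" using norm_triangle_ineq2[of x a] x a by simp
        moreover have "norm (F x) \<le> 1" using Suc.prems(2)[of x] x by simp
        moreover have "norm (x - a) * norm (H x) = 4 * norm (F x)"
          unfolding FH[of x] by (simp only: norm_mult norm_divide) simp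
        ultimately have "4 * norm (H x) \<le> 4 * 1"
          using mult_right_mono[of 4 "norm (x - a)" "norm (H x)"] by simp
        thus ?thesis by simp
      qed
    qed (use that in auto)
    have "(1/2)^N \<le> norm (H 0)"
    proof -
      have e: "norm (F 0) = norm a / 4 * norm (H 0)" using FH[of 0] by (simp add: norm_mult norm_divide)
      have "norm a / 4 * norm (H 0) \<le> 1/2 * norm (H 0)" using a by (intro mult_right_mono) auto
      thus ?thesis using e Suc.prems(3) by simp
    qed
    from Suc.IH[OF Hh H1 this] obtain as G where asG: "length as \<le> N" "G holomorphic_on ball 0 8"
      "\<forall>z\<in>cball 0 6. norm (G z) \<le> 1" "\<forall>z\<in>ball 0 2. G z \<noteq> 0" "(1/2)^N \<le> norm (G 0)"
      "\<forall>z\<in>ball 0 8. H z = (\<Prod>i<length as. (z - as ! i) / 4) * G z" by blast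
    show ?thesis
    proof (intro exI conjI)
      show "length (a # as) \<le> Suc N" using asG by simp
      show "(1/2)^Suc N \<le> norm (G 0)"
        using asG(5) power_decreasing[of N "Suc N" "1/2::real"] by linarith
      show "\<forall>z\<in>ball 0 8. F z = (\<Prod>i<length (a # as). (z - (a # as) ! i) / 4) * G z"
        using asG(6) by (simp add: FH prod.lessThan_Suc_shift o_def del: prod.lessThan_Suc)
    qed (use asG in auto)
  qed
qed

text \<open>Uniformity in \<open>b\<close>: where the distance to \<open>b\<close> exceeds 1 the
  integrand is at most 1, and each side of \<open>b\<close> adds at most the integral 2 of the
  inverse square root over \<open>{0..1}\<close>.\<close>

lemma nn_integral_inverse_sqrt_le:
  fixes b :: real
  shows "(\<integral>\<^sup>+t\<in>{1/2..1}. ennreal (\<bar>t - b\<bar> powr (-1/2)) \<partial>lborel) \<le> 5"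
proof -
  have A: "(\<integral>\<^sup>+t. ennreal (t powr (-1/2)) * indicator {0..1} t \<partial>lborel) = 2"
  proof -
    have "((\<lambda>x. x powr (-1/2)) has_integral (1 powr (-1/2+1) / (-1/2+1))) {0..1::real}"
      by (rule has_integral_powr_from_0) auto
    hence "((\<lambda>x. x powr (-1/2)) has_integral 2) {0..1::real}" by simp
    from nn_integral_has_integral_lebesgue[OF _ this]
    have "(\<integral>\<^sup>+x. ennreal (indicat_real {0..1} x * x powr (-1/2)) \<partial>lborel) = 2"
      by (simp add: nn_integral_completion)
    moreover have "ennreal (indicat_real {0..1} x * x powr (-1/2)) = ennreal (x powr (-1/2)) * indicator {0..1} x" for x
      by (auto split: split_indicator)
    ultimately show ?thesis by (simp add: nn_integral_completion)
  qed
  have B: "(\<integral>\<^sup>+t. ennreal ((t - b) powr (-1/2)) * indicator {0..1} (t - b) \<partial>lborel) = 2"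
    using A nn_integral_real_affine[of "\<lambda>t. ennreal (t powr (-1/2)) * indicator {0..1} t" 1 "-b"] by simp
  have C: "(\<integral>\<^sup>+t. ennreal ((b - t) powr (-1/2)) * indicator {0..1} (b - t) \<partial>lborel) = 2"
    using A nn_integral_real_affine[of "\<lambda>t. ennreal (t powr (-1/2)) * indicator {0..1} t" "-1" "b"] by simp
  have "(\<integral>\<^sup>+t\<in>{1/2..1}. ennreal (\<bar>t - b\<bar> powr (-1/2)) \<partial>lborel) \<le>
    (\<integral>\<^sup>+t. indicator {1/2..1} t + (ennreal ((t - b) powr (-1/2)) * indicator {0..1} (t - b)
        + ennreal ((b - t) powr (-1/2)) * indicator {0..1} (b - t)) \<partial>lborel)"
  proof (rule nn_integral_mono)
    fix t :: real
    have big: "\<bar>t - b\<bar> powr (-1/2) \<le> 1" if "\<bar>t - b\<bar> > 1"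
      using powr_mono[of "-1/2" 0 "\<bar>t - b\<bar>"] that by (simp split: if_splits)
    consider "\<bar>t - b\<bar> > 1" | "\<bar>t - b\<bar> \<le> 1" "t \<ge> b" | "\<bar>t - b\<bar> \<le> 1" "t < b" by linarith
    thus "ennreal (\<bar>t - b\<bar> powr (-1/2)) * indicator {1/2..1} t
      \<le> indicator {1/2..1} t + (ennreal ((t - b) powr (-1/2)) * indicator {0..1} (t - b)
        + ennreal ((b - t) powr (-1/2)) * indicator {0..1} (b - t))"
    proof cases
      case 1
      have "ennreal (\<bar>t - b\<bar> powr (-1/2)) * indicator {1/2..1} t \<le> 1 * indicator {1/2..1} t"
        using big[OF 1] by (intro mult_right_mono) (auto simp: ennreal_le_1)
      also have "\<dots> \<le> indicator {1/2..1} t + (ennreal ((t - b) powr (-1/2)) * indicator {0..1} (t - b)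
        + ennreal ((b - t) powr (-1/2)) * indicator {0..1} (b - t))" by simp
      finally show ?thesis .
    next
      case 2
      thus ?thesis by (auto split: split_indicator simp: add_increasing add_increasing2)
    next
      case 3
      thus ?thesis by (auto split: split_indicator simp: add_increasing add_increasing2 abs_minus_commute)
    qed
  qed
  also have "\<dots> = ennreal (1/2) + (2 + 2)"
    using B C by (subst nn_integral_add, simp, simp, subst nn_integral_add) auto
  also have "\<dots> \<le> 1 + (2 + 2)" by (intro add_mono) (auto simp: ennreal_le_1 simp del: ennreal_half)
  also have "\<dots> = 5" by simp
  finally show ?thesis .
qed

text \<open>AM-GM makes the bound on the sublevel set independent of the degree.\<close>

lemma measure_sublevel_product:
  fixes a :: "nat \<Rightarrow> complex"
  assumes k: "k > 0" and T: "T \<in> sets borel" "T \<subseteq> {1/2..1}" and l: "l > 0"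
    and le: "\<And>t. t \<in> T \<Longrightarrow> (\<Prod>i<k. norm (complex_of_real t - a i)) \<le> l ^ k"
  shows "measure lborel T \<le> 5 * sqrt l"
proof -
  \<comment> \<open>Since \<open>0 powr (-1/2)\<close> is 0, the pointwise bound can fail at the
    real parts of the \<open>a i\<close>; this finite set is removed.\<close>
  define T' where "T' = T - (\<lambda>i. Re (a i)) ` {..<k}"
  have T'b: "T' \<in> sets borel" using T(1) unfolding T'_def by (intro sets.Diff) (auto intro!: borel_closed finite_imp_closed)
  have pt: "ennreal (real k * l powr (-1/2)) * indicator T' t
      \<le> (\<Sum>i<k. ennreal (\<bar>t - Re (a i)\<bar> powr (-1/2)) * indicator {1/2..1} t)" for t
  proof (cases "t \<in> T'")
    case True
    hence tT: "t \<in> T" "t \<in> {1/2..1}" and tn: "\<And>i. i < k \<Longrightarrow> t \<noteq> Re (a i)" using T by (auto simp: T'_def)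
    define P where "P = (\<Prod>i<k. \<bar>t - Re (a i)\<bar>)"
    have Ppos: "P > 0" unfolding P_def using tn by (intro prod_pos) auto
    have "P \<le> (\<Prod>i<k. norm (complex_of_real t - a i))"
      unfolding P_def by (intro prod_mono) (auto intro: order_trans[OF _ abs_Re_le_cmod])
    also have "\<dots> \<le> l^k" using le tT by auto
    finally have PL: "P \<le> l^k" .
    have e1: "l powr (-1/2) = ((l^k) powr (-1/2)) powr (1/k)"
      using l k by (simp add: powr_powr powr_realpow[symmetric])
    have "\<dots> \<le> (P powr (-1/2)) powr (1/k)"
      using PL Ppos l by (intro powr_mono2 powr_mono2') auto
    also have "P powr (-1/2) = (\<Prod>i<k. \<bar>t - Re (a i)\<bar> powr (-1/2))"
      unfolding P_def by (simp add: prod_powr_distrib)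
    also have "(\<Prod>i<k. \<bar>t - Re (a i)\<bar> powr (-1/2)) powr (1/k) \<le> (\<Sum>i<k. \<bar>t - Re (a i)\<bar> powr (-1/2) / k)"
      using arith_geom_mean[of "{..<k}" "\<lambda>i. \<bar>t - Re (a i)\<bar> powr (-1/2)"] k by auto
    finally have "l powr (-1/2) \<le> (\<Sum>i<k. \<bar>t - Re (a i)\<bar> powr (-1/2)) / k"
      using e1 by (simp add: sum_divide_distrib)
    hence "real k * l powr (-1/2) \<le> (\<Sum>i<k. \<bar>t - Re (a i)\<bar> powr (-1/2))"
      using k by (simp add: field_simps)
    thus ?thesis using True tT by (simp add: sum_ennreal ennreal_leI)
  qed simp
  have fin: "emeasure lborel T \<noteq> \<infinity>"
    using emeasure_mono[OF T(2), of lborel] by (auto simp: top_unique)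
  have "T - T' \<in> null_sets lborel"
    by (rule null_sets_subset[OF finite_imp_null_set_lborel[of "(\<lambda>i. Re (a i)) ` {..<k}"]])
       (use T T'b in \<open>auto simp: T'_def\<close>)
  hence "emeasure lborel T = emeasure lborel T'"
    using emeasure_Un_null_set[of T' lborel "T - T'"] T'b by (simp add: T'_def Un_absorb1 Un_Diff_cancel2)
  hence m: "emeasure lborel T' = ennreal (measure lborel T)" using fin
    by (metis emeasure_eq_ennreal_measure infinity_ennreal_def)
  have "ennreal (real k * l powr (-1/2)) * emeasure lborel T'
     = (\<integral>\<^sup>+t. ennreal (real k * l powr (-1/2)) * indicator T' t \<partial>lborel)"
    using T'b by (simp add: nn_integral_cmult_indicator)
  also have "\<dots> \<le> (\<integral>\<^sup>+t. (\<Sum>i<k. ennreal (\<bar>t - Re (a i)\<bar> powr (-1/2)) * indicator {1/2..1} t) \<partial>lborel)"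
    by (intro nn_integral_mono pt)
  also have "\<dots> = (\<Sum>i<k. \<integral>\<^sup>+t. ennreal (\<bar>t - Re (a i)\<bar> powr (-1/2)) * indicator {1/2..1} t \<partial>lborel)"
    by (intro nn_integral_sum) auto
  also have "\<dots> \<le> (\<Sum>i<k. 5)" by (intro sum_mono nn_integral_inverse_sqrt_le)
  also have "\<dots> = ennreal (5 * real k)" by (simp add: ennreal_mult' mult.commute ennreal_of_nat_eq_real_of_nat)
  finally have "ennreal (real k * l powr (-1/2) * measure lborel T) \<le> ennreal (5 * real k)"
    using m by (simp add: ennreal_mult')
  hence "real k * l powr (-1/2) * measure lborel T \<le> 5 * real k" by simp
  hence "l powr (-1/2) * measure lborel T \<le> 5" using k by (simp add: mult.assoc)
  moreover have "l powr (-1/2) = inverse (sqrt l)"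
    using l by (simp add: powr_minus powr_half_sqrt)
  ultimately have "inverse (sqrt l) * measure lborel T \<le> 5" by simp
  thus ?thesis using l by (simp add: inverse_eq_divide divide_le_eq)
qed

text \<open>After division by the zeros, Harnack bounds the zero-free factor below by (1/32)^N on
  \<open>T\<close>. So the product of the at most \<open>N\<close> distances to the zeros is at most
  m * 128^N there, and the sublevel estimate turns this into a bound on the length of
  \<open>T\<close>. Here 32 = 8 * 4 comes from the cube and the quarter in the Harnack bound, and
  128 = 4 * 32 includes the normalising factors 4.\<close>

lemma Remez_holomorphic_aux:
  fixes F :: "complex \<Rightarrow> complex"
  assumes hol: "F holomorphic_on ball 0 8" and F1: "\<And>z. z \<in> cball 0 6 \<Longrightarrow> norm (F z) \<le> 1"
    and T: "T \<in> sets borel" "T \<subseteq> {1/2..1}" and kT: "\<kappa> \<le> measure lborel T" and k0: "0 < \<kappa>"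
    and N: "N > 0" "(1/2)^N \<le> norm (F 0)" and m: "m > 0" and Fm: "\<And>t. t \<in> T \<Longrightarrow> norm (F (complex_of_real t)) \<le> m"
  shows "((\<kappa>/5)^2 / 128) ^ N \<le> m"
proof -
  obtain as G where asG: "length as \<le> N" "G holomorphic_on ball 0 8"
      "\<forall>z\<in>cball 0 6. norm (G z) \<le> 1" "\<forall>z\<in>ball 0 2. G z \<noteq> 0" "(1/2)^N \<le> norm (G 0)"
      "\<forall>z\<in>ball 0 8. F z = (\<Prod>i<length as. (z - as ! i) / 4) * G z"
    using divide_out_zeros[OF hol F1 N(2)] by blast
  define k where "k = length as"
  have kap1: "\<kappa> \<le> 1"
  proof -
    have "measure lborel T \<le> measure lborel {1/2..1::real}"
      by (rule measure_mono_fmeasurable) (use T in \<open>auto intro!: fmeasurable_compact\<close>)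
    thus ?thesis using kT by simp
  qed
  have Glow: "(1/32)^N \<le> norm (G (complex_of_real t))" if "t \<in> {1/2..1}" for t
  proof -
    have "norm (G 0) ^ 3 / 4 \<le> norm (G (complex_of_real t))"
      by (rule Harnack_norm_lower_bound) (use asG that in \<open>auto intro: holomorphic_on_subset\<close>)
    moreover have "((1/2)^N)^3 \<le> norm (G 0) ^ 3" using asG(5) by (intro power_mono) auto
    moreover have "((1/2::real)^N)^3 = (1/8)^N" by (simp add: power3_eq_cube power_mult_distrib[symmetric])
    moreover have "(1/32::real)^N \<le> (1/8)^N / 4"
    proof -
      have "(1/32::real)^N = (1/8)^N * (1/4)^N" by (simp add: power_mult_distrib[symmetric])
      also have "(1/4::real)^N \<le> (1/4)^1" using N(1) by (intro power_decreasing) auto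
      finally show ?thesis by simp
    qed
    ultimately show ?thesis by linarith
  qed
  have prodle: "(\<Prod>i<k. norm (complex_of_real t - as ! i)) \<le> m * 128 ^ N" if "t \<in> T" for t
  proof -
    have t: "t \<in> {1/2..1}" using that T by auto
    have "(\<Prod>i<k. norm (complex_of_real t - as ! i)) = 4^k * (\<Prod>i<k. norm ((complex_of_real t - as ! i)/4))"
      by (simp add: norm_divide prod_dividef)
    moreover have "(\<Prod>i<k. norm ((complex_of_real t - as ! i)/4)) * norm (G (complex_of_real t)) = norm (F (complex_of_real t))"
      using asG(6) t by (simp add: norm_mult k_def prod_norm[symmetric])
    ultimately have "(\<Prod>i<k. norm (complex_of_real t - as ! i)) * norm (G (complex_of_real t)) \<le> 4^k * m"
      using Fm[OF that] by (simp add: mult.assoc)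
    moreover have "(\<Prod>i<k. norm (complex_of_real t - as ! i)) * (1/32)^N \<le>
       (\<Prod>i<k. norm (complex_of_real t - as ! i)) * norm (G (complex_of_real t))"
      by (intro mult_left_mono Glow t prod_nonneg) auto
    moreover have "4^k * m \<le> 4^N * m" using asG(1) m by (intro mult_right_mono power_increasing) (auto simp: k_def)
    ultimately have "(\<Prod>i<k. norm (complex_of_real t - as ! i)) * (1/32)^N \<le> 4^N * m" by linarith
    hence "(\<Prod>i<k. norm (complex_of_real t - as ! i)) * (1/32)^N * 32^N \<le> 4^N * m * 32^N"
      by (intro mult_right_mono) auto
    moreover have e1: "(1/32::real)^N * 32^N = 1" by (simp add: power_mult_distrib[symmetric])
    moreover have e2: "(4::real)^N * 32^N = 128^N" by (simp add: power_mult_distrib[symmetric])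
    ultimately have "(\<Prod>i<k. norm (complex_of_real t - as ! i)) * ((1/32)^N * 32^N) \<le> m * (4^N * 32^N)"
      by argo
    thus ?thesis by (simp only: e1 e2 mult_1_right)
  qed
  have "((\<kappa>/5)^2)^N \<le> m * 128^N"
  proof (cases "k = 0")
    case True
    have "T \<noteq> {}" using kT k0 by auto
    then obtain t where "t \<in> T" by auto
    from prodle[OF this] True have "1 \<le> m * 128^N" by simp
    moreover have "((\<kappa>/5)^2)^N \<le> 1" using kap1 k0 by (intro power_le_one) (auto simp: power_le_one)
    ultimately show ?thesis by linarith
  next
    case False
    define l where "l = root k (m * 128^N)"
    have l: "l > 0" "l^k = m * 128^N" using m False by (auto simp: l_def)
    have "measure lborel T \<le> 5 * sqrt l"
      by (rule measure_sublevel_product[of k T l "\<lambda>i. as ! i"]) (use False T l prodle in auto)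
    hence "\<kappa>/5 \<le> sqrt l" using kT by simp
    hence "(\<kappa>/5)^2 \<le> l" using l k0 by (metis real_le_rsqrt real_sqrt_le_iff real_sqrt_unique power_mono real_sqrt_pow2 less_imp_le divide_nonneg_pos zero_less_numeral)
    hence "((\<kappa>/5)^2)^k \<le> l^k" by (intro power_mono) auto
    moreover have "((\<kappa>/5)^2)^N \<le> ((\<kappa>/5)^2)^k"
      using kap1 k0 asG(1) by (intro power_decreasing) (auto simp: k_def power_le_one)
    ultimately show ?thesis using l by simp
  qed
  thus ?thesis by (simp add: power_divide divide_le_eq power_mult_distrib[symmetric] mult.assoc)
qed

text \<open>The dependence on the density \<open>\<kappa>\<close> is polynomial because \<open>N\<close> is determined by \<open>\<epsilon>\<close> alone.\<close>

lemma Remez_holomorphic: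
  fixes \<epsilon> :: real
  assumes "0 < \<epsilon>"
  obtains K q :: real where "K \<ge> 1" "q > 0"
    "\<And>\<kappa> F T m M. F holomorphic_on ball 0 8 \<Longrightarrow> (\<And>z. z \<in> ball 0 8 \<Longrightarrow> norm (F z) \<le> M) \<Longrightarrow>
       T \<in> sets borel \<Longrightarrow> T \<subseteq> {1/2..1} \<Longrightarrow> 0 < \<kappa> \<Longrightarrow> \<kappa> \<le> measure lborel T \<Longrightarrow>
       (\<And>t. t \<in> T \<Longrightarrow> norm (F (complex_of_real t)) \<le> m) \<Longrightarrow>
       norm (F 0) \<le> K * \<kappa> powr (-q) * m + \<epsilon> * M"
proof -
  obtain n where n: "(1/2)^n < \<epsilon>" using real_arch_pow_inv[of \<epsilon> "1/2"] assms by auto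
  define N where "N = Suc n"
  have N: "N > 0" "(1/2)^N \<le> \<epsilon>"
    using n power_decreasing[of n N "1/2::real"] unfolding N_def by (simp, linarith)
  show thesis
  proof (rule that[of "3200^N" "2 * real N"])
    fix \<kappa> F T m M
    assume hol: "F holomorphic_on ball 0 8" and FM: "\<And>z. z \<in> ball 0 8 \<Longrightarrow> norm (F z) \<le> M"
      and T: "T \<in> sets borel" "T \<subseteq> {1/2..1}" and k: "0 < \<kappa>" "\<kappa> \<le> measure lborel T"
      and Fm: "\<And>t. t \<in> T \<Longrightarrow> norm (F (complex_of_real t)) \<le> m"
    have "T \<noteq> {}" using k by auto
    hence m0: "m \<ge> 0" using Fm norm_ge_zero order_trans by blast
    have M0: "M \<ge> 0" using FM[of 0] norm_ge_zero[of "F 0"] by (simp del: norm_ge_zero)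
    show "norm (F 0) \<le> 3200^N * \<kappa> powr (- (2 * real N)) * m + \<epsilon> * M"
    \<comment> \<open>If the value at 0 exceeds \<epsilon> M, then F / M has modulus at least 2^-N
      there, so at most \<open>N\<close> zeros have to be divided out, with \<open>N\<close>
      independent of \<kappa> and \<open>T\<close>.\<close>
    proof (cases "norm (F 0) \<le> \<epsilon> * M")
      case True
      thus ?thesis using m0 by (simp add: add_increasing)
    next
      case False
      hence "M \<noteq> 0" using FM[of 0] by auto
      hence Mp: "M > 0" using M0 by simp
      \<comment> \<open>The slack \<open>e\<close> covers \<open>m = 0\<close>, because the
        auxiliary bound requires a positive \<open>m\<close>. The constant 3200 is 25 * 128.\<close>
      have "((\<kappa>/5)^2 / 128) ^ N \<le> m / M + e" if "e > 0" for e
      proof (rule Remez_holomorphic_aux[of "\<lambda>z. F z / of_real M" T \<kappa>])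
        show "(\<lambda>z. F z / of_real M) holomorphic_on ball 0 8"
          using hol Mp by (intro holomorphic_intros) auto
        show "norm (F z / of_real M) \<le> 1" if "z \<in> cball 0 6" for z
          using FM[of z] that Mp by (simp add: norm_divide)
        have "(1/2)^N * M \<le> norm (F 0)" using N(2) False Mp mult_right_mono[of "(1/2)^N" \<epsilon> M] by linarith
        thus "(1/2)^N \<le> norm (F 0 / of_real M)" using Mp by (simp add: norm_divide field_simps)
        show "0 < m / M + e" using m0 Mp that by (simp add: add_nonneg_pos)
        show "norm (F (complex_of_real t) / of_real M) \<le> m / M + e" if "t \<in> T" for t
          using divide_right_mono[OF Fm[OF that], of M] Mp \<open>e > 0\<close> by (simp add: norm_divide)
      qed (use T k N in auto)
      hence "((\<kappa>/5)^2 / 128) ^ N \<le> m / M" by (rule field_le_epsilon)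
      moreover have "((\<kappa>/5)^2 / 128) ^ N = \<kappa> powr (2 * real N) / 3200^N"
      proof -
        have "\<kappa> powr (2 * real N) = (\<kappa>^2)^N"
          using k powr_realpow[of \<kappa> "2*N"] by (simp add: power_mult)
        thus ?thesis by (simp add: power_divide power_mult_distrib[symmetric])
      qed
      ultimately have "M \<le> 3200^N * \<kappa> powr (- (2 * real N)) * m"
        using k Mp by (simp add: powr_minus field_simps)
      moreover have "norm (F 0) \<le> M" using FM[of 0] by simp
      moreover have "0 \<le> \<epsilon> * M" using assms Mp by simp
      ultimately show ?thesis by linarith
    qed
  qed (use N in auto)
qed

section \<open>Propagation of smallness in a complex norm ball\<close>

lemma scaleR_eq_scalar_mult: "r *\<^sub>R v = complex_of_real r *s (v :: complex ^ 'n)"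
  by (simp add: vec_eq_iff scaleR_conv_of_real[where 'a = complex])

lemma norm_scalar_mult: "norm (c *s v) = norm c * norm (v :: complex ^ 'n)"
  by (simp add: norm_vec_def norm_mult L2_set_right_distrib)

lemma bounded_linear_scalar_mult_left: "bounded_linear (\<lambda>c::complex. c *s (v :: complex ^ 'n))"
  by (rule bounded_linear_intro[where K = "norm v"])
     (auto simp: vec_eq_iff algebra_simps norm_scalar_mult)

lemma ray_preimage_borel:
  fixes x v :: "'a::euclidean_space"
  assumes "S \<in> sets borel"
  shows "{t \<in> {a..b::real}. x + t *\<^sub>R v \<in> S} \<in> sets borel"
proof -
  have "(\<lambda>t::real. x + t *\<^sub>R v) \<in> borel_measurable borel" by simp
  hence "(\<lambda>t::real. x + t *\<^sub>R v) -` S \<inter> space borel \<in> sets borel" using assms by (rule measurable_sets)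
  moreover have "{t \<in> {a..b}. x + t *\<^sub>R v \<in> S} = {a..b} \<inter> ((\<lambda>t::real. x + t *\<^sub>R v) -` S \<inter> space borel)" by auto
  ultimately show ?thesis by auto
qed

text \<open>Homogeneity over complex scalars makes the balls balanced: a complex line through the
  centre of a ball meets it in a disc, where the one-variable estimate applies. \<open>lower\<close>
  and \<open>upper\<close> give equivalence with the Euclidean norm, hence continuity and finite
  positive volumes.\<close>

locale complex_norm =
  fixes N :: "complex ^ 'n::finite \<Rightarrow> real"
  assumes add: "N (v + w) \<le> N v + N w"
    and scale: "N (c *s v) = norm c * N v"
    and lower: "\<exists>c. \<forall>v. norm v \<le> c * N v"
    and upper: "\<exists>c. \<forall>v. N v \<le> c * norm v"
begin

definition Nball :: "complex ^ 'n \<Rightarrow> real \<Rightarrow> (complex ^ 'n) set" where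
  "Nball x s = {w. N (w - x) < s}"

lemma scaleR: "N (r *\<^sub>R v) = \<bar>r\<bar> * N v"
  by (simp add: scaleR_eq_scalar_mult scale)

lemma zero [simp]: "N 0 = 0" using scaleR[of 0 0] by simp

lemma minus: "N (- v) = N v" using scaleR[of "-1" v] by simp

lemma minus_commute: "N (v - w) = N (w - v)" using minus[of "v - w"] by simp

lemma nonneg [simp]: "0 \<le> N v"
  using add[of v "- v"] by (simp add: minus)

lemma triangle: "N (x - z) \<le> N (x - y) + N (y - z)"
  using add[of "x - y" "y - z"] by simp

lemma continuous: "continuous_on A N"
proof -
  obtain c where c: "\<And>v. N v \<le> c * norm v" using upper by auto
  have "\<bar>N x - N y\<bar> \<le> (\<bar>c\<bar> + 1) * norm (x - y)" for x y
  proof -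
    have "\<bar>N x - N y\<bar> \<le> N (x - y)"
      using add[of "x - y" y] add[of "y - x" x] minus_commute[of x y] by (simp add: abs_le_iff)
    also have "\<dots> \<le> c * norm (x - y)" by (rule c)
    also have "\<dots> \<le> (\<bar>c\<bar> + 1) * norm (x - y)" by (intro mult_right_mono) auto
    finally show ?thesis .
  qed
  hence "(\<bar>c\<bar> + 1)-lipschitz_on A N"
    by (intro lipschitz_onI) (auto simp: dist_norm dist_real_def)
  thus ?thesis by (rule lipschitz_on_continuous_on)
qed

lemma continuous_dist: "continuous_on A (\<lambda>w. N (w - x))"
  by (rule continuous_on_compose2[OF continuous[of UNIV]]) (auto intro!: continuous_intros)

lemma open_Nball: "open (Nball x s)"
  unfolding Nball_def by (intro open_Collect_less continuous_dist continuous_intros)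

lemma bounded_le: "bounded {w. N (w - x) \<le> s}"
proof -
  obtain c where c: "\<And>v. norm v \<le> c * N v" using lower by auto
  have "dist x w \<le> \<bar>c\<bar> * s" if "N (w - x) \<le> s" for w
  proof -
    have "norm (w - x) \<le> c * N (w - x)" by (rule c)
    also have "\<dots> \<le> \<bar>c\<bar> * N (w - x)" by (intro mult_right_mono) auto
    also have "\<dots> \<le> \<bar>c\<bar> * s" using that by (intro mult_left_mono) auto
    finally show ?thesis by (simp add: dist_norm norm_minus_commute)
  qed
  thus ?thesis unfolding bounded_def by blast
qed

lemma compact_le: "compact {w. N (w - x) \<le> s}"
  unfolding compact_eq_bounded_closed
  by (intro conjI bounded_le closed_Collect_le continuous_dist continuous_intros)

lemma Nball_borel [measurable]: "Nball x s \<in> sets borel" using open_Nball by (rule borel_open)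

lemma Nball_finite: "emeasure lborel (Nball x s) < \<infinity>"
proof -
  have "emeasure lborel (Nball x s) \<le> emeasure lborel {w. N (w - x) \<le> s}"
    by (intro emeasure_mono) (auto simp: Nball_def intro!: borel_closed closed_Collect_le continuous_dist continuous_intros)
  also have "\<dots> < \<infinity>" using compact_le by (rule emeasure_compact_finite)
  finally show ?thesis .
qed

lemma emeasure_Nball: "emeasure lborel (Nball x s) = ennreal (measure lborel (Nball x s))"
  using Nball_finite[of x s] by (simp add: emeasure_eq_ennreal_measure less_top)

lemma Nball_affine: assumes "s > 0" shows "Nball x s = (\<lambda>v. s *\<^sub>R v + x) ` Nball 0 1"
proof
  show "Nball x s \<subseteq> (\<lambda>v. s *\<^sub>R v + x) ` Nball 0 1"
  proof
    fix w assume "w \<in> Nball x s"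
    hence "(1/s) *\<^sub>R (w - x) \<in> Nball 0 1" using assms by (simp add: Nball_def scaleR)
    moreover have "w = s *\<^sub>R ((1/s) *\<^sub>R (w - x)) + x" using assms by simp
    ultimately show "w \<in> (\<lambda>v. s *\<^sub>R v + x) ` Nball 0 1" by blast
  qed
qed (use assms in \<open>auto simp: Nball_def scaleR\<close>)

lemma measure_Nball:
  assumes "s > 0"
  shows "measure lborel (Nball x s) = s ^ DIM(complex ^ 'n) * measure lborel (Nball 0 1)"
  unfolding Nball_affine[OF assms, of x]
  using measure_lebesgue_affine[of s x "Nball 0 1"] assms
  by (simp add: Nball_affine[OF assms, of x, symmetric])

lemma measure_Nball_pos: "s > 0 \<Longrightarrow> measure lborel (Nball x s) > 0"
proof -
  assume s: "s > 0"
  have "x \<in> Nball x s" using s by (simp add: Nball_def)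
  then obtain e where e: "e > 0" "ball x e \<subseteq> Nball x s" using open_Nball open_contains_ball by blast
  have "0 < measure lborel (ball x e)" using e content_ball_pos by simp
  also have "\<dots> \<le> measure lborel (Nball x s)"
    by (rule measure_mono_fmeasurable[OF e(2)]) (use Nball_finite[of x s] in \<open>auto simp: fmeasurable_def\<close>)
  finally show ?thesis .
qed

text \<open>Fubini for the indicator of \<open>S\<close> at \<open>x + t *\<^sub>R v\<close>. For
  fixed \<open>t\<close> the map from \<open>v\<close> has Jacobian t^d \<le> 1; as t \<ge> 1/2,
  only \<open>v\<close> with \<open>N v < 2 * s\<close> can hit \<open>S\<close>, and these fill 2^d
  times the volume of the ball. If all rays met \<open>S\<close> in length below the claimed bound,
  averaging would give \<open>S\<close> at most half of the required measure.\<close>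

lemma exists_good_ray:
  assumes S: "S \<in> sets borel" "S \<subseteq> Nball x s" and s: "s > 0" and g: "\<gamma> > 0"
    and dens: "\<gamma> * measure lborel (Nball x s) \<le> measure lborel S"
  shows "\<exists>v. N v < 2 * s \<and>
    \<gamma> / 2 ^ (DIM(complex ^ 'n) + 2) \<le> measure lborel {t \<in> {1/2..1::real}. x + t *\<^sub>R v \<in> S}"
proof (rule ccontr)
  define d where "d = DIM(complex ^ 'n)"
  let ?d = d
  define \<kappa> where "\<kappa> = \<gamma> / 2 ^ (?d + 2)"
  define b where "b = measure lborel (Nball x s)"
  assume neg: "\<not> ?thesis"
  have k: "\<kappa> > 0" using g by (simp add: \<kappa>_def)
  have Tb: "{t \<in> {1/2..1::real}. x + t *\<^sub>R v \<in> S} \<in> sets borel" for v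
    using S(1) by (rule ray_preimage_borel)
  have sl: "emeasure lborel {t \<in> {1/2..1::real}. x + t *\<^sub>R v \<in> S} \<le> ennreal \<kappa>" if "N v < 2 * s" for v
  proof -
    have "emeasure lborel {t \<in> {1/2..1::real}. x + t *\<^sub>R v \<in> S} \<le> emeasure lborel {1/2..1::real}"
      by (intro emeasure_mono) auto
    hence "emeasure lborel {t \<in> {1/2..1::real}. x + t *\<^sub>R v \<in> S} \<noteq> \<infinity>" by (auto simp: top_unique)
    hence "emeasure lborel {t \<in> {1/2..1::real}. x + t *\<^sub>R v \<in> S}
        = ennreal (measure lborel {t \<in> {1/2..1::real}. x + t *\<^sub>R v \<in> S})"
      by (simp add: emeasure_eq_ennreal_measure)
    moreover have "\<not> \<kappa> \<le> measure lborel {t \<in> {1/2..1::real}. x + t *\<^sub>R v \<in> S}"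
      using neg that unfolding \<kappa>_def d_def by blast
    ultimately show ?thesis by (simp add: ennreal_leI)
  qed
  have Sind: "(\<lambda>(v, t::real). indicator {1/2..1} t * indicator S (x + t *\<^sub>R v) :: ennreal)
     \<in> borel_measurable (lborel \<Otimes>\<^sub>M lborel)"
  proof -
    have "(\<lambda>p::(complex^'n) \<times> real. x + snd p *\<^sub>R fst p) \<in> measurable (lborel \<Otimes>\<^sub>M lborel) borel"
      by measurable
    from measurable_compose[OF this, of "indicator S" borel] S(1)
    show ?thesis by (simp add: case_prod_beta') measurable
  qed
  have "emeasure lborel S \<le> (\<integral>\<^sup>+v. indicator S (x + t *\<^sub>R v) \<partial>lborel)" if t: "t \<in> {1/2..1}" for t :: real
  proof -
    have t0: "t \<noteq> 0" using t by auto
    have "emeasure lborel S = emeasure (density (distr lborel borel (\<lambda>v. x + t *\<^sub>R v)) (\<lambda>_. \<bar>t\<bar>^?d)) S"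
      by (subst lborel_affine[OF t0, of x]) (simp add: d_def)
    also have "\<dots> = (\<integral>\<^sup>+w. ennreal (\<bar>t\<bar>^?d) * indicator S w \<partial>distr lborel borel (\<lambda>v. x + t *\<^sub>R v))"
      using S(1) by (subst emeasure_density) auto
    also have "\<dots> = (\<integral>\<^sup>+v. ennreal (\<bar>t\<bar>^?d) * indicator S (x + t *\<^sub>R v) \<partial>lborel)"
      using S(1) by (subst nn_integral_distr) auto
    also have "\<dots> = ennreal (\<bar>t\<bar>^?d) * (\<integral>\<^sup>+v. indicator S (x + t *\<^sub>R v) \<partial>lborel)"
    proof (rule nn_integral_cmult)
      have "(\<lambda>v. x + t *\<^sub>R v) \<in> measurable lborel borel" by simp
      from measurable_compose[OF this, of "indicator S"] S(1)
      show "(\<lambda>v. indicator S (x + t *\<^sub>R v) :: ennreal) \<in> borel_measurable lborel" by auto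
    qed
    also have "\<dots> \<le> 1 * (\<integral>\<^sup>+v. indicator S (x + t *\<^sub>R v) \<partial>lborel)"
      using t by (intro mult_right_mono) (auto simp: ennreal_le_1 power_le_one)
    finally show ?thesis by simp
  qed
  hence "(\<integral>\<^sup>+t. emeasure lborel S * indicator {1/2..1::real} t \<partial>lborel)
    \<le> (\<integral>\<^sup>+t. (\<integral>\<^sup>+v. indicator {1/2..1} t * indicator S (x + t *\<^sub>R v) \<partial>lborel) \<partial>lborel)"
    by (intro nn_integral_mono) (auto split: split_indicator)
  also have "\<dots> = (\<integral>\<^sup>+v. (\<integral>\<^sup>+t. indicator {1/2..1::real} t * indicator S (x + t *\<^sub>R v) \<partial>lborel) \<partial>lborel)"
    using lborel_pair.Fubini'[OF Sind] by simp
  also have "\<dots> \<le> (\<integral>\<^sup>+v. ennreal \<kappa> * indicator (Nball 0 (2 * s)) v \<partial>lborel)"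
  proof (rule nn_integral_mono)
    fix v :: "complex ^ 'n"
    have "(\<integral>\<^sup>+t. indicator {1/2..1::real} t * indicator S (x + t *\<^sub>R v) \<partial>lborel)
       = (\<integral>\<^sup>+t. indicator {t \<in> {1/2..1::real}. x + t *\<^sub>R v \<in> S} t \<partial>lborel)"
      by (intro nn_integral_cong) (auto split: split_indicator)
    also have "\<dots> = emeasure lborel {t \<in> {1/2..1::real}. x + t *\<^sub>R v \<in> S}"
      using Tb by simp
    finally have e: "(\<integral>\<^sup>+t. indicator {1/2..1::real} t * indicator S (x + t *\<^sub>R v) \<partial>lborel)
       = emeasure lborel {t \<in> {1/2..1::real}. x + t *\<^sub>R v \<in> S}" .
    show "(\<integral>\<^sup>+t. indicator {1/2..1::real} t * indicator S (x + t *\<^sub>R v) \<partial>lborel)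
       \<le> ennreal \<kappa> * indicator (Nball 0 (2 * s)) v"
    proof (cases "N v < 2 * s")
      case True
      thus ?thesis unfolding e using sl[OF True] by (simp add: Nball_def)
    next
      case False
      have "x + t *\<^sub>R v \<notin> S" if "t \<in> {1/2..1}" for t :: real
      proof
        assume "x + t *\<^sub>R v \<in> S"
        hence "N (t *\<^sub>R v) < s" using S(2) by (auto simp: Nball_def)
        hence "t * N v < s" using that by (simp add: scaleR)
        moreover have "1/2 * N v \<le> t * N v" using that by (intro mult_right_mono) auto
        ultimately show False using False by simp
      qed
      hence "{t \<in> {1/2..1::real}. x + t *\<^sub>R v \<in> S} = {}" by auto
      thus ?thesis unfolding e by (simp only: emeasure_empty zero_le)
    qed
  qed
  also have "\<dots> = ennreal \<kappa> * emeasure lborel (Nball 0 (2 * s))"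
    by (simp add: nn_integral_cmult_indicator)
  also have "\<dots> = ennreal (\<kappa> * (2^?d * b))"
  proof -
    have "measure lborel (Nball 0 (2 * s)) = 2 ^ d * b"
      using measure_Nball[of "2 * s" 0, folded d_def] measure_Nball[of s x, folded d_def] s
      by (simp add: b_def power_mult_distrib)
    thus ?thesis using ennreal_mult'[of \<kappa> "2 ^ d * b"] k by (simp only: emeasure_Nball less_imp_le)
  qed
  also have "(\<integral>\<^sup>+t. emeasure lborel S * indicator {1/2..1::real} t \<partial>lborel) = emeasure lborel S * ennreal (1/2)"
    by (subst nn_integral_cmult_indicator) (auto simp del: ennreal_half)
  also have "emeasure lborel S = ennreal (measure lborel S)"
    using emeasure_mono[OF S(2), of lborel] Nball_finite[of x s]
    by (intro emeasure_eq_ennreal_measure) (auto simp: top_unique)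
  finally have le: "ennreal (measure lborel S) * ennreal (1/2) \<le> ennreal (\<kappa> * (2^?d * b))" .
  have "ennreal (measure lborel S * (1/2)) \<le> ennreal (\<kappa> * (2^?d * b))"
    by (subst ennreal_mult'', simp, rule le)
  hence "measure lborel S / 2 \<le> \<kappa> * (2^?d * b)"
    using k by (subst (asm) ennreal_le_iff) (auto simp: b_def)
  moreover have "\<kappa> * (2^?d * b) = \<gamma> * b / 4" by (simp add: \<kappa>_def)
  moreover have "0 < \<gamma> * b" using g measure_Nball_pos[OF s] by (simp add: b_def)
  ultimately show False using dens by (simp add: b_def[symmetric])
qed

end

lemma holomorphic_on_Cn_subset: "holomorphic_on_Cn f U \<Longrightarrow> V \<subseteq> U \<Longrightarrow> holomorphic_on_Cn f V"
  by (auto simp: holomorphic_on_Cn_def)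

lemma holomorphic_on_Cn_continuous: "holomorphic_on_Cn f U \<Longrightarrow> continuous_on U f"
  unfolding holomorphic_on_Cn_def
  by (metis continuous_at_imp_continuous_on has_derivative_continuous)

lemma holomorphic_on_Cn_line:
  assumes "holomorphic_on_Cn f U" "\<And>\<zeta>. \<zeta> \<in> B \<Longrightarrow> x + \<zeta> *s v \<in> U"
  shows "(\<lambda>\<zeta>. f (x + \<zeta> *s v)) holomorphic_on B"
proof (rule holomorphic_onI)
  fix \<zeta> assume "\<zeta> \<in> B"
  then obtain f' where f': "(f has_derivative f') (at (x + \<zeta> *s v))" "\<And>c u. f' (c *s u) = c * f' u"
    using assms unfolding holomorphic_on_Cn_def by blast
  have "((\<lambda>\<zeta>. x + \<zeta> *s v) has_derivative (\<lambda>c. c *s v)) (at \<zeta>)"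
    using has_derivative_add[OF has_derivative_const[of x] bounded_linear_imp_has_derivative[OF bounded_linear_scalar_mult_left]] by simp
  from diff_chain_at[OF this f'(1)]
  have "((\<lambda>\<zeta>. f (x + \<zeta> *s v)) has_derivative (\<lambda>c. f' v * c)) (at \<zeta>)"
    by (simp add: o_def f'(2) mult.commute)
  thus "(\<lambda>\<zeta>. f (x + \<zeta> *s v)) field_differentiable at \<zeta> within B"
    using has_field_derivative_def field_differentiable_def field_differentiable_at_within by blast
qed

text \<open>The one-variable estimate is used on the complex line through \<open>x\<close> along a
  good ray \<open>v\<close>; |\<zeta>| < 8 and \<open>N v < 2 * s\<close> explain the radius
  \<open>16 * s\<close>. The density lost in passing to the ray is the dimensional constant
  \<open>c\<close>, so \<open>K\<close> and \<open>q\<close> are the same for all norms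
  \<open>N\<close>.\<close>

lemma Remez_Nball:
  fixes \<epsilon> :: real
  assumes "0 < \<epsilon>"
  obtains K q :: real where "K \<ge> 1" "q > 0"
    "\<And>N f x s S \<gamma> m M. complex_norm (N :: complex ^ 'n::finite \<Rightarrow> real) \<Longrightarrow> 0 < s \<Longrightarrow>
       holomorphic_on_Cn f (complex_norm.Nball N x (16 * s)) \<Longrightarrow>
       (\<And>w. N (w - x) < 16 * s \<Longrightarrow> norm (f w) \<le> M) \<Longrightarrow>
       S \<in> sets borel \<Longrightarrow> S \<subseteq> complex_norm.Nball N x s \<Longrightarrow> 0 < \<gamma> \<Longrightarrow>
       \<gamma> * measure lborel (complex_norm.Nball N x s) \<le> measure lborel S \<Longrightarrow>
       (\<And>w. w \<in> S \<Longrightarrow> norm (f w) \<le> m) \<Longrightarrow>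
       norm (f x) \<le> K * \<gamma> powr (-q) * m + \<epsilon> * M"
proof -
  obtain K q where Kq: "K \<ge> 1" "q > 0"
    and R: "\<And>\<kappa> F T m M. F holomorphic_on ball 0 8 \<Longrightarrow> (\<And>z. z \<in> ball 0 8 \<Longrightarrow> norm (F z) \<le> M) \<Longrightarrow>
       T \<in> sets borel \<Longrightarrow> T \<subseteq> {1/2..1} \<Longrightarrow> 0 < \<kappa> \<Longrightarrow> \<kappa> \<le> measure lborel T \<Longrightarrow>
       (\<And>t. t \<in> T \<Longrightarrow> norm (F (complex_of_real t)) \<le> m) \<Longrightarrow>
       norm (F 0) \<le> K * \<kappa> powr (-q) * m + \<epsilon> * M"
    using Remez_holomorphic[OF assms] by blast
  define c where "c = (2::real) ^ (DIM(complex ^ 'n) + 2)"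
  have c1: "c \<ge> 1" unfolding c_def by (rule one_le_power) simp
  show thesis
  proof (rule that[of "K * c powr q" q])
    show "1 \<le> K * c powr q" using mult_mono[of 1 K 1 "c powr q"] ge_one_powr_ge_zero[of c q] Kq c1 by simp
    fix N :: "complex ^ 'n \<Rightarrow> real" and f x and s :: real and S \<gamma> m M
    assume N: "complex_norm N" and s: "0 < s" and hol: "holomorphic_on_Cn f (complex_norm.Nball N x (16 * s))"
      and fM: "\<And>w. N (w - x) < 16 * s \<Longrightarrow> norm (f w) \<le> M"
      and S: "S \<in> sets borel" "S \<subseteq> complex_norm.Nball N x s" and g: "0 < \<gamma>"
      and dens: "\<gamma> * measure lborel (complex_norm.Nball N x s) \<le> measure lborel S"
      and fm: "\<And>w. w \<in> S \<Longrightarrow> norm (f w) \<le> m"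
    interpret complex_norm N by fact
    obtain v where v: "N v < 2 * s" "\<gamma> / c \<le> measure lborel {t \<in> {1/2..1::real}. x + t *\<^sub>R v \<in> S}"
      using exists_good_ray[OF S s g dens] unfolding c_def by blast
    have inb: "N (\<zeta> *s v) < 16 * s" if "\<zeta> \<in> ball 0 8" for \<zeta>
    proof -
      have "norm \<zeta> * N v \<le> 8 * N v" using that by (intro mult_right_mono) auto
      thus ?thesis using v(1) by (simp add: scale)
    qed
    have "norm (f (x + 0 *s v)) \<le> K * (\<gamma> / c) powr (-q) * m + \<epsilon> * M"
    proof (rule R[where F = "\<lambda>\<zeta>. f (x + \<zeta> *s v)"])
      show "(\<lambda>\<zeta>. f (x + \<zeta> *s v)) holomorphic_on ball 0 8"
        using inb by (intro holomorphic_on_Cn_line[OF hol]) (auto simp: Nball_def)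
      show "{t \<in> {1/2..1::real}. x + t *\<^sub>R v \<in> S} \<in> sets borel" using S(1) by (rule ray_preimage_borel)
      show "norm (f (x + complex_of_real t *s v)) \<le> m" if "t \<in> {t \<in> {1/2..1::real}. x + t *\<^sub>R v \<in> S}" for t
        using fm that by (simp add: scaleR_eq_scalar_mult)
      show "norm (f (x + \<zeta> *s v)) \<le> M" if "\<zeta> \<in> ball 0 8" for \<zeta>
        using fM[of "x + \<zeta> *s v"] inb[OF that] by simp
    qed (use v g c1 in auto)
    moreover have "(\<gamma> / c) powr (-q) = \<gamma> powr (-q) * c powr q"
      using g c1 by (simp add: powr_divide powr_minus_divide)
    ultimately show "norm (f x) \<le> K * c powr q * \<gamma> powr (-q) * m + \<epsilon> * M"
      by (simp add: mult_ac)
  qed (use Kq in auto)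
qed

section \<open>Sub-mean value inequality on norm balls\<close>

lemma Chebyshev_half:
  fixes g :: "'a::euclidean_space \<Rightarrow> real"
  assumes S: "S \<in> sets borel" "emeasure lborel S < \<infinity>" and pos: "measure lborel S > 0"
    and g: "(\<lambda>x. indicator S x * g x) \<in> borel_measurable borel"
    and I: "(\<integral>\<^sup>+x\<in>S. ennreal (g x) \<partial>lborel) \<le> ennreal I" and I0: "I \<ge> 0"
  shows "{x \<in> S. g x \<le> 2 * I / measure lborel S} \<in> sets borel"
    and "measure lborel S / 2 \<le> measure lborel {x \<in> S. g x \<le> 2 * I / measure lborel S}"
proof -
  define b where "b = measure lborel S"
  define A where "A = {x \<in> S. g x \<le> 2 * I / b}"
  define D where "D = {x \<in> S. 2 * I / b < g x}"
  have "A = S \<inter> {x \<in> space borel. indicator S x * g x \<le> 2 * I / b}" by (auto simp: A_def)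
  also have "\<dots> \<in> sets borel" using S(1) g by (intro sets.Int borel_measurable_le) auto
  finally have A: "A \<in> sets borel" .
  thus "{x \<in> S. g x \<le> 2 * I / measure lborel S} \<in> sets borel" by (simp add: A_def b_def)
  have DA: "D = S - A" by (auto simp: D_def A_def)
  have D: "D \<in> sets borel" unfolding DA using S(1) A by auto
  have gS: "(\<lambda>x. ennreal (g x) * indicator S x) \<in> borel_measurable borel"
  proof -
    have "(\<lambda>x. ennreal (g x) * indicator S x) = (\<lambda>x. ennreal (indicator S x * g x))"
      by (auto split: split_indicator)
    thus ?thesis using g by simp
  qed
  have Df: "emeasure lborel D = ennreal (measure lborel D)"
    using emeasure_mono[of D S lborel] S DA by (intro emeasure_eq_ennreal_measure) (auto simp: top_unique)
  have "measure lborel D \<le> b / 2"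
  \<comment> \<open>The threshold vanishes for \<open>I = 0\<close>, so Chebyshev's inequality gives
    nothing; here the exceptional set is null because the integral is zero.\<close>
  proof (cases "I = 0")
    case True
    hence "(\<integral>\<^sup>+x\<in>S. ennreal (g x) \<partial>lborel) = 0" using I by simp
    hence "AE x in lborel. ennreal (g x) * indicator S x = 0"
      using gS by (subst (asm) nn_integral_0_iff_AE) auto
    hence "AE x in lborel. x \<notin> D"
      by eventually_elim (auto simp: D_def True b_def ennreal_eq_0_iff split: split_indicator_asm)
    hence "emeasure lborel D = 0" using D by (simp add: AE_iff_null_sets null_setsD1)
    thus ?thesis using pos by (simp add: measure_def b_def)
  next
    case False
    have "ennreal (2 * I / b) * emeasure lborel D = (\<integral>\<^sup>+x. ennreal (2 * I / b) * indicator D x \<partial>lborel)"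
      using D by (simp add: nn_integral_cmult_indicator)
    also have "\<dots> \<le> (\<integral>\<^sup>+x\<in>S. ennreal (g x) \<partial>lborel)"
      by (intro nn_integral_mono) (auto simp: D_def intro!: ennreal_leI split: split_indicator)
    also note I
    finally have "2 * I / b * measure lborel D \<le> I"
      using I0 pos unfolding Df by (simp add: ennreal_mult'[symmetric] b_def)
    thus ?thesis using False I0 pos by (simp add: field_simps b_def)
  qed
  moreover have "measure lborel D = b - measure lborel A"
    unfolding DA b_def using S A by (intro measure_Diff) (auto simp: A_def)
  ultimately have "b / 2 \<le> measure lborel A" by simp
  thus "measure lborel S / 2 \<le> measure lborel {x \<in> S. g x \<le> 2 * I / measure lborel S}"
    unfolding A_def b_def .
qed

text \<open>Maximising \<open>|f|\<^sup>p (1/2 - N)\<^sup>d\<close> makes \<open>|f|\<close> essentially constant near the maximum point, so that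
  propagation of smallness from a Chebyshev set applies there.\<close>

lemma sub_mean_value_Nball:
  fixes p :: real
  assumes p: "p > 0"
  obtains C :: real where "C > 0"
    "\<And>N f z. complex_norm (N :: complex ^ 'n::finite \<Rightarrow> real) \<Longrightarrow>
       holomorphic_on_Cn f (complex_norm.Nball N z 1) \<Longrightarrow>
       ennreal (norm (f z) powr p) * emeasure lborel (complex_norm.Nball N 0 1)
         \<le> ennreal C * (\<integral>\<^sup>+w\<in>complex_norm.Nball N z 1. ennreal (norm (f w) powr p) \<partial>lborel)"
proof -
  define d where "d = DIM(complex ^ 'n)"
  \<comment> \<open>Halving the weight \<open>1/2 - N\<close> costs 2^d in |f|^p, that is the factor
    \<open>A\<close> in |f|. With \<epsilon> = 1 / (2 A) the error term is half of the value at the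
    maximum point and is absorbed.\<close>
  define A where "A = (2::real) powr (d / p)"
  have A: "A > 0" by (simp add: A_def)
  obtain K q where Kq: "K \<ge> 1" "q > 0" and R:
    "\<And>N f x s S \<gamma> m M. complex_norm (N :: complex ^ 'n::finite \<Rightarrow> real) \<Longrightarrow> 0 < s \<Longrightarrow>
       holomorphic_on_Cn f (complex_norm.Nball N x (16 * s)) \<Longrightarrow>
       (\<And>w. N (w - x) < 16 * s \<Longrightarrow> norm (f w) \<le> M) \<Longrightarrow>
       S \<in> sets borel \<Longrightarrow> S \<subseteq> complex_norm.Nball N x s \<Longrightarrow> 0 < \<gamma> \<Longrightarrow>
       \<gamma> * measure lborel (complex_norm.Nball N x s) \<le> measure lborel S \<Longrightarrow>
       (\<And>w. w \<in> S \<Longrightarrow> norm (f w) \<le> m) \<Longrightarrow>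
       norm (f x) \<le> K * \<gamma> powr (-q) * m + 1 / (2 * A) * M"
    proof (rule Remez_Nball[where 'n = 'n])
    show "0 < 1 / (2 * A)" using A by simp
  qed blast
  define L where "L = 2 * K * 2 powr q"
  have L: "L > 0" using Kq by (simp add: L_def)
  \<comment> \<open>2 is the Chebyshev loss, 32 the ratio of \<open>\<sigma>\<close> to the radius
    \<open>s\<close> chosen below, and 2^d compensates the weight at \<open>z\<close>
    itself.\<close>
  define C where "C = L powr p * 2 * 32 ^ d * 2 ^ d"
  show thesis
  proof (rule that[of C])
    show "C > 0" using L by (simp add: C_def)
    fix N :: "complex ^ 'n \<Rightarrow> real" and f z
    assume N: "complex_norm N" and hol: "holomorphic_on_Cn f (complex_norm.Nball N z 1)"
    interpret complex_norm N by fact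
    define V where "V = measure lborel (Nball 0 1)"
    have V: "V > 0" unfolding V_def by (rule measure_Nball_pos) simp
    define I where "I = (\<integral>\<^sup>+w\<in>Nball z 1. ennreal (norm (f w) powr p) \<partial>lborel)"
    have contf: "continuous_on (Nball z 1) f" using hol by (rule holomorphic_on_Cn_continuous)
    show "ennreal (norm (f z) powr p) * emeasure lborel (Nball 0 1) \<le> ennreal C * I"
    proof (cases "I = \<infinity>")
      case True
      thus ?thesis using \<open>C > 0\<close> by (simp add: ennreal_mult_top)
    next
      case False
      then obtain J where J: "I = ennreal J" "J \<ge> 0" by (metis ennreal_cases infinity_ennreal_def)
      define R1 where "R1 = {w. N (w - z) \<le> 1/2}"
      have R1: "compact R1" "z \<in> R1" "R1 \<subseteq> Nball z 1"
        unfolding R1_def by (rule compact_le) (auto simp: Nball_def)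
      define h where "h x = norm (f x) powr p * (1/2 - N (x - z)) ^ d" for x
      have "continuous_on R1 h" unfolding h_def using p
        by (intro continuous_intros continuous_on_powr' continuous_dist continuous_on_subset[OF contf R1(3)]) auto
      then obtain x0 where x0: "x0 \<in> R1" "\<And>x. x \<in> R1 \<Longrightarrow> h x \<le> h x0"
        using continuous_attains_sup[OF R1(1), of h] R1(2) by auto
      define \<sigma> where "\<sigma> = 1/2 - N (x0 - z)"
      have s0: "\<sigma> \<ge> 0" using x0(1) by (simp add: R1_def \<sigma>_def)
      have hx0: "h x0 * V \<le> C / 2 ^ d * J"
      proof (cases "h x0 = 0")
        case True
        thus ?thesis using \<open>C > 0\<close> J by simp
      next
        case False
        moreover have "d > 0" by (simp add: d_def)
        ultimately have fx0: "norm (f x0) > 0" and "\<sigma> > 0" using s0 by (auto simp: h_def \<sigma>_def)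
        \<comment> \<open>Then \<open>16 * s\<close> is half of \<open>\<sigma>\<close>: on the
          large ball the weight keeps at least half of its value at \<open>x0\<close>.\<close>
        define s where "s = \<sigma> / 32"
        have s: "s > 0" using \<open>\<sigma> > 0\<close> by (simp add: s_def)
        have near: "w \<in> R1" "\<sigma> / 2 \<le> 1/2 - N (w - z)" if "N (w - x0) < 16 * s" for w
        proof -
          have "N (w - z) \<le> N (w - x0) + N (x0 - z)" by (rule triangle)
          thus "\<sigma> / 2 \<le> 1/2 - N (w - z)" using that by (simp add: s_def \<sigma>_def)
          thus "w \<in> R1" using s0 by (simp add: R1_def)
        qed
        have sub: "Nball x0 (16 * s) \<subseteq> Nball z 1" using near(1) R1(3) by (auto simp: Nball_def)
        have sub': "Nball x0 s \<subseteq> Nball x0 (16 * s)" using s by (auto simp: Nball_def)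
        have bd: "norm (f w) \<le> A * norm (f x0)" if "N (w - x0) < 16 * s" for w
        proof -
          have "norm (f w) powr p * (\<sigma> / 2) ^ d \<le> h w"
            unfolding h_def using near(2)[OF that] s0 by (intro mult_left_mono power_mono) auto
          also have "\<dots> \<le> h x0" using x0(2) near(1)[OF that] by blast
          also have "\<dots> = norm (f x0) powr p * \<sigma> ^ d" by (simp add: h_def \<sigma>_def)
          finally have "norm (f w) powr p \<le> 2 ^ d * norm (f x0) powr p"
            using \<open>\<sigma> > 0\<close> by (simp add: power_divide field_simps)
          also have "\<dots> = (A * norm (f x0)) powr p"
            using p by (simp add: A_def powr_mult powr_powr powr_realpow)
          finally show ?thesis using powr_less_mono2[OF p, of "A * norm (f x0)" "norm (f w)"] A by force
        qed
        define b where "b = measure lborel (Nball x0 s)"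
        have b: "b = s ^ d * V" "b > 0" using measure_Nball[OF s, folded d_def] measure_Nball_pos[OF s] by (auto simp: b_def V_def)
        define S where "S = {w \<in> Nball x0 s. norm (f w) powr p \<le> 2 * J / b}"
        have meas: "(\<lambda>w. indicator (Nball x0 s) w * norm (f w) powr p) \<in> borel_measurable borel"
        proof -
          have "continuous_on (Nball x0 s) (\<lambda>w. norm (f w) powr p)" using p
            by (intro continuous_intros continuous_on_powr' continuous_on_subset[OF contf]) (use sub sub' in auto)
          from borel_measurable_continuous_on_indicator[OF _ this] show ?thesis by simp
        qed
        have "(\<integral>\<^sup>+w\<in>Nball x0 s. ennreal (norm (f w) powr p) \<partial>lborel) \<le> I"
          unfolding I_def by (intro nn_integral_mono) (use sub sub' in \<open>auto split: split_indicator\<close>)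
        hence IJ: "(\<integral>\<^sup>+w\<in>Nball x0 s. ennreal (norm (f w) powr p) \<partial>lborel) \<le> ennreal J" by (simp add: J)
        have S: "S \<in> sets borel" "b / 2 \<le> measure lborel S"
          unfolding S_def b_def by (rule Chebyshev_half[OF Nball_borel Nball_finite _ meas IJ J(2)]; use b(2) in \<open>simp add: b_def\<close>)+
        define m where "m = (2 * J / b) powr (1/p)"
        have m: "m \<ge> 0" "m powr p = 2 * J / b" using p J b by (auto simp: m_def powr_powr)
        have "norm (f x0) \<le> K * (1/2) powr (-q) * m + 1 / (2 * A) * (A * norm (f x0))"
        proof (rule R[OF N s _ bd S(1)])
          show "holomorphic_on_Cn f (Nball x0 (16 * s))" using hol sub by (rule holomorphic_on_Cn_subset)
          show "1 / 2 * measure lborel (Nball x0 s) \<le> measure lborel S" using S(2) by (simp add: b_def)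
          show "norm (f w) \<le> m" if "w \<in> S" for w
          proof -
            have "norm (f w) powr p \<le> m powr p" using that m by (simp add: S_def)
            thus ?thesis using powr_less_mono2[OF p m(1), of "norm (f w)"] by linarith
          qed
        qed (auto simp: S_def)
        moreover have "(1/2::real) powr (-q) = 2 powr q" by (simp add: powr_divide powr_minus_divide)
        moreover have "1 / (2 * A) * (A * norm (f x0)) = norm (f x0) / 2" using A by simp
        ultimately have "norm (f x0) \<le> L * m" by (simp add: L_def mult_ac)
        hence "norm (f x0) powr p \<le> (L * m) powr p" using p by (intro powr_mono2) auto
        also have "\<dots> = L powr p * (2 * J / b)" using L m by (simp add: powr_mult)
        finally have "norm (f x0) powr p * \<sigma> ^ d * V \<le> L powr p * (2 * J / b) * \<sigma> ^ d * V"
          using V s0 by (intro mult_right_mono) auto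
        hence "h x0 * V \<le> L powr p * (2 * J / b) * \<sigma> ^ d * V" by (simp only: h_def \<sigma>_def)
        also have "\<dots> = L powr p * 2 * J * (\<sigma> / s) ^ d" using V s by (simp add: b power_divide)
        also have "\<sigma> / s = 32" using \<open>\<sigma> > 0\<close> by (simp add: s_def)
        finally show ?thesis by (simp add: C_def mult_ac)
      qed
      have "norm (f z) powr p * (1/2) ^ d * V \<le> h x0 * V"
        using x0(2)[OF R1(2)] V by (intro mult_right_mono) (auto simp: h_def)
      hence "norm (f z) powr p * V \<le> C * J" using hx0 by (simp add: power_divide field_simps)
      hence "ennreal (norm (f z) powr p * V) \<le> ennreal (C * J)" by (rule ennreal_leI)
      thus ?thesis using J \<open>C > 0\<close> V by (simp add: emeasure_Nball V_def ennreal_mult')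
    qed
  qed
qed

section \<open>Fields of complex norms\<close>

lemma open_in_lborel_pair:
  fixes O' :: "('a::euclidean_space \<times> 'b::euclidean_space) set"
  assumes "open O'"
  shows "O' \<in> sets (lborel \<Otimes>\<^sub>M lborel)"
  using borel_open[OF assms] by (simp add: borel_prod[symmetric] cong: sets_pair_measure_cong)

text \<open>The measures of \<open>S \<inter> Nball w s\<close> are averaged over the centres
  \<open>w\<close>. Only centres in \<open>Nball z (D + s)\<close> count, so the mean is at least
  the volume ratio times the measure of \<open>S\<close>; the factor 1/2 leaves room for a
  contradiction by non-strict inequalities.\<close>

lemma (in complex_norm) exists_concentration:
  assumes S: "S \<in> sets borel" "S \<subseteq> Nball z D" and s: "0 < s" "0 < D"
  shows "\<exists>w. (s / (D + s)) ^ DIM(complex ^ 'n) / 2 * measure lborel S \<le> measure lborel (S \<inter> Nball w s)"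
proof (rule ccontr)
  define d where "d = DIM(complex ^ 'n)"
  define V where "V = measure lborel (Nball 0 1)"
  have V: "V > 0" unfolding V_def by (rule measure_Nball_pos) simp
  define k where "k = (s / (D + s)) ^ d / 2 * measure lborel S"
  assume neg: "\<not> ?thesis"
  have fin: "emeasure lborel (S \<inter> Nball w s) = ennreal (measure lborel (S \<inter> Nball w s))" for w
    using emeasure_mono[of "S \<inter> Nball w s" "Nball w s" lborel] Nball_finite[of w s]
    by (intro emeasure_eq_ennreal_measure) (auto simp: top_unique)
  have Sfin: "emeasure lborel S = ennreal (measure lborel S)"
    using emeasure_mono[OF S(2), of lborel] Nball_finite[of z D]
    by (intro emeasure_eq_ennreal_measure) (auto simp: top_unique)
  have lt: "measure lborel (S \<inter> Nball w s) < k" for w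
    using neg unfolding k_def d_def by (meson not_le)
  have k: "k > 0" using lt[of 0] measure_nonneg[of lborel "S \<inter> Nball 0 s"] by linarith
  have meas: "(\<lambda>(w, x). indicator S x * indicator (Nball w s) x :: ennreal) \<in> borel_measurable (lborel \<Otimes>\<^sub>M lborel)"
  proof -
    have "open {p :: (complex^'n) \<times> (complex^'n). N (snd p - fst p) < s}"
      by (intro open_Collect_less continuous_on_compose2[OF continuous[of UNIV]] continuous_intros) auto
    hence "{p :: (complex^'n) \<times> (complex^'n). N (snd p - fst p) < s} \<in> sets (lborel \<Otimes>\<^sub>M lborel)"
      by (rule open_in_lborel_pair)
    hence "(indicator {p :: (complex^'n) \<times> (complex^'n). N (snd p - fst p) < s} :: _ \<Rightarrow> ennreal) \<in> borel_measurable (lborel \<Otimes>\<^sub>M lborel)"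
      by (rule borel_measurable_indicator)
    moreover have "(\<lambda>p :: (complex^'n) \<times> (complex^'n). indicator S (snd p) :: ennreal) \<in> borel_measurable (lborel \<Otimes>\<^sub>M lborel)"
      using S(1) by (intro measurable_compose[OF measurable_snd]) auto
    moreover have "(\<lambda>(w, x). indicator S x * indicator (Nball w s) x :: ennreal)
      = (\<lambda>p. indicator S (snd p) * indicator {p. N (snd p - fst p) < s} p)"
      by (auto simp: fun_eq_iff Nball_def split: split_indicator)
    ultimately show ?thesis by simp
  qed
  have "ennreal (measure lborel S * (s ^ d * V)) = (\<integral>\<^sup>+x. ennreal (s ^ d * V) * indicator S x \<partial>lborel)"
  proof -
    have "(\<integral>\<^sup>+x. ennreal (s ^ d * V) * indicator S x \<partial>lborel) = ennreal (s ^ d * V) * emeasure lborel S"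
      by (rule nn_integral_cmult_indicator) (use S in simp)
    also have "\<dots> = ennreal (measure lborel S * (s ^ d * V))"
      using V s by (subst ennreal_mult'') (auto simp: Sfin mult.commute)
    finally show ?thesis by simp
  qed
  also have "\<dots> = (\<integral>\<^sup>+x. (\<integral>\<^sup>+w. indicator S x * indicator (Nball w s) x \<partial>lborel) \<partial>lborel)"
  proof (rule nn_integral_cong)
    fix x
    have "(\<integral>\<^sup>+w. indicator S x * indicator (Nball w s) x \<partial>lborel)
       = (\<integral>\<^sup>+w. indicator S x * indicator (Nball x s) w \<partial>lborel)"
      by (intro nn_integral_cong) (auto simp: Nball_def minus_commute split: split_indicator)
    also have "\<dots> = indicator S x * ennreal (s ^ d * V)"
      using measure_Nball[OF s(1), of x, folded d_def]
      by (simp add: nn_integral_cmult_indicator emeasure_Nball V_def)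
    finally show "ennreal (s ^ d * V) * indicator S x = (\<integral>\<^sup>+w. indicator S x * indicator (Nball w s) x \<partial>lborel)"
      by (simp add: mult.commute)
  qed
  also have "\<dots> = (\<integral>\<^sup>+w. (\<integral>\<^sup>+x. indicator S x * indicator (Nball w s) x \<partial>lborel) \<partial>lborel)"
    using lborel_pair.Fubini'[OF meas] by simp
  also have "\<dots> \<le> (\<integral>\<^sup>+w. ennreal k * indicator (Nball z (D + s)) w \<partial>lborel)"
  proof (rule nn_integral_mono)
    fix w
    have e: "(\<integral>\<^sup>+x. indicator S x * indicator (Nball w s) x \<partial>lborel) = emeasure lborel (S \<inter> Nball w s)"
      using S(1) by (simp add: indicator_inter_arith[symmetric])
    show "(\<integral>\<^sup>+x. indicator S x * indicator (Nball w s) x \<partial>lborel) \<le> ennreal k * indicator (Nball z (D + s)) w"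
    proof (cases "w \<in> Nball z (D + s)")
      case True
      thus ?thesis unfolding e fin using lt[of w] by (simp add: ennreal_leI)
    next
      case False
      have "S \<inter> Nball w s = {}"
      proof -
        have "False" if "x \<in> S" "x \<in> Nball w s" for x
          using that S(2) False triangle[of w z x] minus_commute[of w x] by (force simp: Nball_def)
        thus ?thesis by auto
      qed
      thus ?thesis unfolding e by simp
    qed
  qed
  also have "\<dots> = ennreal (k * ((D + s) ^ d * V))"
  proof -
    have "measure lborel (Nball z (D + s)) = (D + s) ^ d * V"
      using measure_Nball[of "D + s" z, folded d_def] s by (simp add: V_def)
    thus ?thesis using ennreal_mult'[of k "(D + s) ^ d * V"] k
      by (simp add: nn_integral_cmult_indicator emeasure_Nball)
  qed
  finally have "measure lborel S * (s ^ d * V) \<le> k * ((D + s) ^ d * V)"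
    using k V s by (subst (asm) ennreal_le_iff) auto
  also have "\<dots> = measure lborel S * (s ^ d * V) / 2"
    using s by (simp add: k_def power_divide)
  finally have le0: "measure lborel S * (s ^ d * V) \<le> 0" by linarith
  have "measure lborel S > 0" using k s by (simp add: k_def zero_less_mult_iff)
  hence "measure lborel S * (s ^ d * V) > 0" using V s by simp
  thus False using le0 by linarith
qed

text \<open>Interface between the two halves of the proof: a slowly varying metric in the sense of
  Hormander, but complex and adapted to \<Omega>. The function \<delta> serves only as the base of
  the weight, and its slow variation makes the weight nearly constant on unit balls.\<close>

locale complex_norm_field =
  fixes \<Omega> :: "(complex ^ 'n::finite) set" and N :: "complex ^ 'n \<Rightarrow> complex ^ 'n \<Rightarrow> real"
    and \<delta> :: "complex ^ 'n \<Rightarrow> real" and A :: real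
  assumes open_domain: "open \<Omega>"
    and norm: "z \<in> \<Omega> \<Longrightarrow> complex_norm (N z)"
    and continuous_N: "continuous_on (\<Omega> \<times> UNIV) (\<lambda>p. N (fst p) (snd p))"
    and \<delta>_pos: "z \<in> \<Omega> \<Longrightarrow> \<delta> z > 0" and continuous_\<delta>: "continuous_on \<Omega> \<delta>"
    and A1: "A \<ge> 1"
    and near: "z \<in> \<Omega> \<Longrightarrow> N z (w - z) < 1 \<Longrightarrow> w \<in> \<Omega>"
    and near_N: "z \<in> \<Omega> \<Longrightarrow> N z (w - z) < 1 \<Longrightarrow> N w v \<le> A * N z v \<and> N z v \<le> A * N w v"
    and near_\<delta>: "z \<in> \<Omega> \<Longrightarrow> N z (w - z) < 1 \<Longrightarrow> \<delta> w \<le> A * \<delta> z \<and> \<delta> z \<le> A * \<delta> w"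
begin

abbreviation B :: "complex ^ 'n \<Rightarrow> complex ^ 'n \<Rightarrow> real \<Rightarrow> (complex ^ 'n) set" where
  "B z \<equiv> complex_norm.Nball (N z)"

definition vol :: "complex ^ 'n \<Rightarrow> real" where "vol z = measure lborel (B z 0 1)"

text \<open>Symmetric by construction, although membership in the balls is not: chains can then be
  reversed, and the same kernel can be integrated in either variable.\<close>

definition adj :: "((complex ^ 'n) \<times> (complex ^ 'n)) set" where
  "adj = {(z, w). z \<in> \<Omega> \<and> w \<in> \<Omega> \<and> (N z (w - z) < 1 \<or> N w (z - w) < 1)}"

text \<open>\<open>\<eta>\<close> is chosen such that an \<open>\<eta>\<close>-ball around \<open>x\<close> lies in the ball of radius \<open>1/16\<close> around any point
  within two \<open>\<eta>\<close>-steps of \<open>x\<close>; sixteen times that ball is still contained in \<open>\<Omega>\<close>.\<close>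

definition \<eta> :: real where "\<eta> = 1 / (48 * A\<^sup>2)"

text \<open>The steps along which smallness is propagated; the coarser \<open>adj\<close> describes
  where the a priori bounds on f are taken.\<close>

definition stp :: "((complex ^ 'n) \<times> (complex ^ 'n)) set" where
  "stp = {(z, w). z \<in> \<Omega> \<and> w \<in> \<Omega> \<and> N z (w - z) < \<eta>}"

lemma B_iff: "z \<in> \<Omega> \<Longrightarrow> w \<in> B z x s \<longleftrightarrow> N z (w - x) < s"
  by (simp add: complex_norm.Nball_def[OF norm])

lemma N_nonneg: "z \<in> \<Omega> \<Longrightarrow> 0 \<le> N z v"
  by (rule complex_norm.nonneg[OF norm])

lemma N_minus_commute: "z \<in> \<Omega> \<Longrightarrow> N z (v - w) = N z (w - v)"
  by (rule complex_norm.minus_commute[OF norm])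

lemma N_triangle: "z \<in> \<Omega> \<Longrightarrow> N z (x - u) \<le> N z (x - y) + N z (y - u)"
  by (rule complex_norm.triangle[OF norm])

lemma vol_pos: "z \<in> \<Omega> \<Longrightarrow> vol z > 0"
  unfolding vol_def by (rule complex_norm.measure_Nball_pos[OF norm]) auto

lemma measure_B: "z \<in> \<Omega> \<Longrightarrow> s > 0 \<Longrightarrow> measure lborel (B z x s) = s ^ DIM(complex ^ 'n) * vol z"
  unfolding vol_def by (rule complex_norm.measure_Nball[OF norm])

lemma B_borel: "z \<in> \<Omega> \<Longrightarrow> B z x s \<in> sets borel"
  by (rule complex_norm.Nball_borel[OF norm])

lemma emeasure_B: "z \<in> \<Omega> \<Longrightarrow> emeasure lborel (B z x s) = ennreal (measure lborel (B z x s))"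
  by (rule complex_norm.emeasure_Nball[OF norm])

lemma \<eta>: "0 < \<eta>" "\<eta> < 1" "3 * A\<^sup>2 * \<eta> = 1/16"
proof -
  have "A\<^sup>2 \<ge> 1" using A1 by (simp add: one_le_power)
  thus "0 < \<eta>" "\<eta> < 1" "3 * A\<^sup>2 * \<eta> = 1/16" unfolding \<eta>_def by (auto simp: divide_less_eq)
qed

lemma stp_subset_adj: "stp \<subseteq> adj"
  using \<eta>(2) by (auto simp: stp_def adj_def)

lemma adjD: "(z, w) \<in> adj \<Longrightarrow> z \<in> \<Omega> \<and> w \<in> \<Omega> \<and> (w, z) \<in> adj"
  by (auto simp: adj_def)

lemma adj_compare:
  assumes "(z, w) \<in> adj"
  shows "N w v \<le> A * N z v" "\<delta> w \<le> A * \<delta> z" "N z (w - z) \<le> A"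
proof -
  consider "z \<in> \<Omega>" "w \<in> \<Omega>" "N z (w - z) < 1" | "z \<in> \<Omega>" "w \<in> \<Omega>" "N w (z - w) < 1"
    using assms by (auto simp: adj_def)
  hence "N w v \<le> A * N z v \<and> \<delta> w \<le> A * \<delta> z \<and> N z (w - z) \<le> A"
  proof cases
    case 1 thus ?thesis using near_N[of z w v] near_\<delta>[of z w] A1 by auto
  next
    case 2
    have "N z (w - z) = N z (z - w)" using 2 N_minus_commute by blast
    also have "\<dots> \<le> A * N w (z - w)" using near_N[of w z "z - w"] 2 by auto
    also have "\<dots> \<le> A * 1" using 2 A1 by (intro mult_left_mono) auto
    finally show ?thesis using near_N[of w z v] near_\<delta>[of w z] 2 by auto
  qed
  thus "N w v \<le> A * N z v" "\<delta> w \<le> A * \<delta> z" "N z (w - z) \<le> A" by auto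
qed

lemma adj_refl: "z \<in> \<Omega> \<Longrightarrow> (z, z) \<in> adj"
  using complex_norm.zero[OF norm[of z]] by (simp add: adj_def)

lemma stp_refl: "z \<in> \<Omega> \<Longrightarrow> (z, z) \<in> stp"
  using complex_norm.zero[OF norm[of z]] \<eta> by (simp add: stp_def)

lemma adj_pow_domain: "(z, w) \<in> adj ^^ J \<Longrightarrow> z \<in> \<Omega> \<Longrightarrow> w \<in> \<Omega>"
  by (induction J arbitrary: w) (auto dest: adjD)

lemma adj_pow_domain': "(z, w) \<in> adj ^^ J \<Longrightarrow> w \<in> \<Omega> \<Longrightarrow> z \<in> \<Omega>"
  by (cases J) (simp, blast dest: relpow_Suc_D2 adjD)

lemma adj_pow_sym: "(z, w) \<in> adj ^^ J \<Longrightarrow> (w, z) \<in> adj ^^ J"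
proof (induction J arbitrary: w)
  case (Suc J)
  then obtain u where "(z, u) \<in> adj ^^ J" "(u, w) \<in> adj" by auto
  thus ?case using Suc.IH[of u] adjD[of u w] relpow_Suc_I2[of w u adj z J] by blast
qed auto

lemma adj_pow_mono:
  assumes "(z, w) \<in> adj ^^ J" "z \<in> \<Omega>" "J \<le> J'"
  shows "(z, w) \<in> adj ^^ J'"
  using assms(3)
proof (induction J' rule: dec_induct)
  case (step k)
  thus ?case using adj_refl adj_pow_domain assms(2) by auto
qed (use assms in auto)

lemma adj_pow_trans: "(x, y) \<in> adj ^^ J \<Longrightarrow> (y, z) \<in> adj ^^ K \<Longrightarrow> (x, z) \<in> adj ^^ (J + K)"
  by (auto simp: relpow_add)

lemma stp_pow_adj: "(x, y) \<in> stp ^^ J \<Longrightarrow> (x, y) \<in> adj ^^ J"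
  using stp_subset_adj by (induction J arbitrary: y) auto

lemma adj_pow_compare:
  assumes "(z, w) \<in> adj ^^ J" "z \<in> \<Omega>"
  shows "N w v \<le> A ^ J * N z v" "\<delta> w \<le> A ^ J * \<delta> z" "N z (w - z) \<le> real J * A ^ J"
proof -
  have "N w v \<le> A ^ J * N z v \<and> \<delta> w \<le> A ^ J * \<delta> z \<and> N z (w - z) \<le> real J * A ^ J"
    using assms(1)
  proof (induction J arbitrary: v w)
    case 0
    thus ?case using complex_norm.zero[OF norm[OF assms(2)]] by simp
  next
    case (Suc J)
    then obtain u where u: "(z, u) \<in> adj ^^ J" "(u, w) \<in> adj" by auto
    note IH = Suc.IH[OF u(1)]
    have "N w v \<le> A * N u v" by (rule adj_compare[OF u(2)])
    also have "\<dots> \<le> A * (A ^ J * N z v)" using IH A1 by (intro mult_left_mono) auto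
    finally have 1: "N w v \<le> A ^ Suc J * N z v" by (simp add: mult.assoc)
    have "\<delta> w \<le> A * \<delta> u" by (rule adj_compare[OF u(2)])
    also have "\<dots> \<le> A * (A ^ J * \<delta> z)" using IH A1 by (intro mult_left_mono) auto
    finally have 2: "\<delta> w \<le> A ^ Suc J * \<delta> z" by (simp add: mult.assoc)
    have zu: "(u, z) \<in> adj ^^ J" using adj_pow_sym u(1) by blast
    \<comment> \<open>The comparison in the opposite direction has its own induction along the
      reversed chain, because the outer induction keeps \<open>z\<close> fixed.\<close>
    have "N z x \<le> A ^ J * N u x" for x
      using zu
    proof (induction J arbitrary: u x)
      case (Suc J)
      then obtain y where y: "(u, y) \<in> adj" "(y, z) \<in> adj ^^ J" using relpow_Suc_D2 by metis
      have "N z x \<le> A ^ J * N y x" by (rule Suc.IH[OF y(2)])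
      also have "\<dots> \<le> A ^ J * (A * N u x)" using adj_compare[OF y(1)] A1 by (intro mult_left_mono) auto
      finally show ?case by (simp add: mult_ac)
    qed auto
    hence "N z (w - u) \<le> A ^ J * N u (w - u)" .
    also have "\<dots> \<le> A ^ J * A" using adj_compare(3)[OF u(2)] A1 by (intro mult_left_mono) auto
    finally have "N z (w - u) \<le> A ^ Suc J" by (simp add: mult.commute)
    moreover have "N z (u - z) \<le> real J * A ^ Suc J"
    proof -
      have "real J * A ^ J \<le> real J * A ^ Suc J" using A1 by (intro mult_left_mono power_increasing) auto
      thus ?thesis using IH by force
    qed
    moreover have "N z (w - z) \<le> N z (w - u) + N z (u - z)" using N_triangle assms(2) by blast
    ultimately have "N z (w - z) \<le> real (Suc J) * A ^ Suc J" by (simp add: algebra_simps)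
    thus ?case using 1 2 by blast
  qed
  thus "N w v \<le> A ^ J * N z v" "\<delta> w \<le> A ^ J * \<delta> z" "N z (w - z) \<le> real J * A ^ J" by auto
qed

lemma vol_le:
  assumes "z \<in> \<Omega>" "w \<in> \<Omega>" "c > 0" "\<And>v. N w v \<le> c * N z v"
  shows "vol z \<le> c ^ DIM(complex ^ 'n) * vol w"
proof -
  have "B z 0 1 \<subseteq> B w 0 c"
  proof
    fix v assume "v \<in> B z 0 1"
    hence "c * N z v < c * 1" using assms by (simp add: B_iff)
    thus "v \<in> B w 0 c" using assms(4)[of v] assms(2) by (simp add: B_iff)
  qed
  hence "measure lborel (B z 0 1) \<le> measure lborel (B w 0 c)"
    using assms emeasure_B[of w 0 c] by (intro measure_mono_fmeasurable) (auto simp: fmeasurable_def B_borel)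
  thus ?thesis using measure_B[OF assms(2,3)] by (simp add: vol_def)
qed

lemma adj_pow_vol:
  assumes "(z, w) \<in> adj ^^ J" "z \<in> \<Omega>"
  shows "vol z \<le> (A ^ J) ^ DIM(complex ^ 'n) * vol w"
  by (rule vol_le) (use assms adj_pow_domain[OF assms] adj_pow_compare[OF assms] A1 in auto)

text \<open>The estimate is applied in the norm at the arbitrary target \<open>u\<close>: by the
  choice of \<open>\<eta>\<close>, the set \<open>S\<close> lies in the ball of radius 1/16 about
  \<open>u\<close>. The volume of that ball is at most \<open>c\<close> times that of the
  \<open>\<eta>\<close>-ball at \<open>x\<close>, which is the loss of density. Three steps suffice
  for the bound \<open>M\<close>: from \<open>x\<close> to \<open>y\<close>, to \<open>u\<close>,
  and into the unit ball at \<open>u\<close>.\<close>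

lemma propagate_density:
  assumes "0 < \<epsilon>"
  obtains K q :: real where "K \<ge> 1" "q > 0"
    "\<And>\<gamma> f m M x y u S. (x, y) \<in> stp \<Longrightarrow> holomorphic_on_Cn f \<Omega> \<Longrightarrow> S \<in> sets borel \<Longrightarrow> S \<subseteq> B x x \<eta> \<Longrightarrow>
      0 < \<gamma> \<Longrightarrow> \<gamma> * measure lborel (B x x \<eta>) \<le> measure lborel S \<Longrightarrow>
      (\<And>w. w \<in> S \<Longrightarrow> norm (f w) \<le> m) \<Longrightarrow> (\<And>w. (x, w) \<in> adj ^^ 3 \<Longrightarrow> norm (f w) \<le> M) \<Longrightarrow>
      N y (u - y) < \<eta> \<Longrightarrow> norm (f u) \<le> K * \<gamma> powr (-q) * m + \<epsilon> * M"
proof -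
  define d where "d = DIM(complex ^ 'n)"
  obtain K q where Kq: "K \<ge> 1" "q > 0" and R:
    "\<And>N f x s S \<gamma> m M. complex_norm (N :: complex ^ 'n::finite \<Rightarrow> real) \<Longrightarrow> 0 < s \<Longrightarrow>
       holomorphic_on_Cn f (complex_norm.Nball N x (16 * s)) \<Longrightarrow>
       (\<And>w. N (w - x) < 16 * s \<Longrightarrow> norm (f w) \<le> M) \<Longrightarrow>
       S \<in> sets borel \<Longrightarrow> S \<subseteq> complex_norm.Nball N x s \<Longrightarrow> 0 < \<gamma> \<Longrightarrow>
       \<gamma> * measure lborel (complex_norm.Nball N x s) \<le> measure lborel S \<Longrightarrow>
       (\<And>w. w \<in> S \<Longrightarrow> norm (f w) \<le> m) \<Longrightarrow>
       norm (f x) \<le> K * \<gamma> powr (-q) * m + \<epsilon> * M"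
    using Remez_Nball[where 'n = 'n, OF assms] by blast
  define c where "c = (3 * A\<^sup>2) ^ d * (A\<^sup>2) ^ d"
  have c1: "c \<ge> 1"
  proof -
    have "A\<^sup>2 \<ge> 1" using A1 by simp
    thus ?thesis using mult_mono[of 1 "(3 * A\<^sup>2) ^ d" 1 "(A\<^sup>2) ^ d"] one_le_power[of "3 * A\<^sup>2" d] one_le_power[of "A\<^sup>2" d]
      by (simp add: c_def)
  qed
  show thesis
  proof (rule that[of "K * c powr q" q])
    show "1 \<le> K * c powr q" using mult_mono[of 1 K 1 "c powr q"] ge_one_powr_ge_zero[of c q] Kq c1 by simp
    fix \<gamma> f m M x y u S
    assume xy: "(x, y) \<in> stp" and hol: "holomorphic_on_Cn f \<Omega>" and S: "S \<in> sets borel" "S \<subseteq> B x x \<eta>"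
      and g: "0 < \<gamma>" and dens: "\<gamma> * measure lborel (B x x \<eta>) \<le> measure lborel S"
      and fm: "\<And>w. w \<in> S \<Longrightarrow> norm (f w) \<le> m" and fM: "\<And>w. (x, w) \<in> adj ^^ 3 \<Longrightarrow> norm (f w) \<le> M"
      and u: "N y (u - y) < \<eta>"
    have x: "x \<in> \<Omega>" and y: "y \<in> \<Omega>" and Nxy: "N x (y - x) < \<eta>" using xy by (auto simp: stp_def)
    have uO: "u \<in> \<Omega>" using near[OF y] u \<eta> by auto
    have xya: "(x, y) \<in> adj" using xy stp_subset_adj by auto
    have yu: "(y, u) \<in> adj" using u \<eta> y uO by (auto simp: adj_def)
    have Nu: "N u v \<le> A * N y v" "N y v \<le> A * N x v" "N x v \<le> A * N y v" "N y v \<le> A * N u v" for v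
      using adj_compare(1)[OF yu] adj_compare(1)[OF xya] adj_compare(1)[of y x v] adj_compare(1)[of u y v] adjD[OF xya] adjD[OF yu] by auto
    have sub: "S \<subseteq> B u u (1/16)"
    proof
      fix v assume "v \<in> S"
      hence v: "N x (v - x) < \<eta>" using S(2) x by (auto simp: B_iff)
      have "N y (v - x) \<le> A * \<eta>"
        using Nu(2)[of "v - x"] mult_left_mono[of "N x (v - x)" \<eta> A] v A1 by linarith
      moreover have "N y (x - y) \<le> A * \<eta>"
        using Nu(2)[of "x - y", unfolded N_minus_commute[OF x, of x y]] mult_left_mono[of "N x (y - x)" \<eta> A] Nxy A1 by linarith
      moreover have "\<eta> \<le> A * \<eta>" using A1 \<eta> by simp
      moreover have "N y (y - u) < \<eta>" using u N_minus_commute[OF y] by simp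
      ultimately have "N y (v - u) < 3 * (A * \<eta>)"
        using N_triangle[OF y, of v u x] N_triangle[OF y, of x u y] by linarith
      hence "A * N y (v - u) < A * (3 * (A * \<eta>))" using A1 by (intro mult_strict_left_mono) auto
      hence "N u (v - u) < 1/16" using Nu(1)[of "v - u"] \<eta>(3) by (simp add: power2_eq_square mult_ac)
      thus "v \<in> B u u (1/16)" using uO by (simp add: B_iff)
    qed
    have "vol u \<le> (A\<^sup>2) ^ d * vol x" unfolding d_def
    proof (rule vol_le[OF uO x])
      show "N x v \<le> A\<^sup>2 * N u v" for v
        using Nu(3)[of v] mult_left_mono[OF Nu(4)[of v], of A] A1 unfolding power2_eq_square mult.assoc by linarith
    qed (use A1 in auto)
    hence "(1/16) ^ d * vol u \<le> (1/16) ^ d * ((A\<^sup>2) ^ d * vol x)" by (intro mult_left_mono) auto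
    also have "\<dots> = c * (\<eta> ^ d * vol x)"
      unfolding c_def \<eta>(3)[symmetric] power_mult_distrib by (simp only: mult_ac)
    finally have "measure lborel (B u u (1/16)) \<le> c * measure lborel (B x x \<eta>)"
      using measure_B[OF uO, of "1/16" u, folded d_def] measure_B[OF x \<eta>(1), of x, folded d_def] by simp
    hence "\<gamma> / c * measure lborel (B u u (1/16)) \<le> \<gamma> / c * (c * measure lborel (B x x \<eta>))"
      using g c1 by (intro mult_left_mono) auto
    hence dens': "\<gamma> / c * measure lborel (B u u (1/16)) \<le> measure lborel S" using dens c1 by simp
    have "norm (f u) \<le> K * (\<gamma> / c) powr (-q) * m + \<epsilon> * M"
    proof (rule R[OF norm[OF uO] _ _ _ S(1) sub _ dens' fm])
      have sub1: "B u u (16 * (1/16)) \<subseteq> \<Omega>" using near[OF uO] uO by (auto simp: B_iff)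
      show "holomorphic_on_Cn f (B u u (16 * (1/16)))" by (rule holomorphic_on_Cn_subset[OF hol sub1])
      show "norm (f w) \<le> M" if "N u (w - u) < 16 * (1 / 16)" for w
      proof (rule fM)
        have "(u, w) \<in> adj" using that uO near[OF uO, of w] by (auto simp: adj_def)
        thus "(x, w) \<in> adj ^^ 3" using xya yu by (auto simp: numeral_3_eq_3)
      qed
    qed (use g c1 in auto)
    moreover have "(\<gamma> / c) powr (-q) = \<gamma> powr (-q) * c powr q"
      using g c1 by (simp add: powr_divide powr_minus_divide)
    ultimately show "norm (f u) \<le> K * c powr q * \<gamma> powr (-q) * m + \<epsilon> * M"
      by (simp add: mult_ac)
  qed (use Kq in auto)
qed

text \<open>Each step starts from a bound on a full \<open>\<eta>\<close>-ball, so
  \<open>propagate_density\<close> is used with density 1 and no power of \<gamma> enters. The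
  induction hypothesis is taken with \<open>\<epsilon> / (2 * K)\<close>, because the next step
  multiplies the accumulated error by \<open>K\<close>.\<close>

lemma propagate_chain:
  assumes "0 < \<epsilon>"
  shows "\<exists>K\<ge>1. \<forall>f m M x y u. (x, y) \<in> stp ^^ J \<longrightarrow> x \<in> \<Omega> \<longrightarrow> holomorphic_on_Cn f \<Omega> \<longrightarrow>
      (\<forall>w. N x (w - x) < \<eta> \<longrightarrow> norm (f w) \<le> m) \<longrightarrow> (\<forall>w. (x, w) \<in> adj ^^ (J + 3) \<longrightarrow> norm (f w) \<le> M) \<longrightarrow>
      N y (u - y) < \<eta> \<longrightarrow> norm (f u) \<le> K * m + \<epsilon> * M"
  using assms
proof (induction J arbitrary: \<epsilon>)
  case 0
  show ?case
  proof (rule exI[of _ 1], intro conjI allI impI)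
    fix f m M x y u assume a: "(x, y) \<in> stp ^^ 0" "x \<in> \<Omega>" "\<forall>w. N x (w - x) < \<eta> \<longrightarrow> norm (f w) \<le> m"
      "\<forall>w. (x, w) \<in> adj ^^ (0 + 3) \<longrightarrow> norm (f w) \<le> M" "N y (u - y) < \<eta>"
    have "(x, x) \<in> adj ^^ 3" using adj_refl[OF a(2)] by (auto simp: numeral_3_eq_3)
    hence "norm (f x) \<le> M" using a by simp
    hence "0 \<le> M" using norm_ge_zero order_trans by blast
    hence "0 \<le> \<epsilon> * M" using 0 by simp
    moreover have "norm (f u) \<le> m" using a by simp
    ultimately show "norm (f u) \<le> 1 * m + \<epsilon> * M" by simp
  qed simp
next
  case (Suc J)
  obtain K q where Kq: "K \<ge> 1" "q > 0" and R:
    "\<And>\<gamma> f m M x y u S. (x, y) \<in> stp \<Longrightarrow> holomorphic_on_Cn f \<Omega> \<Longrightarrow> S \<in> sets borel \<Longrightarrow> S \<subseteq> B x x \<eta> \<Longrightarrow>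
      0 < \<gamma> \<Longrightarrow> \<gamma> * measure lborel (B x x \<eta>) \<le> measure lborel S \<Longrightarrow>
      (\<And>w. w \<in> S \<Longrightarrow> norm (f w) \<le> m) \<Longrightarrow> (\<And>w. (x, w) \<in> adj ^^ 3 \<Longrightarrow> norm (f w) \<le> M) \<Longrightarrow>
      N y (u - y) < \<eta> \<Longrightarrow> norm (f u) \<le> K * \<gamma> powr (-q) * m + \<epsilon> / 2 * M"
    using propagate_density[of "\<epsilon> / 2"] Suc.prems by (metis half_gt_zero)
  obtain K' where K': "K' \<ge> 1" and IH: "\<forall>f m M x y u. (x, y) \<in> stp ^^ J \<longrightarrow> x \<in> \<Omega> \<longrightarrow> holomorphic_on_Cn f \<Omega> \<longrightarrow>
      (\<forall>w. N x (w - x) < \<eta> \<longrightarrow> norm (f w) \<le> m) \<longrightarrow> (\<forall>w. (x, w) \<in> adj ^^ (J + 3) \<longrightarrow> norm (f w) \<le> M) \<longrightarrow>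
      N y (u - y) < \<eta> \<longrightarrow> norm (f u) \<le> K' * m + \<epsilon> / (2 * K) * M"
    using Suc.IH[of "\<epsilon> / (2 * K)"] Suc.prems Kq by auto
  show ?case
  proof (rule exI[of _ "K * K'"], intro conjI allI impI)
    show "1 \<le> K * K'" using mult_mono[of 1 K 1 K'] Kq K' by simp
    fix f m M x y u
    assume xy: "(x, y) \<in> stp ^^ Suc J" and x: "x \<in> \<Omega>" and hol: "holomorphic_on_Cn f \<Omega>"
      and fm: "\<forall>w. N x (w - x) < \<eta> \<longrightarrow> norm (f w) \<le> m"
      and fM: "\<forall>w. (x, w) \<in> adj ^^ (Suc J + 3) \<longrightarrow> norm (f w) \<le> M"
      and u: "N y (u - y) < \<eta>"
    from xy obtain y' where y': "(x, y') \<in> stp ^^ J" "(y', y) \<in> stp" by auto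
    have y'O: "y' \<in> \<Omega>" using y'(2) by (auto simp: stp_def)
    have fM1: "\<forall>w. (x, w) \<in> adj ^^ (J + 3) \<longrightarrow> norm (f w) \<le> M"
      using fM adj_pow_mono[OF _ x, of _ "J + 3" "Suc J + 3"] by simp
    have 1: "norm (f w) \<le> K' * m + \<epsilon> / (2 * K) * M" if "w \<in> B y' y' \<eta>" for w
      using IH y' x hol fm fM1 that y'O by (simp add: B_iff)
    have "norm (f u) \<le> K * 1 powr (-q) * (K' * m + \<epsilon> / (2 * K) * M) + \<epsilon> / 2 * M"
    proof (rule R[OF y'(2) hol B_borel[OF y'O] order_refl _ _ 1 _ u])
      show "norm (f w) \<le> M" if "(y', w) \<in> adj ^^ 3" for w
        using fM1 adj_pow_trans[OF stp_pow_adj[OF y'(1)] that] by simp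
    qed auto
    also have "\<dots> = K * K' * m + \<epsilon> * M" using Kq by (simp add: field_simps)
    finally show "norm (f u) \<le> K * K' * m + \<epsilon> * M" .
  qed
qed

end

section \<open>Local estimate at a point from a set reachable by chains\<close>

lemma powr_add_le:
  fixes a b p :: real
  assumes "a \<ge> 0" "b \<ge> 0" "p > 0"
  shows "(a + b) powr p \<le> 2 powr p * (a powr p + b powr p)"
proof -
  have "(a + b) powr p \<le> (2 * max a b) powr p" using assms by (intro powr_mono2) auto
  also have "\<dots> = 2 powr p * (max a b) powr p" using assms by (simp add: powr_mult)
  also have "(max a b) powr p \<le> a powr p + b powr p" by (simp add: max_def)
  finally show ?thesis by simp
qed

lemma powr_comparable:
  fixes x y c a :: real
  assumes "x > 0" "y > 0" "x \<le> c * y" "y \<le> c * x" "c \<ge> 1"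
  shows "x powr a \<le> c powr \<bar>a\<bar> * y powr a"
proof (cases "a \<ge> 0")
  case True
  have "x powr a \<le> (c * y) powr a" using assms True by (intro powr_mono2) auto
  thus ?thesis using assms True by (simp add: powr_mult)
next
  case False
  have "x powr a \<le> (y / c) powr a" using assms False by (intro powr_mono2') (auto simp: field_simps)
  also have "\<dots> = c powr (-a) * y powr a" using assms by (simp add: powr_divide powr_minus_divide)
  finally show ?thesis using False by simp
qed

context complex_norm_field
begin

lemma holomorphic_powr_borel:
  assumes "holomorphic_on_Cn f \<Omega>" "S \<in> sets borel" "S \<subseteq> \<Omega>" "p > 0"
  shows "(\<lambda>x. indicator S x * norm (f x) powr p) \<in> borel_measurable borel"
proof -
  have "continuous_on \<Omega> (\<lambda>x. norm (f x) powr p)" using assms(4)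
    by (intro continuous_intros continuous_on_powr' holomorphic_on_Cn_continuous[OF assms(1)]) auto
  from borel_measurable_continuous_on_indicator[OF borel_open[OF open_domain] this]
  have "(\<lambda>x. indicator S x * (indicator \<Omega> x *\<^sub>R norm (f x) powr p)) \<in> borel_measurable borel"
    using assms(2) by (intro borel_measurable_times) auto
  moreover have "(\<lambda>x. indicator S x * (indicator \<Omega> x *\<^sub>R norm (f x) powr p)) = (\<lambda>x. indicator S x * norm (f x) powr p)"
    using assms(3) by (auto simp: fun_eq_iff split: split_indicator)
  ultimately show ?thesis by simp
qed

lemma holomorphic_powr_borel':
  assumes "holomorphic_on_Cn f \<Omega>" "S \<in> sets borel" "S \<subseteq> \<Omega>" "p > 0"
  shows "(\<lambda>x. ennreal (norm (f x) powr p) * indicator S x) \<in> borel_measurable borel"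
proof -
  have "(\<lambda>x. ennreal (norm (f x) powr p) * indicator S x) = (\<lambda>x. ennreal (indicator S x * norm (f x) powr p))"
    by (auto simp: fun_eq_iff split: split_indicator)
  thus ?thesis using holomorphic_powr_borel[OF assms] by simp
qed

text \<open>The set \<open>S\<close> is cut down to a piece \<open>S0\<close> of comparable measure
  inside one \<open>\<eta>\<close>-ball about a point \<open>x0\<close> of \<open>S\<close>, and by
  Chebyshev to a half \<open>S1\<close> on which |f| is at most \<open>m\<close>, a multiple of its
  p-mean. Smallness passes from \<open>S1\<close> to the whole ball at \<open>x0\<close> and along
  the chain to \<open>z\<close>. The a priori bound \<open>M\<close> within J + 3 steps of
  \<open>x0\<close> comes from the sub-mean value inequality, whose balls stay within 2 J + 4 steps
  of \<open>z\<close>.\<close>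

lemma local_estimate:
  fixes p \<epsilon> :: real
  assumes p: "p > 0" and \<epsilon>: "\<epsilon> > 0"
  shows "\<exists>K q. K > 0 \<and> q > 0 \<and> (\<forall>\<gamma> f z S. 0 < \<gamma> \<longrightarrow> holomorphic_on_Cn f \<Omega> \<longrightarrow> z \<in> \<Omega> \<longrightarrow> S \<in> sets borel \<longrightarrow>
     (\<forall>x\<in>S. (x, z) \<in> stp ^^ J) \<longrightarrow> \<gamma> * vol z \<le> measure lborel S \<longrightarrow>
     ennreal (norm (f z) powr p) * ennreal (vol z)
       \<le> ennreal (K * \<gamma> powr (-q)) * (\<integral>\<^sup>+w\<in>S. ennreal (norm (f w) powr p) \<partial>lborel)
         + ennreal \<epsilon> * (\<integral>\<^sup>+w\<in>(adj ^^ (2 * J + 4)) `` {z}. ennreal (norm (f w) powr p) \<partial>lborel))"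
proof -
  define d where "d = DIM(complex ^ 'n)"
  define D where "D = real J * A ^ J + 1"
  \<comment> \<open>Two points of one \<open>\<sigma>\<close>-ball of \<open>N z\<close> differ by
    less than \<open>2 * \<sigma>\<close>, hence by less than \<open>\<eta>\<close> in the norm at
    any point \<open>J\<close> steps from \<open>z\<close>.\<close>
  define \<sigma> where "\<sigma> = \<eta> / (2 * A ^ J)"
  define c0 where "c0 = (\<sigma> / (D + \<sigma>)) ^ d / 2"
  define c1 where "c1 = c0 / (A ^ J) ^ d / 2"
  define a where "a = (A ^ (2 * J + 3)) ^ d"
  have AJ: "A ^ J \<ge> 1" using A1 by (rule one_le_power)
  have D: "D > 0" using A1 by (simp add: D_def add_nonneg_pos)
  have \<sigma>: "\<sigma> > 0" using \<eta>(1) AJ by (simp add: \<sigma>_def)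
  have c0: "c0 > 0" using \<sigma> D by (simp add: c0_def)
  have c1: "c1 > 0" using c0 AJ by (simp add: c1_def)
  have a: "a > 0" using A1 by (simp add: a_def)
  obtain C where C: "C > 0" and SM: "\<And>N f z. complex_norm (N :: complex ^ 'n::finite \<Rightarrow> real) \<Longrightarrow>
       holomorphic_on_Cn f (complex_norm.Nball N z 1) \<Longrightarrow>
       ennreal (norm (f z) powr p) * emeasure lborel (complex_norm.Nball N 0 1)
         \<le> ennreal C * (\<integral>\<^sup>+w\<in>complex_norm.Nball N z 1. ennreal (norm (f w) powr p) \<partial>lborel)"
    using sub_mean_value_Nball[where 'n = 'n, OF p] by blast
  \<comment> \<open>Solved for \<open>\<epsilon>\<close>: the error \<open>\<epsilon>1 * M\<close>,
    raised to the power \<open>p\<close>, picks up \<open>2 powr p\<close>, the sub-mean value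
    constant \<open>C\<close> and the volume ratio \<open>a\<close>.\<close>
  define \<epsilon>1 where "\<epsilon>1 = (\<epsilon> / (2 powr p * C * a)) powr (1/p)"
  have \<epsilon>1: "\<epsilon>1 > 0" "2 powr p * \<epsilon>1 powr p * C * a = \<epsilon>"
    using \<epsilon> C a p by (auto simp: \<epsilon>1_def powr_powr)
  obtain K2 where K2: "K2 \<ge> 1" and chain: "\<And>f m M x y u. (x, y) \<in> stp ^^ J \<Longrightarrow> x \<in> \<Omega> \<Longrightarrow> holomorphic_on_Cn f \<Omega> \<Longrightarrow>
      (\<And>w. N x (w - x) < \<eta> \<Longrightarrow> norm (f w) \<le> m) \<Longrightarrow> (\<And>w. (x, w) \<in> adj ^^ (J + 3) \<Longrightarrow> norm (f w) \<le> M) \<Longrightarrow>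
      N y (u - y) < \<eta> \<Longrightarrow> norm (f u) \<le> K2 * m + \<epsilon>1 / 2 * M"
    using propagate_chain[of "\<epsilon>1 / 2" J] \<epsilon>1(1) by auto
  \<comment> \<open>The constant \<open>K2\<close> of the chain is fixed first, since it multiplies
    the error of the density step; hence \<open>\<epsilon>1 / (2 * K2)\<close>.\<close>
  obtain K1 q1 where K1: "K1 \<ge> 1" "q1 > 0" and dens:
    "\<And>\<gamma> f m M x y u S. (x, y) \<in> stp \<Longrightarrow> holomorphic_on_Cn f \<Omega> \<Longrightarrow> S \<in> sets borel \<Longrightarrow> S \<subseteq> B x x \<eta> \<Longrightarrow>
      0 < \<gamma> \<Longrightarrow> \<gamma> * measure lborel (B x x \<eta>) \<le> measure lborel S \<Longrightarrow>
      (\<And>w. w \<in> S \<Longrightarrow> norm (f w) \<le> m) \<Longrightarrow> (\<And>w. (x, w) \<in> adj ^^ 3 \<Longrightarrow> norm (f w) \<le> M) \<Longrightarrow>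
      N y (u - y) < \<eta> \<Longrightarrow> norm (f u) \<le> K1 * \<gamma> powr (-q1) * m + \<epsilon>1 / (2 * K2) * M"
  proof (rule propagate_density)
    show "0 < \<epsilon>1 / (2 * K2)" using \<epsilon>1(1) K2 by simp
  qed blast
  \<comment> \<open>\<open>q1 * p\<close> comes from the p-th power, the extra 1 from dividing by
    the measure of \<open>S0\<close>, which is bounded below by a multiple of \<gamma>.\<close>
  define q where "q = q1 * p + 1"
  define K where "K = 2 powr p * 2 * (K2 * K1) powr p * c1 powr (- (q1 * p)) / c0"
  show ?thesis
  proof (rule exI[of _ K], rule exI[of _ q], intro conjI allI impI)
    show "K > 0" using K1 K2 c0 c1 by (simp add: K_def)
    show "q > 0" using K1 p by (simp add: q_def add_pos_pos)
    fix \<gamma> f z S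
    assume \<gamma>: "0 < \<gamma>" and hol: "holomorphic_on_Cn f \<Omega>" and z: "z \<in> \<Omega>" and S: "S \<in> sets borel"
      and SJ: "\<forall>x\<in>S. (x, z) \<in> stp ^^ J" and Sd: "\<gamma> * vol z \<le> measure lborel S"
    define I where "I = (\<integral>\<^sup>+w\<in>S. ennreal (norm (f w) powr p) \<partial>lborel)"
    define H where "H = (\<integral>\<^sup>+w\<in>(adj ^^ (2 * J + 4)) `` {z}. ennreal (norm (f w) powr p) \<partial>lborel)"
    have K\<gamma>: "K * \<gamma> powr (-q) > 0" using \<open>K > 0\<close> \<gamma> by simp
    interpret z: complex_norm "N z" by (rule norm[OF z])
    have V: "vol z > 0" by (rule vol_pos[OF z])
    have SO: "x \<in> \<Omega>" "(z, x) \<in> adj ^^ J" "(x, z) \<in> adj ^^ J" if "x \<in> S" for x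
    proof -
      show "(x, z) \<in> adj ^^ J" using SJ that stp_pow_adj by blast
      thus "x \<in> \<Omega>" "(z, x) \<in> adj ^^ J" using adj_pow_domain'[OF _ z] adj_pow_sym by blast+
    qed
    show "ennreal (norm (f z) powr p) * ennreal (vol z) \<le> ennreal (K * \<gamma> powr (-q)) * I + ennreal \<epsilon> * H"
    proof (cases "I = \<infinity> \<or> H = \<infinity>")
      case True
      thus ?thesis using K\<gamma> \<epsilon> by (auto simp: ennreal_mult_top)
    next
      case False
      then obtain i h where i: "I = ennreal i" "i \<ge> 0" and h: "H = ennreal h" "h \<ge> 0"
        by (metis ennreal_cases infinity_ennreal_def)
      have SD: "S \<subseteq> z.Nball z D"
        using adj_pow_compare(3)[OF SO(2) z] by (force simp: z.Nball_def D_def)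
      obtain w0 where w0: "c0 * measure lborel S \<le> measure lborel (S \<inter> z.Nball w0 \<sigma>)"
        using z.exists_concentration[OF S SD \<sigma> D] unfolding c0_def d_def by blast
      define S0 where "S0 = S \<inter> z.Nball w0 \<sigma>"
      have S0b: "S0 \<in> sets borel" using S by (auto simp: S0_def)
      have "0 < c0 * (\<gamma> * vol z)" using c0 \<gamma> V by simp
      moreover have S0m: "c0 * (\<gamma> * vol z) \<le> measure lborel S0"
        using w0 mult_left_mono[OF Sd, of c0] c0 unfolding S0_def by linarith
      ultimately have S0pos: "measure lborel S0 > 0" by linarith
      hence "S0 \<noteq> {}" by auto
      then obtain x0 where x0: "x0 \<in> S" "x0 \<in> z.Nball w0 \<sigma>" by (auto simp: S0_def)
      note x0O = SO[OF x0(1)]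
      have S0B: "S0 \<subseteq> B x0 x0 \<eta>"
      proof
        fix y assume "y \<in> S0"
        hence "N z (y - w0) < \<sigma>" by (simp add: S0_def z.Nball_def)
        moreover have "N z (w0 - x0) < \<sigma>" using x0(2) z.minus_commute[of w0 x0] by (simp add: z.Nball_def)
        ultimately have "N z (y - x0) < 2 * \<sigma>" using z.triangle[of y x0 w0] by linarith
        hence "A ^ J * N z (y - x0) < A ^ J * (2 * \<sigma>)" using AJ by (intro mult_strict_left_mono) auto
        also have "\<dots> = \<eta>" unfolding \<sigma>_def using AJ A1 by simp
        finally have "N x0 (y - x0) < \<eta>" using adj_pow_compare(1)[OF x0O(2) z, of "y - x0"] by linarith
        thus "y \<in> B x0 x0 \<eta>" using x0O by (simp add: B_iff)
      qed
      have S0sub: "S0 \<subseteq> S" by (simp add: S0_def)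
      have S0fin: "emeasure lborel S0 < \<infinity>"
        using emeasure_mono[OF S0B, of lborel] emeasure_B[OF x0O(1), of x0 \<eta>] B_borel[OF x0O(1)] by (auto simp: less_top[symmetric] top_unique)
      have "(\<integral>\<^sup>+w\<in>S0. ennreal (norm (f w) powr p) \<partial>lborel) \<le> I"
        unfolding I_def using S0sub by (intro nn_integral_mono) (auto split: split_indicator)
      hence S0I: "(\<integral>\<^sup>+w\<in>S0. ennreal (norm (f w) powr p) \<partial>lborel) \<le> ennreal i" by (simp add: i)
      define S1 where "S1 = {w \<in> S0. norm (f w) powr p \<le> 2 * i / measure lborel S0}"
      have S0O: "S0 \<subseteq> \<Omega>" using SO S0sub by blast
      have S1: "S1 \<in> sets borel" "measure lborel S0 / 2 \<le> measure lborel S1"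
        unfolding S1_def by (rule Chebyshev_half[OF S0b S0fin S0pos holomorphic_powr_borel[OF hol S0b S0O p] S0I i(2)])+
      define m where "m = (2 * i / measure lborel S0) powr (1/p)"
      have m: "m \<ge> 0" "m powr p = 2 * i / measure lborel S0" using p i S0pos by (auto simp: m_def powr_powr)
      define M where "M = (C * a * h / vol z) powr (1/p)"
      have M: "M \<ge> 0" "M powr p = C * a * h / vol z" using p C a h V by (auto simp: M_def powr_powr)
      have fm: "norm (f w) \<le> m" if "w \<in> S1" for w
      proof -
        have "norm (f w) powr p \<le> m powr p" using that m by (simp add: S1_def)
        thus ?thesis using powr_less_mono2[OF p m(1), of "norm (f w)"] by linarith
      qed
      have fM: "norm (f w) \<le> M" if w: "(x0, w) \<in> adj ^^ (J + 3)" for w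
      proof -
        have wO: "w \<in> \<Omega>" using adj_pow_domain[OF w x0O(1)] .
        have zw: "(z, w) \<in> adj ^^ (2 * J + 3)" using adj_pow_trans[OF x0O(2) w] by (simp only: mult_2 add.assoc)
        have sub: "B w w 1 \<subseteq> (adj ^^ (2 * J + 4)) `` {z}"
        proof
          fix v assume "v \<in> B w w 1"
          hence "(w, v) \<in> adj" using wO near[OF wO, of v] by (auto simp: adj_def B_iff)
          hence "(z, v) \<in> adj ^^ Suc (2 * J + 3)" by (rule relpow_Suc_I[OF zw])
          moreover have "Suc (2 * J + 3) = 2 * J + 4" by simp
          ultimately have "(z, v) \<in> adj ^^ (2 * J + 4)" by (simp only:)
          thus "v \<in> (adj ^^ (2 * J + 4)) `` {z}" by (simp only: Image_singleton_iff)
        qed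
        have "B w w 1 \<subseteq> \<Omega>" using near[OF wO] by (auto simp: B_iff wO)
        hence "ennreal (norm (f w) powr p) * emeasure lborel (B w 0 1)
          \<le> ennreal C * (\<integral>\<^sup>+v\<in>B w w 1. ennreal (norm (f v) powr p) \<partial>lborel)"
          by (intro SM norm wO holomorphic_on_Cn_subset[OF hol])
        also have "(\<integral>\<^sup>+v\<in>B w w 1. ennreal (norm (f v) powr p) \<partial>lborel) \<le> H"
          unfolding H_def using sub by (intro nn_integral_mono) (auto split: split_indicator)
        finally have "ennreal (norm (f w) powr p * vol w) \<le> ennreal (C * h)"
          using C h by (simp add: emeasure_B[OF wO] vol_def[symmetric] ennreal_mult' mult_left_mono)
        hence 1: "norm (f w) powr p * vol w \<le> C * h" using C h by simp
        have "vol z \<le> a * vol w" using adj_pow_vol[OF zw z] by (simp add: a_def d_def)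
        hence "norm (f w) powr p * vol z \<le> norm (f w) powr p * (a * vol w)" by (intro mult_left_mono) auto
        also have "\<dots> \<le> a * (C * h)" using mult_left_mono[OF 1, of a] a by (simp add: mult_ac)
        finally have "norm (f w) powr p \<le> M powr p" using V by (simp add: M field_simps)
        thus ?thesis using powr_less_mono2[OF p M(1), of "norm (f w)"] by linarith
      qed
      have x0x0: "(x0, x0) \<in> stp" using x0O by (simp add: stp_refl)
      have densS1: "c1 * \<gamma> * measure lborel (B x0 x0 \<eta>) \<le> measure lborel S1"
      proof -
        have "measure lborel (B x0 x0 \<eta>) = \<eta> ^ d * vol x0" using measure_B[OF x0O(1) \<eta>(1)] by (simp only: d_def)
        also have "\<dots> \<le> 1 * vol x0" using \<eta> vol_pos[OF x0O(1)] by (intro mult_right_mono power_le_one) auto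
        also have "vol x0 \<le> (A ^ J) ^ d * vol z" using adj_pow_vol[OF x0O(3,1)] by (simp only: d_def)
        finally have "c1 * \<gamma> * measure lborel (B x0 x0 \<eta>) \<le> c1 * \<gamma> * ((A ^ J) ^ d * vol z)"
          using c1 \<gamma> by (intro mult_left_mono) auto
        also have "\<dots> = c0 * (\<gamma> * vol z) / 2" using AJ A1 by (simp add: c1_def)
        also have "\<dots> \<le> measure lborel S1" using S0m S1(2) by simp
        finally show ?thesis .
      qed
      have 1: "norm (f u) \<le> K1 * (c1 * \<gamma>) powr (-q1) * m + \<epsilon>1 / (2 * K2) * M" if "N x0 (u - x0) < \<eta>" for u
      proof (rule dens[OF x0x0 hol S1(1) _ _ densS1 fm _ that])
        show "S1 \<subseteq> B x0 x0 \<eta>" using S0B by (auto simp: S1_def)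
        show "0 < c1 * \<gamma>" using c1 \<gamma> by simp
        show "norm (f w) \<le> M" if "(x0, w) \<in> adj ^^ 3" for w
          using fM adj_pow_mono[OF that x0O(1), of "J + 3"] by simp
      qed
      have "norm (f z) \<le> K2 * (K1 * (c1 * \<gamma>) powr (-q1) * m + \<epsilon>1 / (2 * K2) * M) + \<epsilon>1 / 2 * M"
        by (rule chain[OF _ x0O(1) hol 1 fM]) (use SJ x0 z.zero \<eta> in auto)
      also have "\<dots> = K2 * K1 * (c1 * \<gamma>) powr (-q1) * m + \<epsilon>1 * M" using K2 by (simp add: field_simps)
      finally have "norm (f z) powr p \<le> (K2 * K1 * (c1 * \<gamma>) powr (-q1) * m + \<epsilon>1 * M) powr p"
        using p by (intro powr_mono2) auto
      also have "\<dots> \<le> 2 powr p * ((K2 * K1 * (c1 * \<gamma>) powr (-q1) * m) powr p + (\<epsilon>1 * M) powr p)"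
        using K1 K2 m M \<epsilon>1 p by (intro powr_add_le) auto
      also have "(K2 * K1 * (c1 * \<gamma>) powr (-q1) * m) powr p
          = (K2 * K1) powr p * (c1 powr (-(q1 * p)) * \<gamma> powr (-(q1 * p))) * (2 * i / measure lborel S0)"
        using K1 K2 c1 \<gamma> m by (simp add: powr_mult powr_powr)
      also have "\<dots> \<le> (K2 * K1) powr p * (c1 powr (-(q1 * p)) * \<gamma> powr (-(q1 * p))) * (2 * i / (c0 * (\<gamma> * vol z)))"
        using i S0m S0pos c0 \<gamma> V by (intro mult_left_mono divide_left_mono) auto
      also have "(\<epsilon>1 * M) powr p = \<epsilon>1 powr p * (C * a * h / vol z)" using \<epsilon>1 M by (simp add: powr_mult)
      finally have "norm (f z) powr p \<le> 2 powr p * ((K2 * K1) powr p * (c1 powr (-(q1 * p)) * \<gamma> powr (-(q1 * p))) * (2 * i / (c0 * (\<gamma> * vol z)))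
           + \<epsilon>1 powr p * (C * a * h / vol z))" by simp
      hence "norm (f z) powr p * vol z \<le> 2 powr p * ((K2 * K1) powr p * (c1 powr (-(q1 * p)) * \<gamma> powr (-(q1 * p))) * (2 * i / (c0 * (\<gamma> * vol z)))
           + \<epsilon>1 powr p * (C * a * h / vol z)) * vol z" using V by (intro mult_right_mono) auto
      also have "\<dots> = K * (\<gamma> powr (-(q1 * p)) / \<gamma>) * i + (2 powr p * \<epsilon>1 powr p * C * a) * h"
        using V c0 \<gamma> by (simp add: K_def field_simps)
      also have "\<gamma> powr (-(q1 * p)) / \<gamma> = \<gamma> powr (-q)"
        using \<gamma> powr_diff[of \<gamma> "-(q1*p)" 1] by (simp add: q_def)
      finally have "norm (f z) powr p * vol z \<le> K * \<gamma> powr (-q) * i + \<epsilon> * h" by (simp only: \<epsilon>1(2))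
      hence "ennreal (norm (f z) powr p * vol z) \<le> ennreal (K * \<gamma> powr (-q) * i + \<epsilon> * h)" by (rule ennreal_leI)
      thus ?thesis using K\<gamma> \<epsilon> i h V by (simp add: ennreal_mult' ennreal_plus)
    qed
  qed
qed

section \<open>Measurability of the adjacency kernel and a Schur-type bound\<close>

lemma open_adj: "open adj"
proof -
  have 1: "continuous_on (\<Omega> \<times> \<Omega>) (\<lambda>p. N (fst p) (snd p - fst p))"
    by (rule continuous_on_compose2[OF continuous_N, of _ "\<lambda>p. (fst p, snd p - fst p)", simplified])
       (auto intro!: continuous_intros)
  have 2: "continuous_on (\<Omega> \<times> \<Omega>) (\<lambda>p. N (snd p) (fst p - snd p))"
    by (rule continuous_on_compose2[OF continuous_N, of _ "\<lambda>p. (snd p, fst p - snd p)", simplified])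
       (auto intro!: continuous_intros)
  have oo: "open (\<Omega> \<times> \<Omega>)" using open_domain by (intro open_Times)
  have "adj = ((\<Omega> \<times> \<Omega>) \<inter> (\<lambda>p. N (fst p) (snd p - fst p)) -` {..<1}) \<union> ((\<Omega> \<times> \<Omega>) \<inter> (\<lambda>p. N (snd p) (fst p - snd p)) -` {..<1})"
    by (auto simp: adj_def)
  also have "open \<dots>" by (intro open_Un continuous_open_preimage 1 2 oo open_lessThan)
  finally show ?thesis .
qed

text \<open>A composition of open relations is a union of products of open slices. Power 0 is the
  diagonal, which is not open, hence \<open>Suc n\<close>.\<close>

lemma open_adj_pow: "open (adj ^^ Suc n)"
proof (induction n)
  case 0
  show ?case using open_adj by simp
next
  case (Suc n)
  have "(adj ^^ Suc n) O adj = (\<Union>y. ((\<lambda>x. (x, y)) -` (adj ^^ Suc n)) \<times> (Pair y -` adj))"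
    by (auto simp del: relpow.simps)
  also have "open \<dots>"
  proof (intro open_UN ballI open_Times)
    fix y
    show "open ((\<lambda>x. (x, y)) -` (adj ^^ Suc n))"
      by (rule open_vimage[OF Suc]) (intro continuous_intros)
    show "open (Pair y -` adj)" by (rule open_vimage[OF open_adj]) (intro continuous_intros)
  qed
  finally show ?case by (simp only: relpow.simps)
qed

lemma adj_pow_Image_borel: "(adj ^^ Suc n) `` {z} \<in> sets borel"
proof -
  have "(adj ^^ Suc n) `` {z} = Pair z -` (adj ^^ Suc n)" by auto
  moreover have "open (Pair z -` (adj ^^ Suc n))" by (rule open_vimage[OF open_adj_pow]) (intro continuous_intros)
  ultimately show ?thesis by simp
qed

lemma weight_borel: "(\<lambda>w. ennreal (\<delta> w powr a) * indicator \<Omega> w) \<in> borel_measurable borel"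
proof -
  have "(\<lambda>w. indicator \<Omega> w *\<^sub>R (\<delta> w powr a)) \<in> borel_measurable borel"
    by (rule borel_measurable_continuous_on_indicator[OF borel_open[OF open_domain]])
       (use \<delta>_pos in \<open>force intro!: continuous_on_powr continuous_\<delta> continuous_intros\<close>)
  from measurable_compose[OF this measurable_ennreal]
  have "(\<lambda>w. ennreal (indicator \<Omega> w *\<^sub>R (\<delta> w powr a))) \<in> borel_measurable borel" .
  moreover have "(\<lambda>w. ennreal (indicator \<Omega> w *\<^sub>R (\<delta> w powr a))) = (\<lambda>w. ennreal (\<delta> w powr a) * indicator \<Omega> w)"
    by (auto simp: fun_eq_iff split: split_indicator)
  ultimately show ?thesis by (simp only:)
qed

text \<open>\<open>vol z\<close> is the measure of the slice at \<open>z\<close> of an open subset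
  of the product, so Tonelli's theorem gives measurability.\<close>

lemma vol_borel: "(\<lambda>z. ennreal (vol z) * indicator \<Omega> z) \<in> borel_measurable borel"
proof -
  have "open ((\<Omega> \<times> UNIV) \<inter> (\<lambda>p. N (fst p) (snd p)) -` {..<1})"
    using open_domain by (intro continuous_open_preimage continuous_N open_Times open_lessThan) auto
  hence "(\<Omega> \<times> UNIV) \<inter> (\<lambda>p. N (fst p) (snd p)) -` {..<1} \<in> sets (lborel \<Otimes>\<^sub>M lborel)" by (rule open_in_lborel_pair)
  from lborel.measurable_emeasure_Pair[OF this]
  have "(\<lambda>z. emeasure lborel (Pair z -` ((\<Omega> \<times> UNIV) \<inter> (\<lambda>p. N (fst p) (snd p)) -` {..<1}))) \<in> borel_measurable borel" by simp
  moreover have "emeasure lborel (Pair z -` ((\<Omega> \<times> UNIV) \<inter> (\<lambda>p. N (fst p) (snd p)) -` {..<1})) = ennreal (vol z) * indicator \<Omega> z" for z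
  proof (cases "z \<in> \<Omega>")
    case True
    hence "Pair z -` ((\<Omega> \<times> UNIV) \<inter> (\<lambda>p. N (fst p) (snd p)) -` {..<1}) = B z 0 1" by (auto simp: B_iff)
    thus ?thesis using True by (simp add: emeasure_B vol_def)
  next
    case False
    hence "Pair z -` ((\<Omega> \<times> UNIV) \<inter> (\<lambda>p. N (fst p) (snd p)) -` {..<1}) = {}" by auto
    thus ?thesis using False by simp
  qed
  ultimately show ?thesis by simp
qed

lemma adj_pow_ball:
  assumes "w \<in> \<Omega>"
  shows "{z. (z, w) \<in> adj ^^ n} \<subseteq> B w w (real n * A ^ n + 1)"
proof
  fix z assume "z \<in> {z. (z, w) \<in> adj ^^ n}"
  hence "(w, z) \<in> adj ^^ n" using adj_pow_sym by auto
  from adj_pow_compare(3)[OF this assms] show "z \<in> B w w (real n * A ^ n + 1)" using assms by (simp add: B_iff)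
qed

lemma emeasure_adj_pow:
  assumes "w \<in> \<Omega>"
  shows "emeasure lborel {z. (z, w) \<in> adj ^^ n} \<le> ennreal ((real n * A ^ n + 1) ^ DIM(complex ^ 'n) * vol w)"
proof -
  have "real n * A ^ n + 1 > 0" using A1 by (simp add: add_nonneg_pos)
  thus ?thesis
    using emeasure_mono[OF adj_pow_ball[OF assms, of n], of lborel] B_borel[OF assms]
      measure_B[OF assms, of "real n * A ^ n + 1" w] emeasure_B[OF assms, of w "real n * A ^ n + 1"] by simp
qed

text \<open>Schur test: after exchanging the integrals, the points \<open>z\<close> within
  \<open>Suc n\<close> steps of \<open>w\<close> fill a set of volume at most a multiple of
  \<open>vol w\<close>, and on it both \<open>vol\<close> and the weight are comparable to their
  values at \<open>w\<close>. The three factors of \<open>C\<close> are these comparisons; division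
  by \<open>vol z\<close> cancels the volume of the set.\<close>

lemma kernel_bound:
  fixes \<alpha> :: real and n :: nat
  defines "C \<equiv> (A ^ Suc n) powr \<bar>\<alpha>\<bar> * (A ^ Suc n) ^ DIM(complex ^ 'n) * (real (Suc n) * A ^ Suc n + 1) ^ DIM(complex ^ 'n)"
  assumes F: "(\<lambda>w. F w * indicator \<Omega> w) \<in> borel_measurable borel"
  shows "(\<integral>\<^sup>+z\<in>\<Omega>. ennreal (\<delta> z powr \<alpha> / vol z) * (\<integral>\<^sup>+w\<in>(adj ^^ Suc n) `` {z}. F w \<partial>lborel) \<partial>lborel)
    \<le> ennreal C * (\<integral>\<^sup>+w\<in>\<Omega>. F w * ennreal (\<delta> w powr \<alpha>) \<partial>lborel)"
proof -
  define R where "R = adj ^^ Suc n"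
  define a where "a = (A ^ Suc n) powr \<bar>\<alpha>\<bar>"
  define b where "b = (A ^ Suc n) ^ DIM(complex ^ 'n)"
  define c where "c = (real (Suc n) * A ^ Suc n + 1) ^ DIM(complex ^ 'n)"
  define g where "g w = F w * indicator \<Omega> w * ennreal (a * b * \<delta> w powr \<alpha> / vol w)" for w
  have AS: "A ^ Suc n \<ge> 1" using A1 by (rule one_le_power)
  have ab: "a > 0" "b > 0" "c \<ge> 0" using AS A1 by (auto simp: a_def b_def c_def)
  have \<delta>b: "(\<lambda>w. indicator \<Omega> w *\<^sub>R (\<delta> w powr \<alpha>)) \<in> borel_measurable borel"
    by (rule borel_measurable_continuous_on_indicator[OF borel_open[OF open_domain]])
       (use \<delta>_pos in \<open>force intro!: continuous_on_powr continuous_\<delta> continuous_intros\<close>)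
  have vb: "(\<lambda>z. enn2real (ennreal (vol z) * indicator \<Omega> z)) \<in> borel_measurable borel"
    by (rule measurable_compose[OF vol_borel]) simp
  have gb: "g \<in> borel_measurable borel"
  proof -
    have "(\<lambda>w. ennreal (a * b * (indicator \<Omega> w *\<^sub>R (\<delta> w powr \<alpha>)) / enn2real (ennreal (vol w) * indicator \<Omega> w))) \<in> borel_measurable borel"
      using \<delta>b vb by (intro measurable_compose[OF _ measurable_ennreal] borel_measurable_times borel_measurable_divide) auto
    hence "(\<lambda>w. (F w * indicator \<Omega> w) * ennreal (a * b * (indicator \<Omega> w *\<^sub>R (\<delta> w powr \<alpha>)) / enn2real (ennreal (vol w) * indicator \<Omega> w))) \<in> borel_measurable borel"
      by (rule borel_measurable_times_ennreal[OF F])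
    moreover have "(\<lambda>w. (F w * indicator \<Omega> w) * ennreal (a * b * (indicator \<Omega> w *\<^sub>R (\<delta> w powr \<alpha>)) / enn2real (ennreal (vol w) * indicator \<Omega> w))) = g"
      using vol_pos by (auto simp: g_def fun_eq_iff less_imp_le split: split_indicator)
    ultimately show ?thesis by simp
  qed
  have Rm: "R \<in> sets (lborel \<Otimes>\<^sub>M lborel)" unfolding R_def by (rule open_in_lborel_pair[OF open_adj_pow])
  have meas: "(\<lambda>(z, w). indicator R (z, w) * g w) \<in> borel_measurable (lborel \<Otimes>\<^sub>M lborel)"
  proof -
    have "(indicator R :: _ \<Rightarrow> ennreal) \<in> borel_measurable (lborel \<Otimes>\<^sub>M lborel)" using Rm by (rule borel_measurable_indicator)
    moreover have "(\<lambda>p. g (snd p)) \<in> borel_measurable (lborel \<Otimes>\<^sub>M lborel)"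
      using gb by (intro measurable_compose[OF measurable_snd]) simp
    ultimately have "(\<lambda>p. indicator R p * g (snd p)) \<in> borel_measurable (lborel \<Otimes>\<^sub>M lborel)" by (rule borel_measurable_times_ennreal)
    thus ?thesis by (simp add: case_prod_beta')
  qed
  have "(\<integral>\<^sup>+z\<in>\<Omega>. ennreal (\<delta> z powr \<alpha> / vol z) * (\<integral>\<^sup>+w\<in>R `` {z}. F w \<partial>lborel) \<partial>lborel)
     \<le> (\<integral>\<^sup>+z. (\<integral>\<^sup>+w. indicator R (z, w) * g w \<partial>lborel) \<partial>lborel)"
  proof (rule nn_integral_mono)
    fix z
    show "ennreal (\<delta> z powr \<alpha> / vol z) * (\<integral>\<^sup>+w\<in>R `` {z}. F w \<partial>lborel) * indicator \<Omega> z
      \<le> (\<integral>\<^sup>+w. indicator R (z, w) * g w \<partial>lborel)"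
    proof (cases "z \<in> \<Omega>")
      case True
      have Rz: "R `` {z} \<in> sets borel" unfolding R_def by (rule adj_pow_Image_borel)
      have eqF: "F w * indicator (R `` {z}) w = (F w * indicator \<Omega> w) * indicator (R `` {z}) w" for w
        using adj_pow_domain[OF _ True, of w "Suc n"] unfolding R_def
        by (cases "(z, w) \<in> adj ^^ Suc n") (auto simp del: relpow.simps split: split_indicator)
      have "ennreal (\<delta> z powr \<alpha> / vol z) * (\<integral>\<^sup>+w\<in>R `` {z}. F w \<partial>lborel)
         = (\<integral>\<^sup>+w. ennreal (\<delta> z powr \<alpha> / vol z) * (F w * indicator (R `` {z}) w) \<partial>lborel)"
        unfolding eqF by (rule nn_integral_cmult[symmetric]) (use Rz F in \<open>auto intro: borel_measurable_times_ennreal[of "\<lambda>w. F w * indicator \<Omega> w"]\<close>)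
      also have "\<dots> \<le> (\<integral>\<^sup>+w. indicator R (z, w) * g w \<partial>lborel)"
      proof (rule nn_integral_mono)
        fix w
        show "ennreal (\<delta> z powr \<alpha> / vol z) * (F w * indicator (R `` {z}) w) \<le> indicator R (z, w) * g w"
        proof (cases "(z, w) \<in> R")
          case zw: True
          hence zw': "(z, w) \<in> adj ^^ Suc n" by (simp add: R_def)
          have w: "w \<in> \<Omega>" by (rule adj_pow_domain[OF zw' True])
          have wz: "(w, z) \<in> adj ^^ Suc n" by (rule adj_pow_sym[OF zw'])
          have 1: "\<delta> z powr \<alpha> \<le> a * \<delta> w powr \<alpha>" unfolding a_def
            by (rule powr_comparable[OF \<delta>_pos[OF True] \<delta>_pos[OF w] adj_pow_compare(2)[OF wz w] adj_pow_compare(2)[OF zw' True] AS])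
          have 2: "vol w \<le> b * vol z" unfolding b_def by (rule adj_pow_vol[OF wz w])
          have "\<delta> z powr \<alpha> / vol z \<le> (a * \<delta> w powr \<alpha>) / (vol w / b)"
            using 1 2 ab vol_pos[OF w] vol_pos[OF True] by (intro frac_le) (auto simp: field_simps)
          hence "ennreal (\<delta> z powr \<alpha> / vol z) \<le> ennreal (a * b * \<delta> w powr \<alpha> / vol w)"
            by (intro ennreal_leI) (simp add: mult_ac)
          hence "F w * ennreal (\<delta> z powr \<alpha> / vol z) \<le> F w * ennreal (a * b * \<delta> w powr \<alpha> / vol w)"
            by (rule mult_left_mono) simp
          thus ?thesis using zw w by (simp add: g_def mult.commute)
        qed simp
      qed
      finally show ?thesis using True by simp
    qed simp
  qed
  also have "\<dots> = (\<integral>\<^sup>+w. (\<integral>\<^sup>+z. indicator R (z, w) * g w \<partial>lborel) \<partial>lborel)"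
    using lborel_pair.Fubini'[OF meas] by simp
  also have "\<dots> \<le> (\<integral>\<^sup>+w. ennreal C * (F w * ennreal (\<delta> w powr \<alpha>) * indicator \<Omega> w) \<partial>lborel)"
  proof (rule nn_integral_mono)
    fix w
    have Rw: "{z. (z, w) \<in> R} \<in> sets lborel"
    proof -
      have "{z. (z, w) \<in> R} = (\<lambda>z. (z, w)) -` R" by auto
      moreover have "open ((\<lambda>z. (z, w)) -` R)" unfolding R_def by (rule open_vimage[OF open_adj_pow]) (intro continuous_intros)
      ultimately show ?thesis by simp
    qed
    have "(\<integral>\<^sup>+z. indicator R (z, w) * g w \<partial>lborel) = (\<integral>\<^sup>+z. g w * indicator {z. (z, w) \<in> R} z \<partial>lborel)"
      by (intro nn_integral_cong) (auto split: split_indicator)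
    also have "\<dots> = g w * emeasure lborel {z. (z, w) \<in> R}" using Rw by (rule nn_integral_cmult_indicator)
    also have "\<dots> \<le> ennreal C * (F w * ennreal (\<delta> w powr \<alpha>) * indicator \<Omega> w)"
    proof (cases "w \<in> \<Omega>")
      case True
      have "g w * emeasure lborel {z. (z, w) \<in> R} \<le> g w * ennreal (c * vol w)"
        unfolding R_def c_def by (intro mult_left_mono emeasure_adj_pow True) simp
      also have "\<dots> = F w * (ennreal (a * b * \<delta> w powr \<alpha> / vol w) * ennreal (c * vol w))"
        using True by (simp add: g_def mult.assoc)
      also have "ennreal (a * b * \<delta> w powr \<alpha> / vol w) * ennreal (c * vol w) = ennreal (C * \<delta> w powr \<alpha>)"
        using ab vol_pos[OF True] by (subst ennreal_mult''[symmetric]) (auto simp: C_def a_def b_def c_def)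
      also have "\<dots> = ennreal C * ennreal (\<delta> w powr \<alpha>)" by (simp add: ennreal_mult'')
      finally show ?thesis using True by (simp add: mult_ac)
    next
      case False
      thus ?thesis by (simp add: g_def)
    qed
    finally show "(\<integral>\<^sup>+z. indicator R (z, w) * g w \<partial>lborel) \<le> ennreal C * (F w * ennreal (\<delta> w powr \<alpha>) * indicator \<Omega> w)" .
  qed
  also have "\<dots> = ennreal C * (\<integral>\<^sup>+w\<in>\<Omega>. F w * ennreal (\<delta> w powr \<alpha>) \<partial>lborel)"
  proof (rule nn_integral_cmult)
    have "(\<lambda>w. (F w * indicator \<Omega> w) * (ennreal (\<delta> w powr \<alpha>) * indicator \<Omega> w)) \<in> borel_measurable borel"
      by (rule borel_measurable_times_ennreal[OF F weight_borel])
    moreover have "(\<lambda>w. (F w * indicator \<Omega> w) * (ennreal (\<delta> w powr \<alpha>) * indicator \<Omega> w)) = (\<lambda>w. F w * ennreal (\<delta> w powr \<alpha>) * indicator \<Omega> w)"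
      by (auto simp: fun_eq_iff split: split_indicator)
    ultimately show "(\<lambda>w. F w * ennreal (\<delta> w powr \<alpha>) * indicator \<Omega> w) \<in> borel_measurable lborel" by simp
  qed
  finally show ?thesis unfolding R_def .
qed

end

section \<open>Dominating sets for a field of complex norms\<close>

context complex_norm_field
begin

text \<open>What the density hypothesis says once the Kobayashi balls are eliminated: a Borel piece
  of \<open>E\<close>, chosen for each \<open>z\<close>, from which \<open>z\<close> is reached in
  \<open>J\<close> steps. The choice is made pointwise; \<open>S\<close> is enlarged to a set
  independent of the choice before anything is integrated in \<open>z\<close>.\<close>

definition chain_dense :: "nat \<Rightarrow> real \<Rightarrow> (complex ^ 'n) set \<Rightarrow> bool" where
  "chain_dense J \<gamma> E \<longleftrightarrow> E \<in> sets borel \<and> E \<subseteq> \<Omega> \<and>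
     (\<forall>z\<in>\<Omega>. \<exists>S\<in>sets borel. S \<subseteq> E \<and> (\<forall>x\<in>S. (x, z) \<in> stp ^^ J) \<and> \<gamma> * vol z \<le> measure lborel S)"

text \<open>The local estimate is divided by \<open>vol z\<close> and integrated against the weight.
  By the Schur bound its error returns as \<open>C * \<epsilon>\<close> = 1/2 times the integral
  over \<Omega>, and finiteness of this integral allows it to be subtracted.\<close>

lemma dominating_integral:
  fixes p \<alpha> :: real
  assumes p: "p > 0"
  shows "\<exists>K q. K > 0 \<and> q > 0 \<and> (\<forall>\<gamma> f E. 0 < \<gamma> \<longrightarrow> holomorphic_on_Cn f \<Omega> \<longrightarrow> chain_dense J \<gamma> E \<longrightarrow>
     (\<integral>\<^sup>+w\<in>\<Omega>. ennreal (norm (f w) powr p) * ennreal (\<delta> w powr \<alpha>) \<partial>lborel) < \<infinity> \<longrightarrow>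
     (\<integral>\<^sup>+w\<in>\<Omega>. ennreal (norm (f w) powr p) * ennreal (\<delta> w powr \<alpha>) \<partial>lborel)
       \<le> ennreal (K * \<gamma> powr (-q)) * (\<integral>\<^sup>+w\<in>E. ennreal (norm (f w) powr p) * ennreal (\<delta> w powr \<alpha>) \<partial>lborel))"
proof -
  define n where "n = 2 * J + 3"
  define C where "C = (A ^ Suc n) powr \<bar>\<alpha>\<bar> * (A ^ Suc n) ^ DIM(complex ^ 'n) * (real (Suc n) * A ^ Suc n + 1) ^ DIM(complex ^ 'n)"
  have "A ^ Suc n > 0" "real (Suc n) * A ^ Suc n + 1 > 0" using A1 by (auto simp: add_nonneg_pos)
  hence C: "C > 0" unfolding C_def by (intro mult_pos_pos zero_less_power powr_gt_zero[THEN iffD2]) (use A1 in auto)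
  define \<epsilon> where "\<epsilon> = 1 / (2 * C)"
  have \<epsilon>: "\<epsilon> > 0" using C by (simp add: \<epsilon>_def)
  have Sn: "2 * J + 4 = Suc n" by (simp add: n_def)
  obtain K q where Kq: "K > 0" "q > 0" and LE: "\<And>\<gamma> f z S. 0 < \<gamma> \<Longrightarrow> holomorphic_on_Cn f \<Omega> \<Longrightarrow> z \<in> \<Omega> \<Longrightarrow> S \<in> sets borel \<Longrightarrow>
     (\<forall>x\<in>S. (x, z) \<in> stp ^^ J) \<Longrightarrow> \<gamma> * vol z \<le> measure lborel S \<Longrightarrow>
     ennreal (norm (f z) powr p) * ennreal (vol z)
       \<le> ennreal (K * \<gamma> powr (-q)) * (\<integral>\<^sup>+w\<in>S. ennreal (norm (f w) powr p) \<partial>lborel)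
         + ennreal \<epsilon> * (\<integral>\<^sup>+w\<in>(adj ^^ Suc n) `` {z}. ennreal (norm (f w) powr p) \<partial>lborel)"
    using local_estimate[OF p \<epsilon>, of J] unfolding Sn by blast
  show ?thesis
  proof (rule exI[of _ "2 * C * K"], rule exI[of _ q], intro conjI allI impI)
    show "0 < 2 * C * K" using C Kq by simp
    show "0 < q" by fact
    fix \<gamma> f E
    assume \<gamma>: "0 < \<gamma>" and hol: "holomorphic_on_Cn f \<Omega>" and cd: "chain_dense J \<gamma> E"
    have E: "E \<in> sets borel" "E \<subseteq> \<Omega>"
      and dom: "\<forall>z\<in>\<Omega>. \<exists>S\<in>sets borel. S \<subseteq> E \<and> (\<forall>x\<in>S. (x, z) \<in> stp ^^ J) \<and> \<gamma> * vol z \<le> measure lborel S"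
      using cd unfolding chain_dense_def by blast+
    define F where "F w = ennreal (norm (f w) powr p)" for w
    define W where "W w = ennreal (\<delta> w powr \<alpha>)" for w
    define k where "k = ennreal (K * \<gamma> powr (-q))"
    \<comment> \<open>\<open>S\<close> is replaced by the larger set \<open>E\<close> here, so that
      the integrand does not depend on \<open>z\<close> and one application of
      \<open>kernel_bound\<close> treats both terms.\<close>
    define G where "G w = k * (F w * indicator E w) + ennreal \<epsilon> * (F w * indicator \<Omega> w)" for w
    assume "(\<integral>\<^sup>+w\<in>\<Omega>. ennreal (norm (f w) powr p) * ennreal (\<delta> w powr \<alpha>) \<partial>lborel) < \<infinity>"
    hence fin: "(\<integral>\<^sup>+w\<in>\<Omega>. F w * W w \<partial>lborel) < \<infinity>" by (simp add: F_def W_def)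
    have FE: "(\<lambda>w. F w * indicator E w) \<in> borel_measurable borel"
      unfolding F_def by (rule holomorphic_powr_borel'[OF hol E p])
    have F\<Omega>: "(\<lambda>w. F w * indicator \<Omega> w) \<in> borel_measurable borel"
      unfolding F_def by (rule holomorphic_powr_borel'[OF hol borel_open[OF open_domain] order_refl p])
    have Gb: "G \<in> borel_measurable borel"
      unfolding G_def using FE F\<Omega> by (intro borel_measurable_add borel_measurable_times_ennreal[OF borel_measurable_const])
    have WB: "(\<lambda>w. W w * indicator \<Omega> w) \<in> borel_measurable borel" unfolding W_def by (rule weight_borel)
    have pt: "F z * ennreal (\<delta> z powr \<alpha>) \<le> ennreal (\<delta> z powr \<alpha> / vol z) * (\<integral>\<^sup>+w\<in>(adj ^^ Suc n) `` {z}. G w \<partial>lborel)"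
      if z: "z \<in> \<Omega>" for z
    proof -
      obtain S where S: "S \<in> sets borel" "S \<subseteq> E" "\<forall>x\<in>S. (x, z) \<in> stp ^^ J" "\<gamma> * vol z \<le> measure lborel S"
        using dom z by blast
      have Rb: "(adj ^^ Suc n) `` {z} \<in> sets borel" by (rule adj_pow_Image_borel)
      have SR: "S \<subseteq> E \<inter> (adj ^^ Suc n) `` {z}"
      proof
        fix x assume x: "x \<in> S"
        hence xz: "(z, x) \<in> adj ^^ J" using S(3) stp_pow_adj adj_pow_sym by blast
        have "(z, x) \<in> adj ^^ Suc n" by (rule adj_pow_mono[OF xz z]) (simp add: n_def)
        thus "x \<in> E \<inter> (adj ^^ Suc n) `` {z}" using x S(2) by auto
      qed
      have RO: "(adj ^^ Suc n) `` {z} \<subseteq> \<Omega>" using adj_pow_domain z by blast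
      have 1: "(\<integral>\<^sup>+w\<in>S. F w \<partial>lborel) \<le> (\<integral>\<^sup>+w. (F w * indicator E w) * indicator ((adj ^^ Suc n) `` {z}) w \<partial>lborel)"
        using SR by (intro nn_integral_mono) (auto split: split_indicator)
      have 2: "(\<integral>\<^sup>+w\<in>(adj ^^ Suc n) `` {z}. F w \<partial>lborel) = (\<integral>\<^sup>+w. (F w * indicator \<Omega> w) * indicator ((adj ^^ Suc n) `` {z}) w \<partial>lborel)"
        using RO by (intro nn_integral_cong) (auto split: split_indicator)
      have m1: "(\<lambda>w. (F w * indicator E w) * indicator ((adj ^^ Suc n) `` {z}) w) \<in> borel_measurable lborel"
        using borel_measurable_times_ennreal[OF FE borel_measurable_indicator[OF Rb]] by (simp del: relpow.simps)
      have m2: "(\<lambda>w. (F w * indicator \<Omega> w) * indicator ((adj ^^ Suc n) `` {z}) w) \<in> borel_measurable lborel"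
        using borel_measurable_times_ennreal[OF F\<Omega> borel_measurable_indicator[OF Rb]] by (simp del: relpow.simps)
      have "F z * ennreal (vol z) \<le> k * (\<integral>\<^sup>+w\<in>S. F w \<partial>lborel) + ennreal \<epsilon> * (\<integral>\<^sup>+w\<in>(adj ^^ Suc n) `` {z}. F w \<partial>lborel)"
        unfolding F_def k_def by (rule LE[OF \<gamma> hol z S(1,3,4)])
      also have "\<dots> \<le> k * (\<integral>\<^sup>+w. (F w * indicator E w) * indicator ((adj ^^ Suc n) `` {z}) w \<partial>lborel)
          + ennreal \<epsilon> * (\<integral>\<^sup>+w. (F w * indicator \<Omega> w) * indicator ((adj ^^ Suc n) `` {z}) w \<partial>lborel)"
        unfolding 2 using 1 by (intro add_mono mult_left_mono order_refl) auto
      also have "\<dots> = (\<integral>\<^sup>+w. k * ((F w * indicator E w) * indicator ((adj ^^ Suc n) `` {z}) w)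
          + ennreal \<epsilon> * ((F w * indicator \<Omega> w) * indicator ((adj ^^ Suc n) `` {z}) w) \<partial>lborel)"
        by (subst nn_integral_add)
           (auto simp only: nn_integral_cmult[OF m1] nn_integral_cmult[OF m2] intro!: borel_measurable_times_ennreal m1 m2 borel_measurable_const)
      also have "\<dots> = (\<integral>\<^sup>+w\<in>(adj ^^ Suc n) `` {z}. G w \<partial>lborel)"
        by (intro nn_integral_cong) (simp add: G_def distrib_right mult.assoc)
      finally have le: "F z * ennreal (vol z) \<le> (\<integral>\<^sup>+w\<in>(adj ^^ Suc n) `` {z}. G w \<partial>lborel)" .
      have "F z * ennreal (\<delta> z powr \<alpha>) = ennreal (\<delta> z powr \<alpha> / vol z) * (F z * ennreal (vol z))"
      proof -
        have "ennreal (\<delta> z powr \<alpha>) = ennreal (\<delta> z powr \<alpha> / vol z) * ennreal (vol z)"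
          using vol_pos[OF z] by (subst ennreal_mult''[symmetric]) auto
        thus ?thesis by (simp add: mult_ac)
      qed
      also have "\<dots> \<le> ennreal (\<delta> z powr \<alpha> / vol z) * (\<integral>\<^sup>+w\<in>(adj ^^ Suc n) `` {z}. G w \<partial>lborel)"
        by (rule mult_left_mono[OF le]) simp
      finally show ?thesis .
    qed
    have "(\<integral>\<^sup>+w\<in>\<Omega>. F w * W w \<partial>lborel) \<le> (\<integral>\<^sup>+z\<in>\<Omega>. ennreal (\<delta> z powr \<alpha> / vol z) * (\<integral>\<^sup>+w\<in>(adj ^^ Suc n) `` {z}. G w \<partial>lborel) \<partial>lborel)"
      using pt by (intro nn_integral_mono) (auto simp: W_def simp del: relpow.simps split: split_indicator)
    also have "\<dots> \<le> ennreal C * (\<integral>\<^sup>+w\<in>\<Omega>. G w * ennreal (\<delta> w powr \<alpha>) \<partial>lborel)"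
      unfolding C_def by (rule kernel_bound) (use Gb open_domain in auto)
    also have "(\<integral>\<^sup>+w\<in>\<Omega>. G w * ennreal (\<delta> w powr \<alpha>) \<partial>lborel)
       = (\<integral>\<^sup>+w. k * ((F w * indicator E w) * (W w * indicator \<Omega> w)) + ennreal \<epsilon> * ((F w * indicator \<Omega> w) * (W w * indicator \<Omega> w)) \<partial>lborel)"
      by (intro nn_integral_cong) (auto simp: G_def W_def distrib_right mult.assoc split: split_indicator)
    also have "\<dots> = k * (\<integral>\<^sup>+w. (F w * indicator E w) * (W w * indicator \<Omega> w) \<partial>lborel)
        + ennreal \<epsilon> * (\<integral>\<^sup>+w. (F w * indicator \<Omega> w) * (W w * indicator \<Omega> w) \<partial>lborel)"
    proof -
      have m1: "(\<lambda>w. (F w * indicator E w) * (W w * indicator \<Omega> w)) \<in> borel_measurable lborel"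
        using borel_measurable_times_ennreal[OF FE WB] by simp
      have m2: "(\<lambda>w. (F w * indicator \<Omega> w) * (W w * indicator \<Omega> w)) \<in> borel_measurable lborel"
        using borel_measurable_times_ennreal[OF F\<Omega> WB] by simp
      show ?thesis
        by (subst nn_integral_add)
           (auto simp only: nn_integral_cmult[OF m1] nn_integral_cmult[OF m2] intro!: borel_measurable_times_ennreal m1 m2 borel_measurable_const)
    qed
    also have "(\<integral>\<^sup>+w. (F w * indicator E w) * (W w * indicator \<Omega> w) \<partial>lborel) = (\<integral>\<^sup>+w\<in>E. F w * W w \<partial>lborel)"
      using E(2) by (intro nn_integral_cong) (auto split: split_indicator)
    also have "(\<integral>\<^sup>+w. (F w * indicator \<Omega> w) * (W w * indicator \<Omega> w) \<partial>lborel) = (\<integral>\<^sup>+w\<in>\<Omega>. F w * W w \<partial>lborel)"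
      by (intro nn_integral_cong) (auto split: split_indicator)
    finally have main: "(\<integral>\<^sup>+w\<in>\<Omega>. F w * W w \<partial>lborel) \<le> ennreal C * (k * (\<integral>\<^sup>+w\<in>E. F w * W w \<partial>lborel)
        + ennreal \<epsilon> * (\<integral>\<^sup>+w\<in>\<Omega>. F w * W w \<partial>lborel))" .
    have "(\<integral>\<^sup>+w\<in>E. F w * W w \<partial>lborel) \<le> (\<integral>\<^sup>+w\<in>\<Omega>. F w * W w \<partial>lborel)"
      using E(2) by (intro nn_integral_mono) (auto split: split_indicator)
    hence finE: "(\<integral>\<^sup>+w\<in>E. F w * W w \<partial>lborel) < \<infinity>" using fin by (rule le_less_trans)
    obtain i where i: "(\<integral>\<^sup>+w\<in>\<Omega>. F w * W w \<partial>lborel) = ennreal i" "i \<ge> 0"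
      using fin by (metis ennreal_cases infinity_ennreal_def less_irrefl)
    obtain j where j: "(\<integral>\<^sup>+w\<in>E. F w * W w \<partial>lborel) = ennreal j" "j \<ge> 0"
      using finE by (metis ennreal_cases infinity_ennreal_def less_irrefl)
    have K\<gamma>: "K * \<gamma> powr (-q) > 0" using Kq \<gamma> by simp
    have "ennreal i \<le> ennreal (C * (K * \<gamma> powr (-q) * j + \<epsilon> * i))"
      using main C K\<gamma> \<epsilon> i j unfolding i j k_def by (simp add: ennreal_mult' ennreal_plus)
    hence "i \<le> C * (K * \<gamma> powr (-q) * j + \<epsilon> * i)"
      using C K\<gamma> \<epsilon> i j by (subst (asm) ennreal_le_iff) auto
    also have "\<dots> = C * K * \<gamma> powr (-q) * j + i / 2" using C by (simp add: \<epsilon>_def field_simps)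
    finally have "i \<le> 2 * C * K * \<gamma> powr (-q) * j" by simp
    hence "ennreal i \<le> ennreal (2 * C * K * \<gamma> powr (-q) * j)" by (rule ennreal_leI)
    also have "\<dots> = ennreal (2 * C * K * \<gamma> powr (-q)) * ennreal j" using j by (simp add: ennreal_mult'')
    finally show "(\<integral>\<^sup>+w\<in>\<Omega>. ennreal (norm (f w) powr p) * ennreal (\<delta> w powr \<alpha>) \<partial>lborel)
       \<le> ennreal (2 * C * K * \<gamma> powr (-q)) * (\<integral>\<^sup>+w\<in>E. ennreal (norm (f w) powr p) * ennreal (\<delta> w powr \<alpha>) \<partial>lborel)"
      using i j by (simp add: F_def W_def)
  qed
qed

text \<open>The local estimate with p = 1 suffices, as its integrals are bounded by suprema times
  volumes. \<open>M\<close> makes the supremum of |f| finite; the estimate is then applied with the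
  supremum itself as bound, and half of it is absorbed.\<close>

lemma dominating_sup:
  shows "\<exists>K q. K > 0 \<and> q > 0 \<and> (\<forall>\<gamma> f E m M. 0 < \<gamma> \<longrightarrow> holomorphic_on_Cn f \<Omega> \<longrightarrow> chain_dense J \<gamma> E \<longrightarrow>
     (AE w in lborel. w \<in> E \<longrightarrow> norm (f w) \<le> m) \<longrightarrow> 0 \<le> m \<longrightarrow> (\<forall>w\<in>\<Omega>. norm (f w) \<le> M) \<longrightarrow>
     (\<forall>z\<in>\<Omega>. norm (f z) \<le> K * \<gamma> powr (-q) * m))"
proof -
  define n where "n = 2 * J + 3"
  define C where "C = (real (Suc n) * A ^ Suc n + 1) ^ DIM(complex ^ 'n)"
  have "real (Suc n) * A ^ Suc n + 1 > 0" using A1 by (auto simp: add_nonneg_pos)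
  hence C: "C > 0" unfolding C_def by simp
  define \<epsilon> where "\<epsilon> = 1 / (2 * C)"
  have \<epsilon>: "\<epsilon> > 0" using C by (simp add: \<epsilon>_def)
  have Sn: "2 * J + 4 = Suc n" by (simp add: n_def)
  have p1: "(1::real) > 0" by simp
  obtain K q where Kq: "K > 0" "q > 0" and LE: "\<And>\<gamma> f z S. 0 < \<gamma> \<Longrightarrow> holomorphic_on_Cn f \<Omega> \<Longrightarrow> z \<in> \<Omega> \<Longrightarrow> S \<in> sets borel \<Longrightarrow>
     (\<forall>x\<in>S. (x, z) \<in> stp ^^ J) \<Longrightarrow> \<gamma> * vol z \<le> measure lborel S \<Longrightarrow>
     ennreal (norm (f z) powr 1) * ennreal (vol z)
       \<le> ennreal (K * \<gamma> powr (-q)) * (\<integral>\<^sup>+w\<in>S. ennreal (norm (f w) powr 1) \<partial>lborel)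
         + ennreal \<epsilon> * (\<integral>\<^sup>+w\<in>(adj ^^ Suc n) `` {z}. ennreal (norm (f w) powr 1) \<partial>lborel)"
    using local_estimate[OF p1 \<epsilon>, of J] unfolding Sn by blast
  show ?thesis
  proof (rule exI[of _ "2 * C * K"], rule exI[of _ q], intro conjI allI impI)
    show "0 < 2 * C * K" using C Kq by simp
    show "0 < q" by fact
    fix \<gamma> f E m M
    assume \<gamma>: "0 < \<gamma>" and hol: "holomorphic_on_Cn f \<Omega>" and cd: "chain_dense J \<gamma> E"
      and fm: "AE w in lborel. w \<in> E \<longrightarrow> norm (f w) \<le> m" and m0: "0 \<le> m" and fM: "\<forall>w\<in>\<Omega>. norm (f w) \<le> M"
    have dom: "\<forall>z\<in>\<Omega>. \<exists>S\<in>sets borel. S \<subseteq> E \<and> (\<forall>x\<in>S. (x, z) \<in> stp ^^ J) \<and> \<gamma> * vol z \<le> measure lborel S"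
      using cd unfolding chain_dense_def by blast
    have K\<gamma>: "K * \<gamma> powr (-q) > 0" using Kq \<gamma> by simp
    have pt: "norm (f z) \<le> C * (K * \<gamma> powr (-q) * m) + M' / 2" if z: "z \<in> \<Omega>" and fM': "\<forall>w\<in>\<Omega>. norm (f w) \<le> M'" for z M'
    proof -
      obtain S where S: "S \<in> sets borel" "S \<subseteq> E" "\<forall>x\<in>S. (x, z) \<in> stp ^^ J" "\<gamma> * vol z \<le> measure lborel S"
        using dom z by blast
      have M'0: "0 \<le> M'" using fM' z norm_ge_zero order_trans by blast
      have Rb: "(adj ^^ Suc n) `` {z} \<in> sets borel" by (rule adj_pow_Image_borel)
      have SR: "S \<subseteq> (adj ^^ Suc n) `` {z}"
      proof
        fix x assume x: "x \<in> S"
        hence xz: "(z, x) \<in> adj ^^ J" using S(3) stp_pow_adj adj_pow_sym by blast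
        have "(z, x) \<in> adj ^^ Suc n" by (rule adj_pow_mono[OF xz z]) (simp add: n_def)
        thus "x \<in> (adj ^^ Suc n) `` {z}" by auto
      qed
      have RO: "(adj ^^ Suc n) `` {z} \<subseteq> \<Omega>" using adj_pow_domain z by blast
      have Rv: "emeasure lborel ((adj ^^ Suc n) `` {z}) \<le> ennreal (C * vol z)"
      proof -
        have "(adj ^^ Suc n) `` {z} = {w. (w, z) \<in> adj ^^ Suc n}" using adj_pow_sym by blast
        thus ?thesis using emeasure_adj_pow[OF z, of "Suc n"] unfolding C_def by simp
      qed
      have "(\<integral>\<^sup>+w\<in>S. ennreal (norm (f w) powr 1) \<partial>lborel) \<le> (\<integral>\<^sup>+w. ennreal m * indicator ((adj ^^ Suc n) `` {z}) w \<partial>lborel)"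
      proof (rule nn_integral_mono_AE)
        show "AE w in lborel. ennreal (norm (f w) powr 1) * indicator S w \<le> ennreal m * indicator ((adj ^^ Suc n) `` {z}) w"
          using fm by eventually_elim (use SR S(2) in \<open>auto simp del: relpow.simps intro!: ennreal_leI split: split_indicator\<close>)
      qed
      also have "\<dots> \<le> ennreal m * ennreal (C * vol z)"
        using Rb Rv by (subst nn_integral_cmult_indicator) (auto simp del: relpow.simps intro: mult_left_mono)
      finally have 1: "(\<integral>\<^sup>+w\<in>S. ennreal (norm (f w) powr 1) \<partial>lborel) \<le> ennreal m * ennreal (C * vol z)" .
      have "(\<integral>\<^sup>+w\<in>(adj ^^ Suc n) `` {z}. ennreal (norm (f w) powr 1) \<partial>lborel) \<le> (\<integral>\<^sup>+w. ennreal M' * indicator ((adj ^^ Suc n) `` {z}) w \<partial>lborel)"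
        by (rule nn_integral_mono) (use RO fM' in \<open>auto simp del: relpow.simps intro!: ennreal_leI split: split_indicator\<close>)
      also have "\<dots> \<le> ennreal M' * ennreal (C * vol z)"
        using Rb Rv by (subst nn_integral_cmult_indicator) (auto simp del: relpow.simps intro: mult_left_mono)
      finally have 2: "(\<integral>\<^sup>+w\<in>(adj ^^ Suc n) `` {z}. ennreal (norm (f w) powr 1) \<partial>lborel) \<le> ennreal M' * ennreal (C * vol z)" .
      have V: "vol z > 0" by (rule vol_pos[OF z])
      have "ennreal (norm (f z) powr 1) * ennreal (vol z)
       \<le> ennreal (K * \<gamma> powr (-q)) * (ennreal m * ennreal (C * vol z)) + ennreal \<epsilon> * (ennreal M' * ennreal (C * vol z))"
        by (rule order_trans[OF LE[OF \<gamma> hol z S(1,3,4)]]) (intro add_mono mult_left_mono 1 2; simp)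
      also have "\<dots> = ennreal (K * \<gamma> powr (-q) * (m * (C * vol z)) + \<epsilon> * (M' * (C * vol z)))"
        using K\<gamma> \<epsilon> m0 M'0 C V by (simp add: ennreal_mult' ennreal_plus)
      finally have "ennreal (norm (f z) * vol z) \<le> \<dots>" using V by (simp add: ennreal_mult')
      hence "norm (f z) * vol z \<le> K * \<gamma> powr (-q) * (m * (C * vol z)) + \<epsilon> * (M' * (C * vol z))"
        using K\<gamma> \<epsilon> m0 M'0 C V by (subst (asm) ennreal_le_iff) auto
      also have "\<dots> = (C * (K * \<gamma> powr (-q) * m) + M' / 2) * vol z" using C by (simp add: \<epsilon>_def field_simps)
      finally show ?thesis using V by simp
    qed
    show "\<forall>z\<in>\<Omega>. norm (f z) \<le> 2 * C * K * \<gamma> powr (-q) * m"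
    proof (cases "\<Omega> = {}")
      case False
      define M' where "M' = (SUP w\<in>\<Omega>. norm (f w))"
      have bdd: "bdd_above ((\<lambda>w. norm (f w)) ` \<Omega>)" using fM by (auto intro: bdd_aboveI2)
      have fM': "\<forall>w\<in>\<Omega>. norm (f w) \<le> M'" unfolding M'_def using bdd by (auto intro: cSUP_upper)
      have "M' \<le> C * (K * \<gamma> powr (-q) * m) + M' / 2"
        unfolding M'_def using pt[OF _ fM'] False by (intro cSUP_least) (auto simp: M'_def)
      hence "M' \<le> 2 * C * K * \<gamma> powr (-q) * m" by simp
      thus ?thesis using fM' by (meson order_trans)
    qed simp
  qed
qed

lemma path_step:
  fixes \<Lambda> :: "complex ^ 'n \<Rightarrow> complex ^ 'n \<Rightarrow> 'b::banach"
  assumes \<Lambda>: "\<And>z. z \<in> \<Omega> \<Longrightarrow> bounded_linear (\<Lambda> z)" "\<And>z v. z \<in> \<Omega> \<Longrightarrow> N z v = norm (\<Lambda> z v)"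
    and ab: "a \<le> b" and der: "\<And>t. t \<in> {a..b} \<Longrightarrow> (c has_vector_derivative c' t) (at t within {a..b})"
    and cont: "continuous_on {a..b} c'" and im: "c ` {a..b} \<subseteq> \<Omega>"
    and int: "integral {a..b} (\<lambda>t. N (c t) (c' t)) \<le> \<eta> / (2 * A)"
  shows "(c a, c b) \<in> stp"
proof -
  have contc: "continuous_on {a..b} c"
    using der by (meson continuous_on_eq_continuous_within has_vector_derivative_continuous)
  have ca: "c a \<in> \<Omega>" and cb: "c b \<in> \<Omega>" using im ab by auto
  define h where "h t = N (c a) (c t - c a)" for t
  have gcont: "continuous_on {a..b} (\<lambda>t. N (c t) (c' t))"
    by (rule continuous_on_compose2[OF continuous_N, of _ "\<lambda>t. (c t, c' t)", simplified])
       (use im in \<open>auto intro!: continuous_intros contc cont\<close>)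
  have hcont: "continuous_on {a..b} h" unfolding h_def
    by (rule continuous_on_compose2[OF complex_norm.continuous[OF norm[OF ca], of UNIV]])
       (auto intro!: continuous_intros contc)
  have ha: "h a = 0" using complex_norm.zero[OF norm[OF ca]] by (simp add: h_def)
  have "h b < \<eta>"
  proof (rule ccontr)
    assume "\<not> h b < \<eta>"
    hence hb: "\<eta> \<le> h b" by simp
    define T where "T = {t \<in> {a..b}. h t = \<eta>}"
    have "T \<noteq> {}" using IVT'[of h a \<eta> b] ha hb \<eta>(1) ab hcont by (auto simp: T_def)
    moreover have "compact T"
    proof -
      have "closed T" unfolding T_def using continuous_closed_preimage_constant[OF hcont, of \<eta>] by simp
      thus ?thesis unfolding compact_eq_bounded_closed T_def by (auto intro: bounded_subset[of "{a..b}"])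
    qed
    ultimately obtain s where s: "s \<in> T" "\<And>t. t \<in> T \<Longrightarrow> s \<le> t" using compact_attains_inf[of T] by auto
    have sab: "s \<in> {a..b}" "h s = \<eta>" using s(1) by (auto simp: T_def)
    have hle: "h t \<le> \<eta>" if tas: "t \<in> {a..s}" for t
    proof (rule ccontr)
      assume "\<not> h t \<le> \<eta>"
      moreover have "continuous_on {a..t} h" by (rule continuous_on_subset[OF hcont]) (use that sab in auto)
      ultimately obtain u where "a \<le> u" "u \<le> t" "h u = \<eta>"
        using IVT'[of h a \<eta> t] ha \<eta>(1) tas by auto
      moreover have "u \<in> T" using calculation that sab by (auto simp: T_def)
      ultimately have "t = s" using s(2)[of u] that by auto
      thus False using \<open>\<not> h t \<le> \<eta>\<close> sab by simp
    qed
    interpret \<Lambda>: bounded_linear "\<Lambda> (c a)" by (rule \<Lambda>(1)[OF ca])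
    have sub: "{a..s} \<subseteq> {a..b}" using sab by auto
    have "(c' has_integral (c s - c a)) {a..s}"
      using sab sub by (intro fundamental_theorem_of_calculus has_vector_derivative_within_subset[OF der _]) auto
    hence I: "((\<lambda>t. \<Lambda> (c a) (c' t)) has_integral \<Lambda> (c a) (c s - c a)) {a..s}"
      using has_integral_linear[OF _ \<Lambda>.bounded_linear_axioms] by (simp add: o_def)
    have "\<eta> = norm (integral {a..s} (\<lambda>t. \<Lambda> (c a) (c' t)))"
      using sab(2) I \<Lambda>(2)[OF ca] by (simp add: h_def integral_unique)
    also have "\<dots> \<le> integral {a..s} (\<lambda>t. A * N (c t) (c' t))"
    proof (rule integral_norm_bound_integral)
      show "(\<lambda>t. \<Lambda> (c a) (c' t)) integrable_on {a..s}" using I by blast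
      show "(\<lambda>t. A * N (c t) (c' t)) integrable_on {a..s}"
        by (intro integrable_continuous_interval continuous_intros continuous_on_subset[OF gcont sub])
      show "norm (\<Lambda> (c a) (c' t)) \<le> A * N (c t) (c' t)" if "t \<in> {a..s}" for t
      proof -
        have "N (c a) (c t - c a) < 1" using hle[OF that] \<eta>(2) by (simp add: h_def)
        thus ?thesis using near_N[OF ca, of "c t" "c' t"] \<Lambda>(2)[OF ca] by simp
      qed
    qed
    also have "\<dots> = A * integral {a..s} (\<lambda>t. N (c t) (c' t))" by simp
    also have "\<dots> \<le> A * integral {a..b} (\<lambda>t. N (c t) (c' t))"
    proof (intro mult_left_mono integral_subset_le sub)
      show "(\<lambda>t. N (c t) (c' t)) integrable_on {a..s}" "(\<lambda>t. N (c t) (c' t)) integrable_on {a..b}"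
        by (intro integrable_continuous_interval continuous_on_subset[OF gcont sub] gcont)+
      show "\<forall>t\<in>{a..b}. 0 \<le> N (c t) (c' t)" using im by (auto intro!: N_nonneg)
      show "0 \<le> A" using A1 by simp
    qed
    also have "\<dots> \<le> A * (\<eta> / (2 * A))" using int A1 by (intro mult_left_mono) auto
    also have "\<dots> = \<eta> / 2" using A1 by simp
    finally show False using \<eta>(1) by simp
  qed
  thus ?thesis using ca cb by (simp add: stp_def h_def)
qed

text \<open>The curve is cut where its length reaches \<open>\<eta> / (2 * A)\<close>; such a time
  exists by continuity of the integral, and the remaining piece is covered by the induction
  hypothesis.\<close>

lemma path_chain:
  fixes \<Lambda> :: "complex ^ 'n \<Rightarrow> complex ^ 'n \<Rightarrow> 'b::banach"
  assumes \<Lambda>: "\<And>z. z \<in> \<Omega> \<Longrightarrow> bounded_linear (\<Lambda> z)" "\<And>z v. z \<in> \<Omega> \<Longrightarrow> N z v = norm (\<Lambda> z v)"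
    and ab: "a \<le> b" and der: "\<And>t. t \<in> {a..b} \<Longrightarrow> (c has_vector_derivative c' t) (at t within {a..b})"
    and cont: "continuous_on {a..b} c'" and im: "c ` {a..b} \<subseteq> \<Omega>"
    and int: "integral {a..b} (\<lambda>t. N (c t) (c' t)) \<le> real (Suc J) * (\<eta> / (2 * A))"
  shows "(c a, c b) \<in> stp ^^ Suc J"
  using ab der cont im int
proof (induction J arbitrary: a)
  case 0
  thus ?case using path_step[OF \<Lambda> 0(1-4)] by simp
next
  case (Suc J a)
  define \<kappa> where "\<kappa> = \<eta> / (2 * A)"
  have k: "\<kappa> > 0" using \<eta>(1) A1 by (simp add: \<kappa>_def)
  have contc: "continuous_on {a..b} c"
    using Suc.prems(2) by (meson continuous_on_eq_continuous_within has_vector_derivative_continuous)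
  have gcont: "continuous_on {a..b} (\<lambda>t. N (c t) (c' t))"
    by (rule continuous_on_compose2[OF continuous_N, of _ "\<lambda>t. (c t, c' t)", simplified])
       (use Suc.prems in \<open>auto intro!: continuous_intros contc\<close>)
  have gint: "(\<lambda>t. N (c t) (c' t)) integrable_on {a..b}" by (rule integrable_continuous_interval[OF gcont])
  obtain s where s: "s \<in> {a..b}" "integral {a..s} (\<lambda>t. N (c t) (c' t)) \<le> \<kappa>"
    "integral {s..b} (\<lambda>t. N (c t) (c' t)) \<le> real (Suc J) * \<kappa>"
  proof (cases "integral {a..b} (\<lambda>t. N (c t) (c' t)) \<le> \<kappa>")
    case True
    show thesis by (rule that[of b]) (use True Suc.prems(1) k in auto)
  next
    case False
    have "continuous_on {a..b} (\<lambda>x. integral {a..x} (\<lambda>t. N (c t) (c' t)))"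
      by (rule indefinite_integral_continuous_1[OF gint])
    then obtain s where s: "a \<le> s" "s \<le> b" "integral {a..s} (\<lambda>t. N (c t) (c' t)) = \<kappa>"
      using IVT'[of "\<lambda>x. integral {a..x} (\<lambda>t. N (c t) (c' t))" a \<kappa> b] False k Suc.prems(1) by auto
    have "integral {a..s} (\<lambda>t. N (c t) (c' t)) + integral {s..b} (\<lambda>t. N (c t) (c' t)) = integral {a..b} (\<lambda>t. N (c t) (c' t))"
      by (rule Henstock_Kurzweil_Integration.integral_combine[OF s(1,2) gint])
    moreover have "real (Suc (Suc J)) * \<kappa> = real (Suc J) * \<kappa> + \<kappa>" by (simp add: algebra_simps)
    ultimately have "integral {s..b} (\<lambda>t. N (c t) (c' t)) \<le> real (Suc J) * \<kappa>"
      using s(3) Suc.prems(5) unfolding \<kappa>_def[symmetric] by linarith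
    thus thesis using s that by simp
  qed
  have sub1: "{a..s} \<subseteq> {a..b}" and sub2: "{s..b} \<subseteq> {a..b}" using s(1) by auto
  have "(c a, c s) \<in> stp"
  proof (rule path_step[OF \<Lambda>])
    show "(c has_vector_derivative c' t) (at t within {a..s})" if "t \<in> {a..s}" for t
      by (rule has_vector_derivative_within_subset[OF Suc.prems(2) sub1]) (use that sub1 in auto)
  qed (use s sub1 Suc.prems in \<open>auto simp: \<kappa>_def intro: continuous_on_subset\<close>)
  moreover have "(c s, c b) \<in> stp ^^ Suc J"
  proof (rule Suc.IH)
    show "(c has_vector_derivative c' t) (at t within {s..b})" if "t \<in> {s..b}" for t
      by (rule has_vector_derivative_within_subset[OF Suc.prems(2) sub2]) (use that sub2 in auto)
  qed (use s sub2 Suc.prems in \<open>auto simp: \<kappa>_def simp del: of_nat_Suc intro: continuous_on_subset\<close>)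
  ultimately show ?case by (rule relpow_Suc_I2)
qed

end

section \<open>Kobayashi balls\<close>

lemma lebesgue_inner_borel:
  assumes "S \<in> sets lebesgue"
  obtains T where "T \<in> sets borel" "T \<subseteq> S" "S - T \<in> null_sets lebesgue"
proof -
  obtain C T where CT: "fsigma C" "T \<in> null_sets lebesgue" "C \<union> T = S" "disjnt C T"
    using lebesgue_set_almost_fsigma[OF assms] by blast
  have "C \<in> sets borel" using CT(1) by (induction rule: fsigma.induct) auto
  moreover have "S - C = T" using CT(3,4) by (auto simp: disjnt_def)
  ultimately show thesis using that CT by auto
qed

context complex_norm_field
begin

text \<open>Some competing curve has Kobayashi length below \<open>artanh r\<close>, hence length at
  most \<open>artanh r / c\<close> for the norms \<open>N\<close>. The minorant \<open>c * N\<close>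
  is continuous along the curve, so its length is an ordinary integral to which
  \<open>path_chain\<close> applies.\<close>

lemma kobayashi_ball_chain:
  fixes \<Lambda> :: "complex ^ 'n \<Rightarrow> complex ^ 'n \<Rightarrow> 'b::banach"
  assumes \<Lambda>: "\<And>z. z \<in> \<Omega> \<Longrightarrow> bounded_linear (\<Lambda> z)" "\<And>z v. z \<in> \<Omega> \<Longrightarrow> N z v = norm (\<Lambda> z v)"
    and kob: "\<And>z \<xi>. z \<in> \<Omega> \<Longrightarrow> c * N z \<xi> \<le> kobayashi_metric \<Omega> z \<xi>" and c: "c > 0"
    and r: "0 < artanh r" and J: "artanh r / c \<le> real (Suc J) * (\<eta> / (2 * A))"
    and x: "x \<in> kobayashi_ball \<Omega> z r"
  shows "(x, z) \<in> stp ^^ Suc J"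
proof -
  have "kobayashi_dist \<Omega> x z < ennreal (artanh r)" using x by (simp add: kobayashi_ball_def)
  then obtain g g' where g: "\<forall>t\<in>{0..1::real}. (g has_vector_derivative g' t) (at t within {0..1})"
    "continuous_on {0..1} g'" "g ` {0..1} \<subseteq> \<Omega>" "g 0 = x" "g 1 = z"
    and int: "(\<integral>\<^sup>+ t\<in>{0..1}. ennreal (kobayashi_metric \<Omega> (g t) (g' t)) \<partial>lborel) < ennreal (artanh r)"
    unfolding kobayashi_dist_def Inf_less_iff by blast
  define h where "h t = N (g t) (g' t)" for t
  have contg: "continuous_on {0..1} g"
    using g(1) by (meson continuous_on_eq_continuous_within has_vector_derivative_continuous)
  have hcont: "continuous_on {0..1} h" unfolding h_def
    by (rule continuous_on_compose2[OF continuous_N, of _ "\<lambda>t. (g t, g' t)", simplified])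
       (use g(3) in \<open>auto intro!: continuous_intros contg g(2)\<close>)
  have h0: "0 \<le> h t" if "t \<in> {0..1}" for t using that g(3) unfolding h_def by (intro N_nonneg) auto
  have "((\<lambda>t. c * h t) has_integral c * integral {0..1} h) {0..1}"
    by (intro has_integral_mult_right integrable_integral integrable_continuous_interval hcont)
  from nn_integral_has_integral_lebesgue[OF _ this]
  have "ennreal (c * integral {0..1} h) = (\<integral>\<^sup>+t. ennreal (indicat_real {0..1} t * (c * h t)) \<partial>lborel)"
    using h0 c by simp
  also have "\<dots> \<le> (\<integral>\<^sup>+ t\<in>{0..1}. ennreal (kobayashi_metric \<Omega> (g t) (g' t)) \<partial>lborel)"
  proof (rule nn_integral_mono)
    fix t :: real
    show "ennreal (indicat_real {0..1} t * (c * h t)) \<le> ennreal (kobayashi_metric \<Omega> (g t) (g' t)) * indicator {0..1} t"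
      using kob[of "g t" "g' t"] g(3) by (auto simp: h_def image_subset_iff intro!: ennreal_leI split: split_indicator)
  qed
  also note int
  finally have "c * integral {0..1} h < artanh r" using ennreal_leI[of "artanh r" "c * integral {0..1} h"] by (meson not_le)
  hence "integral {0..1} h \<le> artanh r / c" using c by (simp add: field_simps)
  hence "integral {0..1} h \<le> real (Suc J) * (\<eta> / (2 * A))" using J by linarith
  hence "(g 0, g 1) \<in> stp ^^ Suc J" unfolding h_def
    by (intro path_chain[OF \<Lambda>, of 0 1 g g' J] g(2,3)) (use g(1) in auto)
  thus ?thesis by (simp only: g)
qed

text \<open>The segment from \<open>w\<close> to \<open>z\<close> is a competitor: about each of its
  points the affine disc in direction \<open>z - w\<close>, scaled by K =
  \<open>2 / artanh r\<close>, stays in the unit ball of \<open>N z\<close>. So the metric is at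
  most \<open>artanh r / 2\<close>, and the half yields the strict inequality. The radius 1 / (1 +
  K) leaves room for the segment and the disc together.\<close>

lemma Nball_subset_kobayashi_ball:
  assumes z: "z \<in> \<Omega>" and L: "artanh r > 0" and w: "N z (w - z) < 1 / (1 + 2 / artanh r)"
  shows "w \<in> kobayashi_ball \<Omega> z r"
proof -
  interpret z: complex_norm "N z" by (rule norm[OF z])
  define K where "K = 2 / artanh r"
  have K: "K > 0" using L by (simp add: K_def)
  have wK: "(1 + K) * N z (w - z) < 1" using w K by (simp add: K_def[symmetric] field_simps)
  moreover have "N z (w - z) \<le> (1 + K) * N z (w - z)" using K by (simp add: algebra_simps)
  ultimately have wO: "w \<in> \<Omega>" using near[OF z] by simp
  define g where "g t = w + t *\<^sub>R (z - w)" for t :: real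
  have disc: "g t + (\<zeta> * of_real K) *s (z - w) \<in> \<Omega>" if "t \<in> {0..1}" "norm \<zeta> \<le> 1" for t \<zeta>
  proof -
    have "g t - z = (1 - t) *\<^sub>R (w - z)" by (simp add: g_def algebra_simps)
    hence "N z (g t - z) = (1 - t) * N z (w - z)" using that by (simp add: z.scaleR)
    also have "\<dots> \<le> 1 * N z (w - z)" using that by (intro mult_right_mono) auto
    finally have 1: "N z (g t - z) \<le> N z (w - z)" by simp
    have "N z ((\<zeta> * of_real K) *s (z - w)) = norm \<zeta> * K * N z (w - z)"
      unfolding z.scale using K z.minus_commute[of z w] by (simp add: norm_mult)
    also have "\<dots> \<le> 1 * K * N z (w - z)" using that K by (intro mult_right_mono) auto
    finally have 2: "N z ((\<zeta> * of_real K) *s (z - w)) \<le> K * N z (w - z)" by simp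
    have "N z (g t + (\<zeta> * of_real K) *s (z - w) - z) \<le> N z (g t - z) + N z ((\<zeta> * of_real K) *s (z - w))"
      using z.add[of "g t - z" "(\<zeta> * of_real K) *s (z - w)"] by (simp add: algebra_simps)
    also have "\<dots> \<le> (1 + K) * N z (w - z)" using 1 2 by (simp add: algebra_simps)
    finally show ?thesis using wK near[OF z] by simp
  qed
  have met: "kobayashi_metric \<Omega> (g t) (z - w) \<le> artanh r / 2" if t: "t \<in> {0..1}" for t
    unfolding kobayashi_metric_def
  proof (rule cInf_lower)
    have "\<exists>\<phi>. (\<forall>i. (\<lambda>\<zeta>. \<phi> \<zeta> $ i) holomorphic_on ball 0 1) \<and> \<phi> ` ball 0 1 \<subseteq> \<Omega> \<and> \<phi> 0 = g t \<and>
          (\<forall>i. deriv (\<lambda>\<zeta>. \<phi> \<zeta> $ i) 0 = (z - w) $ i / complex_of_real (artanh r / 2))"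
    proof (rule exI[of _ "\<lambda>\<zeta>. g t + (\<zeta> * of_real K) *s (z - w)"], intro conjI allI)
      fix i
      show "(\<lambda>\<zeta>. (g t + (\<zeta> * of_real K) *s (z - w)) $ i) holomorphic_on ball 0 1"
        by (auto intro!: holomorphic_intros)
      have "((\<lambda>\<zeta>. (g t + (\<zeta> * of_real K) *s (z - w)) $ i) has_field_derivative of_real K * (z - w) $ i) (at 0)"
        by (auto intro!: derivative_eq_intros simp: algebra_simps)
      thus "deriv (\<lambda>\<zeta>. (g t + (\<zeta> * of_real K) *s (z - w)) $ i) 0 = (z - w) $ i / complex_of_real (artanh r / 2)"
        by (simp add: DERIV_imp_deriv K_def)
    qed (use disc[OF t] in auto)
    thus "artanh r / 2 \<in> {\<alpha>. \<alpha> > 0 \<and> (\<exists>\<phi> :: complex \<Rightarrow> complex ^ 'n.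
          (\<forall>i. (\<lambda>\<zeta>. \<phi> \<zeta> $ i) holomorphic_on ball 0 1) \<and> \<phi> ` ball 0 1 \<subseteq> \<Omega> \<and>
          \<phi> 0 = g t \<and> (\<forall>i. deriv (\<lambda>\<zeta>. \<phi> \<zeta> $ i) 0 = (z - w) $ i / complex_of_real \<alpha>))}"
      using L by simp
  qed (auto intro: bdd_belowI[of _ 0])
  have gO: "g t \<in> \<Omega>" if "t \<in> {0..1}" for t using disc[OF that, of 0] by simp
  have "kobayashi_dist \<Omega> w z \<le> (\<integral>\<^sup>+ t\<in>{0..1}. ennreal (kobayashi_metric \<Omega> (g t) (z - w)) \<partial>lborel)"
    unfolding kobayashi_dist_def
  proof (rule Inf_lower, rule CollectI, intro exI conjI)
    show "\<forall>t\<in>{0..1}. (g has_vector_derivative (z - w)) (at t within {0..1})"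
      unfolding g_def by (auto intro!: derivative_eq_intros)
    show "continuous_on {0..1} (\<lambda>t::real. z - w)" by (intro continuous_intros)
  qed (use gO in \<open>auto simp: g_def\<close>)
  also have "\<dots> \<le> (\<integral>\<^sup>+ t. ennreal (artanh r / 2) * indicator {0..1::real} t \<partial>lborel)"
    using met by (intro nn_integral_mono) (auto intro!: ennreal_leI split: split_indicator)
  also have "\<dots> = ennreal (artanh r / 2)" by (subst nn_integral_cmult_indicator) auto
  also have "\<dots> < ennreal (artanh r)" using L by (intro ennreal_lessI) auto
  finally show ?thesis using wO by (simp add: kobayashi_ball_def)
qed

text \<open>Measurability of Kobayashi balls is not needed: a nonmeasurable set has \<^const>\<open>measure\<close> zero, and
  then the ratio in the hypothesis is zero because \<open>x / 0 = 0\<close>.\<close>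

lemma dense_subset_of_kobayashi_ball:
  fixes Y :: "(complex ^ 'n) set"
  assumes E: "E \<in> sets lebesgue" and E': "E' \<in> sets borel" "E' \<subseteq> E" "E - E' \<in> null_sets lebesgue"
    and z: "z \<in> \<Omega>" and \<kappa>: "\<kappa> > 0" "B z z \<kappa> \<subseteq> Y" and \<gamma>: "\<gamma> > 0"
    and ratio: "measure lebesgue (E \<inter> Y) / measure lebesgue Y \<ge> \<gamma>"
  obtains S where "S \<in> sets borel" "S \<subseteq> E'" "S \<subseteq> Y" "\<gamma> * \<kappa> ^ DIM(complex ^ 'n) * vol z \<le> measure lborel S"
proof -
  have "measure lebesgue Y \<noteq> 0" using ratio \<gamma> by auto
  hence Y0: "measure lebesgue Y > 0" using measure_nonneg[of lebesgue Y] by linarith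
  have Yf: "Y \<in> fmeasurable lebesgue"
  proof -
    have "Y \<in> sets lebesgue" using Y0 by (metis less_irrefl measure_notin_sets)
    moreover have "emeasure lebesgue Y < \<infinity>"
      using Y0 unfolding measure_def by (metis enn2real_top infinity_ennreal_def less_irrefl less_top)
    ultimately show ?thesis by (rule fmeasurableI)
  qed
  have "\<gamma> * measure lebesgue Y \<le> measure lebesgue (E \<inter> Y)" using ratio Y0 by (simp add: field_simps)
  moreover have "measure lebesgue (B z z \<kappa>) \<le> measure lebesgue Y"
    using B_borel[OF z] by (intro measure_mono_fmeasurable \<kappa> Yf) auto
  hence "\<kappa> ^ DIM(complex ^ 'n) * vol z \<le> measure lebesgue Y"
    using measure_B[OF z \<kappa>(1), of z] B_borel[OF z] by (simp add: measure_completion)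
  hence "\<gamma> * (\<kappa> ^ DIM(complex ^ 'n) * vol z) \<le> \<gamma> * measure lebesgue Y" using \<gamma> by (intro mult_left_mono) auto
  ultimately have EY: "\<gamma> * \<kappa> ^ DIM(complex ^ 'n) * vol z \<le> measure lebesgue (E \<inter> Y)" by (simp add: mult.assoc)
  have T: "E' \<inter> Y \<in> sets lebesgue" using E'(1) Yf by auto
  obtain S where S: "S \<in> sets borel" "S \<subseteq> E' \<inter> Y" "E' \<inter> Y - S \<in> null_sets lebesgue"
    using lebesgue_inner_borel[OF T] by blast
  have "E \<inter> Y - S \<in> null_sets lebesgue"
  proof (rule null_sets_subset[OF null_sets.Un[OF S(3) E'(3)]])
    show "E \<inter> Y - S \<in> sets lebesgue" using E Yf S(1) by auto
  qed auto
  hence "measure lebesgue (E \<inter> Y) = measure lebesgue S"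
  proof -
    have "E \<inter> Y = S \<union> (E \<inter> Y - S)" using S(2) E'(2) by auto
    moreover have "measure lebesgue (S \<union> (E \<inter> Y - S)) = measure lebesgue S"
      using S(1) \<open>E \<inter> Y - S \<in> null_sets lebesgue\<close> by (intro measure_Un_null_set) auto
    ultimately show ?thesis by simp
  qed
  hence "\<gamma> * \<kappa> ^ DIM(complex ^ 'n) * vol z \<le> measure lborel S" using EY S(1) by (simp add: measure_completion)
  thus thesis using that S by blast
qed

section \<open>Weighted norms in terms of Lebesgue measure, and transfer to Kobayashi balls\<close>

lemma weighted_density_measurable:
  assumes F: "F \<in> sets lebesgue" "F \<subseteq> \<Omega>" and \<delta>\<rho>: "\<forall>z\<in>\<Omega>. \<delta> z = \<bar>\<rho> z\<bar>"
  shows "(\<lambda>z. ennreal (\<bar>\<rho> z\<bar> powr \<alpha>)) \<in> borel_measurable (restrict_space lebesgue F)"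
proof -
  have "continuous_on F (\<lambda>z. \<delta> z powr \<alpha>)"
    by (intro continuous_on_powr continuous_on_subset[OF continuous_\<delta> F(2)] continuous_intros)
       (use \<delta>_pos F(2) in force)
  hence "(\<lambda>z. \<delta> z powr \<alpha>) \<in> borel_measurable (restrict_space lebesgue F)"
    using F(1) by (rule continuous_imp_measurable_on_sets_lebesgue)
  from measurable_compose[OF this measurable_ennreal]
  have "(\<lambda>z. ennreal (\<delta> z powr \<alpha>)) \<in> borel_measurable (restrict_space lebesgue F)" .
  thus ?thesis by (rule measurable_cong[THEN iffD1, rotated]) (use F(2) \<delta>\<rho> in \<open>auto simp: space_restrict_space\<close>)
qed

lemma nn_integral_weighted_measure:
  assumes F: "F \<in> sets lebesgue" "F \<subseteq> \<Omega>" and \<delta>\<rho>: "\<forall>z\<in>\<Omega>. \<delta> z = \<bar>\<rho> z\<bar>"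
    and h: "continuous_on \<Omega> h"
  shows "(\<integral>\<^sup>+z. ennreal (h z) \<partial>weighted_measure \<rho> \<alpha> F) = (\<integral>\<^sup>+z\<in>F. ennreal (h z) * ennreal (\<delta> z powr \<alpha>) \<partial>lborel)"
proof -
  have "h \<in> borel_measurable (restrict_space lebesgue F)"
    using continuous_on_subset[OF h F(2)] F(1) by (rule continuous_imp_measurable_on_sets_lebesgue)
  from measurable_compose[OF this measurable_ennreal]
  have hm: "(\<lambda>z. ennreal (h z)) \<in> borel_measurable (restrict_space lebesgue F)" .
  have "(\<integral>\<^sup>+z. ennreal (h z) \<partial>weighted_measure \<rho> \<alpha> F)
      = (\<integral>\<^sup>+z. ennreal (\<bar>\<rho> z\<bar> powr \<alpha>) * ennreal (h z) \<partial>restrict_space lebesgue F)"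
    unfolding weighted_measure_def by (rule nn_integral_density[OF weighted_density_measurable[OF F \<delta>\<rho>] hm])
  also have "\<dots> = (\<integral>\<^sup>+z. ennreal (\<bar>\<rho> z\<bar> powr \<alpha>) * ennreal (h z) * indicator F z \<partial>lebesgue)"
    using F(1) by (intro nn_integral_restrict_space) auto
  also have "\<dots> = (\<integral>\<^sup>+z. ennreal (\<bar>\<rho> z\<bar> powr \<alpha>) * ennreal (h z) * indicator F z \<partial>lborel)"
    by (rule nn_integral_completion)
  also have "\<dots> = (\<integral>\<^sup>+z\<in>F. ennreal (h z) * ennreal (\<delta> z powr \<alpha>) \<partial>lborel)"
    using F(2) \<delta>\<rho> by (intro nn_integral_cong) (auto simp: mult_ac split: split_indicator)
  finally show ?thesis .
qed

text \<open>The weight is positive on \<open>F\<close>, so sets that are null for the weighted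
  measure are Lebesgue null there.\<close>

lemma AE_weighted_measure:
  assumes F: "F \<in> sets lebesgue" "F \<subseteq> \<Omega>" and \<delta>\<rho>: "\<forall>z\<in>\<Omega>. \<delta> z = \<bar>\<rho> z\<bar>"
    and ae: "AE z in weighted_measure \<rho> \<alpha> F. P z"
  shows "AE z in lborel. z \<in> F \<longrightarrow> P z"
proof -
  have "AE z in restrict_space lebesgue F. 0 < ennreal (\<bar>\<rho> z\<bar> powr \<alpha>) \<longrightarrow> P z"
    by (rule AE_density[OF weighted_density_measurable[OF F \<delta>\<rho>], THEN iffD1]) (use ae in \<open>simp only: weighted_measure_def\<close>)
  hence "AE z in lebesgue. z \<in> F \<longrightarrow> (0 < ennreal (\<bar>\<rho> z\<bar> powr \<alpha>) \<longrightarrow> P z)"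
    using F(1) by (subst (asm) AE_restrict_space_iff) auto
  hence "AE z in lborel. z \<in> F \<longrightarrow> (0 < ennreal (\<bar>\<rho> z\<bar> powr \<alpha>) \<longrightarrow> P z)"
    by (simp add: AE_completion_iff)
  thus ?thesis
  proof eventually_elim
    case (elim z)
    thus ?case using F(2) \<delta>\<rho> \<delta>_pos[of z] by fastforce
  qed
qed

text \<open>Density \<gamma> in Kobayashi balls becomes density \<open>\<gamma> * s\<close> relative
  to the unit balls of \<open>N z\<close>, with \<open>s\<close> fixed by \<open>r\<close>; the
  factor \<open>s powr (-q)\<close> goes into the constant. For finite p a p-th root is taken at the
  end, which divides the exponent by p.\<close>

lemma dominating_kobayashi_balls:
  fixes \<Lambda> :: "complex ^ 'n \<Rightarrow> complex ^ 'n \<Rightarrow> 'b::banach" and p :: ennreal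
  assumes \<Lambda>: "\<And>z. z \<in> \<Omega> \<Longrightarrow> bounded_linear (\<Lambda> z)" "\<And>z v. z \<in> \<Omega> \<Longrightarrow> N z v = norm (\<Lambda> z v)"
    and kob: "\<And>z \<xi>. z \<in> \<Omega> \<Longrightarrow> c * N z \<xi> \<le> kobayashi_metric \<Omega> z \<xi>" and c: "c > 0"
    and r: "0 < r" "r < 1" and p: "1 \<le> p" and \<delta>\<rho>: "\<forall>z\<in>\<Omega>. \<delta> z = \<bar>\<rho> z\<bar>"
  shows "\<exists>C q :: real. C > 0 \<and> q > 0 \<and>
    (\<forall>\<gamma>::real. 0 < \<gamma> \<longrightarrow> \<gamma> < 1 \<longrightarrow>
      (\<forall>E \<in> sets lebesgue. E \<subseteq> \<Omega> \<longrightarrow>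
        (\<forall>z\<in>\<Omega>. measure lebesgue (E \<inter> kobayashi_ball \<Omega> z r)
                  / measure lebesgue (kobayashi_ball \<Omega> z r) \<ge> \<gamma>) \<longrightarrow>
        (\<forall>f \<in> bergman_space \<Omega> \<rho> p \<alpha>.
           Lp_norm p (weighted_measure \<rho> \<alpha> \<Omega>) f
             \<le> ennreal (C * \<gamma> powr (- q)) * Lp_norm p (weighted_measure \<rho> \<alpha> E) f)))"
proof -
  have L: "artanh r > 0"
  proof -
    have "(1 + r) / (1 - r) > 1" using r by (simp add: field_simps)
    thus ?thesis unfolding artanh_def by simp
  qed
  obtain J where "artanh r / c / (\<eta> / (2 * A)) < real J" using reals_Archimedean2 by blast
  moreover have x: "\<eta> / (2 * A) > 0" using \<eta>(1) A1 by simp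
  ultimately have "artanh r / c < real J * (\<eta> / (2 * A))" by (simp only: pos_divide_less_eq)
  also have "\<dots> \<le> real (Suc J) * (\<eta> / (2 * A))" using x by (intro mult_right_mono) auto
  finally have J: "artanh r / c \<le> real (Suc J) * (\<eta> / (2 * A))" by simp
  define \<kappa> where "\<kappa> = 1 / (1 + 2 / artanh r)"
  have \<kappa>: "\<kappa> > 0" using L by (simp add: \<kappa>_def add_pos_pos)
  define s where "s = \<kappa> ^ DIM(complex ^ 'n)"
  have s: "s > 0" using \<kappa> by (simp add: s_def)
  have \<Omega>l: "\<Omega> \<in> sets lebesgue" using open_domain by simp
  have dens: "\<exists>E'\<subseteq>E. chain_dense (Suc J) (\<gamma> * s) E'"
    if E: "E \<in> sets lebesgue" "E \<subseteq> \<Omega>" and \<gamma>: "0 < \<gamma>" and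
      ratio: "\<forall>z\<in>\<Omega>. measure lebesgue (E \<inter> kobayashi_ball \<Omega> z r) / measure lebesgue (kobayashi_ball \<Omega> z r) \<ge> \<gamma>"
    for E \<gamma>
  proof -
    obtain E' where E': "E' \<in> sets borel" "E' \<subseteq> E" "E - E' \<in> null_sets lebesgue"
      using lebesgue_inner_borel[OF E(1)] by blast
    have "\<exists>S\<in>sets borel. S \<subseteq> E' \<and> (\<forall>x\<in>S. (x, z) \<in> stp ^^ Suc J) \<and> \<gamma> * s * vol z \<le> measure lborel S"
      if z: "z \<in> \<Omega>" for z
    proof -
      have sub: "B z z \<kappa> \<subseteq> kobayashi_ball \<Omega> z r"
        using Nball_subset_kobayashi_ball[OF z L] by (auto simp: B_iff[OF z] \<kappa>_def)
      obtain S where S: "S \<in> sets borel" "S \<subseteq> E'" "S \<subseteq> kobayashi_ball \<Omega> z r"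
        "\<gamma> * \<kappa> ^ DIM(complex ^ 'n) * vol z \<le> measure lborel S"
        using dense_subset_of_kobayashi_ball[OF E(1) E' z \<kappa> sub \<gamma>] ratio z by blast
      have "(x, z) \<in> stp ^^ Suc J" if "x \<in> S" for x
        by (rule kobayashi_ball_chain[OF \<Lambda> kob c L J]) (use that S(3) in auto)
      thus ?thesis using S unfolding s_def by blast
    qed
    hence "chain_dense (Suc J) (\<gamma> * s) E'" unfolding chain_dense_def using E' E(2) by blast
    thus ?thesis using E'(2) by blast
  qed
  show ?thesis
  proof (cases "p = \<infinity>")
    case True
    obtain K q where Kq: "K > 0" "q > 0" and dom: "\<And>\<gamma> f E m M. 0 < \<gamma> \<Longrightarrow> holomorphic_on_Cn f \<Omega> \<Longrightarrow> chain_dense (Suc J) \<gamma> E \<Longrightarrow>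
     (AE w in lborel. w \<in> E \<longrightarrow> norm (f w) \<le> m) \<Longrightarrow> 0 \<le> m \<Longrightarrow> (\<forall>w\<in>\<Omega>. norm (f w) \<le> M) \<Longrightarrow>
     (\<forall>z\<in>\<Omega>. norm (f z) \<le> K * \<gamma> powr (-q) * m)"
      using dominating_sup[of "Suc J"] by blast
    show ?thesis
    proof (rule exI[of _ "K * s powr (-q)"], rule exI[of _ q], intro conjI allI ballI impI)
      show "0 < K * s powr (-q)" using Kq s by simp
      show "0 < q" by fact
      fix \<gamma> E f
      assume \<gamma>: "0 < \<gamma>" and E: "E \<in> sets lebesgue" "E \<subseteq> \<Omega>" and
        ratio: "\<forall>z\<in>\<Omega>. measure lebesgue (E \<inter> kobayashi_ball \<Omega> z r) / measure lebesgue (kobayashi_ball \<Omega> z r) \<ge> \<gamma>"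
        and f: "f \<in> bergman_space \<Omega> \<rho> p \<alpha>"
      have hol: "holomorphic_on_Cn f \<Omega>" using f by (simp add: bergman_space_def)
      have fmeas: "f \<in> borel_measurable (weighted_measure \<rho> \<alpha> \<Omega>)"
        and ffin: "esssup (weighted_measure \<rho> \<alpha> \<Omega>) (\<lambda>z. ennreal (norm (f z))) < \<infinity>"
        using f True by (auto simp: bergman_space_def Lp_space_def Lp_norm_def)
      define e where "e = esssup (weighted_measure \<rho> \<alpha> E) (\<lambda>z. ennreal (norm (f z)))"
      have C\<gamma>: "K * s powr (-q) * \<gamma> powr (-q) > 0" using Kq s \<gamma> by simp
      obtain E' where E': "E' \<subseteq> E" "chain_dense (Suc J) (\<gamma> * s) E'" using dens[OF E \<gamma> ratio] by blast
      have "esssup (weighted_measure \<rho> \<alpha> \<Omega>) (\<lambda>z. ennreal (norm (f z))) \<le> ennreal (K * s powr (-q) * \<gamma> powr (-q)) * e"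
      proof (cases "e = \<infinity>")
        case True
        \<comment> \<open>In \<open>ennreal\<close> the product of 0 and \<infinity> is 0, so the
          bound is trivial only because the constant is nonzero.\<close>
        have "ennreal (K * s powr (-q) * \<gamma> powr (-q)) \<noteq> 0" using C\<gamma> by (metis ennreal_eq_0_iff not_le)
        hence "ennreal (K * s powr (-q) * \<gamma> powr (-q)) * e = \<infinity>" unfolding True by (simp add: ennreal_mult_top)
        thus ?thesis by simp
      next
        case False
        then obtain m where m: "e = ennreal m" "m \<ge> 0" by (metis ennreal_cases infinity_ennreal_def)
        have "AE w in weighted_measure \<rho> \<alpha> E. ennreal (norm (f w)) \<le> e" unfolding e_def by (rule esssup_AE)
        hence "AE w in lborel. w \<in> E \<longrightarrow> ennreal (norm (f w)) \<le> e" by (rule AE_weighted_measure[OF E \<delta>\<rho>])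
        hence fm: "AE w in lborel. w \<in> E' \<longrightarrow> norm (f w) \<le> m"
          by eventually_elim (use E'(1) m in auto)
        obtain M where M: "esssup (weighted_measure \<rho> \<alpha> \<Omega>) (\<lambda>z. ennreal (norm (f z))) = ennreal M" "M \<ge> 0"
          using ffin by (metis ennreal_cases infinity_ennreal_def less_irrefl)
        have "AE w in weighted_measure \<rho> \<alpha> \<Omega>. ennreal (norm (f w)) \<le> ennreal M" unfolding M(1)[symmetric] by (rule esssup_AE)
        hence "AE w in lborel. w \<in> \<Omega> \<longrightarrow> ennreal (norm (f w)) \<le> ennreal M" by (rule AE_weighted_measure[OF \<Omega>l order_refl \<delta>\<rho>])
        hence aeM: "AE w in lborel. w \<notin> {w \<in> \<Omega>. M < norm (f w)}"
          by eventually_elim (use M in auto)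
        \<comment> \<open>The set where |f| exceeds its essential supremum is open and null, hence
          empty: the essential bound holds at every point, as \<open>dominating_sup\<close>
          requires.\<close>
        have op: "open {w \<in> \<Omega>. M < norm (f w)}"
        proof -
          have "continuous_on \<Omega> (\<lambda>w. norm (f w))" by (intro continuous_intros holomorphic_on_Cn_continuous[OF hol])
          from continuous_open_preimage[OF this open_domain open_greaterThan[of M]]
          show ?thesis by (simp add: vimage_def Int_def)
        qed
        have "{w \<in> \<Omega>. M < norm (f w)} = {}"
        proof (rule ccontr)
          assume ne: "{w \<in> \<Omega>. M < norm (f w)} \<noteq> {}"
          have "{w \<in> \<Omega>. M < norm (f w)} \<in> null_sets lborel"
            using aeM op by (subst AE_iff_null_sets) auto
          hence "negligible {w \<in> \<Omega>. M < norm (f w)}" by (simp add: negligible_iff_null_sets null_sets_completionI)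
          thus False using open_not_negligible[OF op ne] by simp
        qed
        hence fM: "\<forall>w\<in>\<Omega>. norm (f w) \<le> M" by (auto simp: not_less)
        have "\<forall>z\<in>\<Omega>. norm (f z) \<le> K * (\<gamma> * s) powr (-q) * m"
          by (rule dom[OF _ hol E'(2) fm m(2) fM]) (use \<gamma> s in auto)
        hence bd: "\<forall>z\<in>\<Omega>. norm (f z) \<le> K * s powr (-q) * \<gamma> powr (-q) * m"
          using \<gamma> s by (simp add: powr_mult mult_ac)
        have "esssup (weighted_measure \<rho> \<alpha> \<Omega>) (\<lambda>z. ennreal (norm (f z))) \<le> ennreal (K * s powr (-q) * \<gamma> powr (-q) * m)"
        proof (rule esssup_I)
          show "(\<lambda>z. ennreal (norm (f z))) \<in> borel_measurable (weighted_measure \<rho> \<alpha> \<Omega>)"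
            by (rule measurable_compose[OF measurable_compose[OF fmeas borel_measurable_norm] measurable_ennreal])
          have "space (weighted_measure \<rho> \<alpha> \<Omega>) = \<Omega>" by (simp add: weighted_measure_def space_restrict_space)
          thus "AE z in weighted_measure \<rho> \<alpha> \<Omega>. ennreal (norm (f z)) \<le> ennreal (K * s powr (-q) * \<gamma> powr (-q) * m)"
            using bd by (intro AE_I2 ennreal_leI) auto
        qed
        also have "\<dots> = ennreal (K * s powr (-q) * \<gamma> powr (-q)) * e" using m by (simp add: ennreal_mult'')
        finally show ?thesis .
      qed
      thus "Lp_norm p (weighted_measure \<rho> \<alpha> \<Omega>) f \<le> ennreal (K * s powr (-q) * \<gamma> powr (-q)) * Lp_norm p (weighted_measure \<rho> \<alpha> E) f"
        using True by (simp add: Lp_norm_def e_def)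
    qed
  next
    case False
    then obtain P where P: "p = ennreal P" "P \<ge> 0" by (metis ennreal_cases infinity_ennreal_def)
    have P1: "P \<ge> 1" using p P by (simp add: ennreal_1[symmetric] del: ennreal_1)
    hence P0: "P > 0" by simp
    have pP: "enn2real p = P" using P by simp
    obtain K q where Kq: "K > 0" "q > 0" and dom: "\<And>\<gamma> f E. 0 < \<gamma> \<Longrightarrow> holomorphic_on_Cn f \<Omega> \<Longrightarrow> chain_dense (Suc J) \<gamma> E \<Longrightarrow>
     (\<integral>\<^sup>+w\<in>\<Omega>. ennreal (norm (f w) powr P) * ennreal (\<delta> w powr \<alpha>) \<partial>lborel) < \<infinity> \<Longrightarrow>
     (\<integral>\<^sup>+w\<in>\<Omega>. ennreal (norm (f w) powr P) * ennreal (\<delta> w powr \<alpha>) \<partial>lborel)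
       \<le> ennreal (K * \<gamma> powr (-q)) * (\<integral>\<^sup>+w\<in>E. ennreal (norm (f w) powr P) * ennreal (\<delta> w powr \<alpha>) \<partial>lborel)"
      using dominating_integral[OF P0, of "Suc J" \<alpha>] by blast
    show ?thesis
    proof (rule exI[of _ "(K * s powr (-q)) powr (1/P)"], rule exI[of _ "q / P"], intro conjI allI ballI impI)
      show "0 < (K * s powr (-q)) powr (1/P)" using Kq s by simp
      show "0 < q / P" using Kq P0 by simp
      fix \<gamma> E f
      assume \<gamma>: "0 < \<gamma>" and E: "E \<in> sets lebesgue" "E \<subseteq> \<Omega>" and
        ratio: "\<forall>z\<in>\<Omega>. measure lebesgue (E \<inter> kobayashi_ball \<Omega> z r) / measure lebesgue (kobayashi_ball \<Omega> z r) \<ge> \<gamma>"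
        and f: "f \<in> bergman_space \<Omega> \<rho> p \<alpha>"
      have hol: "holomorphic_on_Cn f \<Omega>" using f by (simp add: bergman_space_def)
      define I where "I F = (\<integral>\<^sup>+w\<in>F. ennreal (norm (f w) powr P) * ennreal (\<delta> w powr \<alpha>) \<partial>lborel)" for F
      have contf: "continuous_on \<Omega> (\<lambda>w. norm (f w) powr P)"
        using P0 by (intro continuous_intros continuous_on_powr' holomorphic_on_Cn_continuous[OF hol]) auto
      have norm_eq: "Lp_norm p (weighted_measure \<rho> \<alpha> F) f = (if I F = \<infinity> then \<infinity> else ennreal (enn2real (I F) powr (1 / P)))"
        if "F \<in> sets lebesgue" "F \<subseteq> \<Omega>" for F
        using False nn_integral_weighted_measure[OF that \<delta>\<rho> contf, of \<alpha>] by (simp add: Lp_norm_def pP I_def Let_def)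
      have "Lp_norm p (weighted_measure \<rho> \<alpha> \<Omega>) f < \<infinity>" using f by (simp add: bergman_space_def Lp_space_def)
      hence fin: "I \<Omega> < \<infinity>" using norm_eq[OF \<Omega>l order_refl] by (auto simp: less_top split: if_splits)
      obtain E' where E': "E' \<subseteq> E" "chain_dense (Suc J) (\<gamma> * s) E'" using dens[OF E \<gamma> ratio] by blast
      have mono: "I F \<le> I G" if "F \<subseteq> G" for F G
        unfolding I_def using that by (intro nn_integral_mono) (auto split: split_indicator)
      have finE: "I E < \<infinity>" using mono[OF E(2)] fin by (rule le_less_trans)
      obtain i where i: "I \<Omega> = ennreal i" "i \<ge> 0" using fin by (metis ennreal_cases infinity_ennreal_def less_irrefl)
      obtain j where j: "I E = ennreal j" "j \<ge> 0" using finE by (metis ennreal_cases infinity_ennreal_def less_irrefl)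
      have "I \<Omega> \<le> ennreal (K * (\<gamma> * s) powr (-q)) * I E'"
        unfolding I_def by (rule dom[OF _ hol E'(2)]) (use \<gamma> s fin in \<open>auto simp: I_def\<close>)
      also have "\<dots> \<le> ennreal (K * (\<gamma> * s) powr (-q)) * I E" by (intro mult_left_mono mono E') auto
      also have "\<dots> = ennreal (K * (\<gamma> * s) powr (-q) * j)" using j by (simp add: ennreal_mult'')
      finally have "i \<le> K * (\<gamma> * s) powr (-q) * j" using i j Kq by simp
      hence "i powr (1/P) \<le> (K * (\<gamma> * s) powr (-q) * j) powr (1/P)" using i P0 by (intro powr_mono2) auto
      also have "\<dots> = (K * s powr (-q)) powr (1/P) * \<gamma> powr (- (q / P)) * j powr (1/P)"
        using Kq \<gamma> s j by (simp add: powr_mult powr_powr mult_ac)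
      finally have "ennreal (i powr (1/P)) \<le> ennreal ((K * s powr (-q)) powr (1/P) * \<gamma> powr (- (q / P)) * j powr (1/P))"
        by (rule ennreal_leI)
      also have "\<dots> = ennreal ((K * s powr (-q)) powr (1/P) * \<gamma> powr (- (q / P))) * ennreal (j powr (1/P))"
        by (simp add: ennreal_mult'')
      finally show "Lp_norm p (weighted_measure \<rho> \<alpha> \<Omega>) f \<le> ennreal ((K * s powr (-q)) powr (1/P) * \<gamma> powr (- (q / P))) * Lp_norm p (weighted_measure \<rho> \<alpha> E) f"
        using i j by (simp add: norm_eq[OF \<Omega>l order_refl] norm_eq[OF E])
    qed
  qed
qed

end

section \<open>Circular means of plurisubharmonic functions\<close>

lemma has_vector_derivative_vec:
  fixes f :: "real \<Rightarrow> complex ^ 'n"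
  assumes "\<And>i. ((\<lambda>t. f t $ i) has_vector_derivative f' $ i) (at t within S)"
  shows "(f has_vector_derivative f') (at t within S)"
proof -
  have "((\<lambda>t. \<Sum>i\<in>UNIV. (f t $ i) *s axis i 1) has_vector_derivative (\<Sum>i\<in>UNIV. (f' $ i) *s axis i 1)) (at t within S)"
    by (intro has_vector_derivative_sum bounded_linear.has_vector_derivative[OF bounded_linear_scalar_mult_left] assms)
  thus ?thesis by (simp add: basis_expansion)
qed

text \<open>\<open>H x u v\<close> is the derivative of \<open>D x v\<close> in direction
  \<open>u\<close>. Continuity is asked for fixed directions only; joint continuity follows by
  expanding in the basis. With \<open>D\<close> and \<open>H\<close> as parameters,
  \<open>\<rho>\<close> minus a multiple of a squared distance becomes an instance too.\<close>

locale C2_function =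
  fixes U :: "'a::euclidean_space set" and g :: "'a \<Rightarrow> real" and D :: "'a \<Rightarrow> 'a \<Rightarrow> real" and H :: "'a \<Rightarrow> 'a \<Rightarrow> 'a \<Rightarrow> real"
  assumes open_U: "open U"
    and der1: "x \<in> U \<Longrightarrow> (g has_derivative D x) (at x)"
    and der2: "x \<in> U \<Longrightarrow> ((\<lambda>y. D y v) has_derivative (\<lambda>u. H x u v)) (at x)"
    and cont2: "continuous_on U (\<lambda>x. H x u v)"
begin

lemma linear_D: "x \<in> U \<Longrightarrow> linear (D x)"
  using der1 has_derivative_linear by blast

lemma linear_H1: "x \<in> U \<Longrightarrow> linear (\<lambda>u. H x u v)"
  using der2 has_derivative_linear by blast

text \<open>\<open>D y\<close> is linear for all \<open>y\<close> near \<open>x\<close>, and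
  derivatives are unique.\<close>

lemma linear_H2: assumes x: "x \<in> U" shows "linear (H x u)"
proof (rule linearI)
  fix v w :: 'a and r :: real
  have "((\<lambda>y. D y v + D y w) has_derivative (\<lambda>u. H x u v + H x u w)) (at x)"
    by (intro has_derivative_add der2 x)
  hence "((\<lambda>y. D y (v + w)) has_derivative (\<lambda>u. H x u v + H x u w)) (at x)"
    by (rule has_derivative_transform_within_open[OF _ open_U x]) (simp add: linear_add[OF linear_D])
  from has_derivative_unique[OF this der2[OF x]]
  show "H x u (v + w) = H x u v + H x u w" by metis
  have "((\<lambda>y. r *\<^sub>R D y v) has_derivative (\<lambda>u. r *\<^sub>R H x u v)) (at x)"
    by (intro has_derivative_scaleR_right der2 x)
  hence "((\<lambda>y. D y (r *\<^sub>R v)) has_derivative (\<lambda>u. r *\<^sub>R H x u v)) (at x)"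
    by (rule has_derivative_transform_within_open[OF _ open_U x]) (simp add: linear_scale[OF linear_D])
  from has_derivative_unique[OF this der2[OF x]]
  show "H x u (r *\<^sub>R v) = r *\<^sub>R H x u v" by metis
qed

lemma D_expand: assumes "x \<in> U" shows "D x v = (\<Sum>b\<in>Basis. (v \<bullet> b) * D x b)"
proof -
  have "D x v = D x (\<Sum>b\<in>Basis. (v \<bullet> b) *\<^sub>R b)" by (simp add: euclidean_representation)
  thus ?thesis by (simp add: linear_sum[OF linear_D[OF assms]] linear_scale[OF linear_D[OF assms]])
qed

lemma H_expand: assumes "x \<in> U" shows "H x u v = (\<Sum>b\<in>Basis. \<Sum>b'\<in>Basis. (u \<bullet> b) * (v \<bullet> b') * H x b b')"
proof -
  have "H x u v = H x (\<Sum>b\<in>Basis. (u \<bullet> b) *\<^sub>R b) v" by (simp add: euclidean_representation)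
  also have "\<dots> = (\<Sum>b\<in>Basis. (u \<bullet> b) * H x b v)"
    by (simp add: linear_sum[OF linear_H1[OF assms, of v]] linear_scale[OF linear_H1[OF assms, of v]])
  also have "\<dots> = (\<Sum>b\<in>Basis. (u \<bullet> b) * (\<Sum>b'\<in>Basis. (v \<bullet> b') * H x b b'))"
  proof (intro sum.cong refl arg_cong2[where f = "(*)"])
    fix b :: 'a
    have "H x b v = H x b (\<Sum>b'\<in>Basis. (v \<bullet> b') *\<^sub>R b')" by (simp add: euclidean_representation)
    thus "H x b v = (\<Sum>b'\<in>Basis. (v \<bullet> b') * H x b b')"
      using linear_H2[OF assms, of b] by (simp add: linear_sum linear_scale)
  qed
  finally show ?thesis by (simp add: sum_distrib_left mult.assoc)
qed

lemma cont1: "continuous_on U (\<lambda>x. D x v)"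
  by (intro continuous_at_imp_continuous_on ballI has_derivative_continuous[OF der2])

lemma continuous_g: "continuous_on U g"
  by (intro continuous_at_imp_continuous_on ballI has_derivative_continuous[OF der1])

lemma continuous_D:
  assumes "continuous_on S p" "continuous_on S q" "p ` S \<subseteq> U"
  shows "continuous_on S (\<lambda>s. D (p s) (q s))"
proof -
  have "continuous_on S (\<lambda>s. \<Sum>b\<in>Basis. (q s \<bullet> b) * D (p s) b)"
    using assms by (intro continuous_intros continuous_on_compose2[OF cont1]) auto
  moreover have "(\<Sum>b\<in>Basis. (q s \<bullet> b) * D (p s) b) = D (p s) (q s)" if "s \<in> S" for s
    by (rule D_expand[symmetric]) (use assms(3) that in auto)
  ultimately show ?thesis by (rule continuous_on_eq)
qed

lemma continuous_H:
  assumes "continuous_on S p" "continuous_on S q" "continuous_on S r" "p ` S \<subseteq> U"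
  shows "continuous_on S (\<lambda>s. H (p s) (q s) (r s))"
proof -
  have "continuous_on S (\<lambda>s. \<Sum>b\<in>Basis. \<Sum>b'\<in>Basis. (q s \<bullet> b) * (r s \<bullet> b') * H (p s) b b')"
    using assms by (intro continuous_intros continuous_on_compose2[OF cont2]) auto
  moreover have "(\<Sum>b\<in>Basis. \<Sum>b'\<in>Basis. (q s \<bullet> b) * (r s \<bullet> b') * H (p s) b b') = H (p s) (q s) (r s)" if "s \<in> S" for s
    by (rule H_expand[symmetric]) (use assms(4) that in auto)
  ultimately show ?thesis by (rule continuous_on_eq)
qed

lemma curve_derivative1:
  assumes "(c has_vector_derivative c') (at t within S)" "c t \<in> U"
  shows "((\<lambda>t. g (c t)) has_vector_derivative D (c t) c') (at t within S)"
  using has_derivative_compose[OF assms(1)[unfolded has_vector_derivative_def] der1[OF assms(2)]]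
  unfolding has_vector_derivative_def by (simp add: linear_scale[OF linear_D[OF assms(2)]])

text \<open>Product rule after expanding the second argument of \<open>D\<close> in the
  basis.\<close>

lemma curve_derivative2:
  assumes c: "(c has_vector_derivative c') (at t within S)" and w: "(w has_vector_derivative w') (at t within S)"
    and t: "t \<in> S" and U: "c ` S \<subseteq> U"
  shows "((\<lambda>t. D (c t) (w t)) has_vector_derivative H (c t) c' (w t) + D (c t) w') (at t within S)"
proof -
  have ct: "c t \<in> U" using t U by auto
  have D': "((\<lambda>s. D (c s) b) has_vector_derivative H (c t) c' b) (at t within S)" for b
    using has_derivative_compose[OF c[unfolded has_vector_derivative_def] der2[OF ct, of b]]
    unfolding has_vector_derivative_def by (simp add: linear_scale[OF linear_H1[OF ct]])
  have "((\<lambda>s. w s \<bullet> b) has_vector_derivative w' \<bullet> b) (at t within S)" for b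
    by (rule bounded_linear.has_vector_derivative[OF bounded_linear_inner_left w])
  hence "((\<lambda>s. \<Sum>b\<in>Basis. (w s \<bullet> b) * D (c s) b) has_vector_derivative
      (\<Sum>b\<in>Basis. (w t \<bullet> b) * H (c t) c' b + (w' \<bullet> b) * D (c t) b)) (at t within S)"
    by (intro has_vector_derivative_sum has_vector_derivative_mult D')
  moreover have "(\<Sum>b\<in>Basis. (w t \<bullet> b) * H (c t) c' b + (w' \<bullet> b) * D (c t) b) = H (c t) c' (w t) + D (c t) w'"
  proof -
    have "H (c t) c' (w t) = H (c t) c' (\<Sum>b\<in>Basis. (w t \<bullet> b) *\<^sub>R b)" by (simp add: euclidean_representation)
    also have "\<dots> = (\<Sum>b\<in>Basis. (w t \<bullet> b) * H (c t) c' b)"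
      using linear_H2[OF ct, of c'] by (simp add: linear_sum linear_scale)
    finally show ?thesis by (simp add: sum.distrib D_expand[OF ct, of w'])
  qed
  ultimately have d: "((\<lambda>s. \<Sum>b\<in>Basis. (w s \<bullet> b) * D (c s) b) has_vector_derivative H (c t) c' (w t) + D (c t) w') (at t within S)"
    by simp
  show ?thesis
  proof (rule has_vector_derivative_transform[OF t _ d])
    show "D (c s) (w s) = (\<Sum>b\<in>Basis. (w s \<bullet> b) * D (c s) b)" if "s \<in> S" for s
      by (rule D_expand) (use U that in auto)
  qed
qed

end

text \<open>In the coordinates \<open>\<zeta> = exp (\<tau> + \<i> \<theta>)\<close> the circular mean is a convex function of \<open>\<tau>\<close>, and it is
  bounded as \<open>\<tau> \<rightarrow> -\<infinity>\<close>, hence nondecreasing.\<close>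

lemma circle_mean_ge_center:
  fixes g :: "complex ^ 'n \<Rightarrow> real" and \<phi> :: "complex \<Rightarrow> complex ^ 'n"
  assumes C2: "C2_function U g D H"
    and psh: "\<And>x v. x \<in> \<Omega> \<Longrightarrow> 0 \<le> H x v v + H x (\<i> *s v) (\<i> *s v)" and sub: "\<Omega> \<subseteq> U"
    and B: "\<And>x. x \<in> \<Omega> \<Longrightarrow> g x \<le> B"
    and hol: "\<And>i. (\<lambda>\<zeta>. \<phi> \<zeta> $ i) holomorphic_on ball 0 1" and im: "\<phi> ` ball 0 1 \<subseteq> \<Omega>"
    and s: "0 < s" "s < 1"
  shows "2 * pi * g (\<phi> 0) \<le> integral {0..2*pi} (\<lambda>\<theta>. g (\<phi> (of_real s * cis \<theta>)))"
proof -
  interpret C2_function U g D H by fact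
  define f1 where "f1 i = deriv (\<lambda>\<zeta>. \<phi> \<zeta> $ i)" for i
  define f2 where "f2 i = deriv (f1 i)" for i
  have h1: "f1 i holomorphic_on ball 0 1" for i unfolding f1_def by (intro holomorphic_deriv hol) auto
  have h2: "f2 i holomorphic_on ball 0 1" for i unfolding f2_def by (intro holomorphic_deriv h1) auto
  have d0: "((\<lambda>\<zeta>. \<phi> \<zeta> $ i) has_field_derivative f1 i \<zeta>) (at \<zeta>)" if "\<zeta> \<in> ball 0 1" for i \<zeta>
    unfolding f1_def using hol that by (intro holomorphic_derivI[of _ "ball 0 1"]) auto
  have d1: "(f1 i has_field_derivative f2 i \<zeta>) (at \<zeta>)" if "\<zeta> \<in> ball 0 1" for i \<zeta>
    unfolding f2_def using h1 that by (intro holomorphic_derivI[of _ "ball 0 1"]) auto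
  define P where "P = {\<omega>::complex. Re \<omega> < 0}"
  have expP: "exp \<omega> \<in> ball 0 1" if "\<omega> \<in> P" for \<omega> using that by (simp add: P_def)
  define \<psi> where "\<psi> \<omega> = \<phi> (exp \<omega>)" for \<omega>
  define \<psi>1 where "\<psi>1 \<omega> = (\<chi> i. exp \<omega> * f1 i (exp \<omega>))" for \<omega>
  define \<psi>2 where "\<psi>2 \<omega> = (\<chi> i. exp \<omega> * f1 i (exp \<omega>) + (exp \<omega>)\<^sup>2 * f2 i (exp \<omega>))" for \<omega>
  have e0: "((\<lambda>\<omega>. \<psi> \<omega> $ i) has_field_derivative \<psi>1 \<omega> $ i) (at \<omega>)" if "\<omega> \<in> P" for \<omega> i
    using DERIV_chain2[OF d0[OF expP[OF that], of i] DERIV_exp] by (simp add: \<psi>_def \<psi>1_def mult.commute)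
  have e1: "((\<lambda>\<omega>. \<psi>1 \<omega> $ i) has_field_derivative \<psi>2 \<omega> $ i) (at \<omega>)" if "\<omega> \<in> P" for \<omega> i
    using DERIV_mult[OF DERIV_exp[of \<omega>] DERIV_chain2[OF d1[OF expP[OF that], of i] DERIV_exp]]
    by (simp add: \<psi>1_def \<psi>2_def power2_eq_square mult_ac)
  have contP: "continuous_on P (\<lambda>\<omega>. \<psi> \<omega> $ i)" "continuous_on P (\<lambda>\<omega>. \<psi>1 \<omega> $ i)" "continuous_on P (\<lambda>\<omega>. \<psi>2 \<omega> $ i)" for i
  proof -
    show "continuous_on P (\<lambda>\<omega>. \<psi> \<omega> $ i)" "continuous_on P (\<lambda>\<omega>. \<psi>1 \<omega> $ i)"
      by (intro continuous_at_imp_continuous_on ballI DERIV_isCont[OF e0] DERIV_isCont[OF e1]; assumption)+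
    have "continuous_on (ball 0 1) (f1 i)" "continuous_on (ball 0 1) (f2 i)"
      using h1 h2 holomorphic_on_imp_continuous_on by auto
    thus "continuous_on P (\<lambda>\<omega>. \<psi>2 \<omega> $ i)" unfolding \<psi>2_def using expP
      by (auto intro!: continuous_intros continuous_on_compose2[of "ball 0 1" "f1 i"] continuous_on_compose2[of "ball 0 1" "f2 i"])
  qed
  have vcont: "continuous_on S f" if "\<And>i. continuous_on S (\<lambda>x. f x $ i)" for f :: "complex \<Rightarrow> complex ^ 'n" and S
    using continuous_on_vec_lambda[of S "\<lambda>i x. f x $ i"] that by simp
  have cont: "continuous_on P \<psi>" "continuous_on P \<psi>1" "continuous_on P \<psi>2"
    using contP by (auto intro: vcont)
  have \<psi>\<Omega>: "\<psi> \<omega> \<in> \<Omega>" if "\<omega> \<in> P" for \<omega> using im expP[OF that] by (auto simp: \<psi>_def)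
  hence \<psi>U: "\<psi> ` P \<subseteq> U" using sub by auto
  define \<omega> where "\<omega> \<tau> \<theta> = Complex \<tau> \<theta>" for \<tau> \<theta>
  have \<omega>P: "\<omega> \<tau> \<theta> \<in> P" if "\<tau> < 0" for \<tau> \<theta> using that by (simp add: P_def \<omega>_def)
  have \<omega>\<tau>: "((\<lambda>\<tau>. \<omega> \<tau> \<theta>) has_vector_derivative 1) (at \<tau> within S)" for \<tau> \<theta> S
    unfolding \<omega>_def Complex_eq by (auto intro!: derivative_eq_intros)
  have \<omega>\<theta>: "((\<lambda>\<theta>. \<omega> \<tau> \<theta>) has_vector_derivative \<i>) (at \<theta> within S)" for \<tau> \<theta> S
    unfolding \<omega>_def Complex_eq by (auto intro!: derivative_eq_intros)
  have chain: "((\<lambda>t. F (c t)) has_vector_derivative c' * F') (at t within S)"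
    if "(c has_vector_derivative c') (at t within S)" "(F has_field_derivative F') (at (c t))" for F c c' F' t S
    using field_vector_diff_chain_within[OF that(1) has_field_derivative_at_within[OF that(2)]] by (simp add: o_def)
  have p0\<tau>: "((\<lambda>\<tau>. \<psi> (\<omega> \<tau> \<theta>)) has_vector_derivative \<psi>1 (\<omega> \<tau> \<theta>)) (at \<tau> within S)" if "\<tau> < 0" for \<tau> \<theta> S
    by (rule has_vector_derivative_vec) (use chain[OF \<omega>\<tau> e0[OF \<omega>P[OF that]]] in simp)
  have p1\<tau>: "((\<lambda>\<tau>. \<psi>1 (\<omega> \<tau> \<theta>)) has_vector_derivative \<psi>2 (\<omega> \<tau> \<theta>)) (at \<tau> within S)" if "\<tau> < 0" for \<tau> \<theta> S
    by (rule has_vector_derivative_vec) (use chain[OF \<omega>\<tau> e1[OF \<omega>P[OF that]]] in simp)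
  have p0\<theta>: "((\<lambda>\<theta>. \<psi> (\<omega> \<tau> \<theta>)) has_vector_derivative \<i> *s \<psi>1 (\<omega> \<tau> \<theta>)) (at \<theta> within S)" if "\<tau> < 0" for \<tau> \<theta> S
    by (rule has_vector_derivative_vec) (use chain[OF \<omega>\<theta> e0[OF \<omega>P[OF that]]] in simp)
  have p1\<theta>: "((\<lambda>\<theta>. \<i> *s \<psi>1 (\<omega> \<tau> \<theta>)) has_vector_derivative - \<psi>2 (\<omega> \<tau> \<theta>)) (at \<theta> within S)" if "\<tau> < 0" for \<tau> \<theta> S
  proof (rule has_vector_derivative_vec)
    fix i
    have "((\<lambda>\<theta>. \<i> * (\<psi>1 (\<omega> \<tau> \<theta>) $ i)) has_vector_derivative \<i> * (\<i> * (\<psi>2 (\<omega> \<tau> \<theta>) $ i))) (at \<theta> within S)"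
      by (intro has_vector_derivative_mult_right chain[OF \<omega>\<theta> e1[OF \<omega>P[OF that]]])
    thus "((\<lambda>\<theta>. (\<i> *s \<psi>1 (\<omega> \<tau> \<theta>)) $ i) has_vector_derivative (- \<psi>2 (\<omega> \<tau> \<theta>)) $ i) (at \<theta> within S)"
      by (simp add: mult.assoc[symmetric])
  qed
  have \<omega>cont: "continuous_on ({..<0} \<times> S) (\<lambda>(\<tau>, \<theta>). \<omega> \<tau> \<theta>)" for S
    unfolding \<omega>_def Complex_eq by (auto simp: case_prod_beta' intro!: continuous_intros)
  have \<omega>im: "(\<lambda>(\<tau>, \<theta>). \<omega> \<tau> \<theta>) ` ({..<0} \<times> S) \<subseteq> P" for S using \<omega>P by auto
  have c\<psi>: "continuous_on ({..<0} \<times> S) (\<lambda>(\<tau>, \<theta>). \<psi> (\<omega> \<tau> \<theta>))" for S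
    using continuous_on_compose2[OF cont(1) \<omega>cont \<omega>im] by (simp add: case_prod_beta')
  have c\<psi>1: "continuous_on ({..<0} \<times> S) (\<lambda>(\<tau>, \<theta>). \<psi>1 (\<omega> \<tau> \<theta>))" for S
    using continuous_on_compose2[OF cont(2) \<omega>cont \<omega>im] by (simp add: case_prod_beta')
  have c\<psi>2: "continuous_on ({..<0} \<times> S) (\<lambda>(\<tau>, \<theta>). \<psi>2 (\<omega> \<tau> \<theta>))" for S
    using continuous_on_compose2[OF cont(3) \<omega>cont \<omega>im] by (simp add: case_prod_beta')
  define G0 where "G0 \<tau> \<theta> = g (\<psi> (\<omega> \<tau> \<theta>))" for \<tau> \<theta>
  define G1 where "G1 \<tau> \<theta> = D (\<psi> (\<omega> \<tau> \<theta>)) (\<psi>1 (\<omega> \<tau> \<theta>))" for \<tau> \<theta>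
  define G2 where "G2 \<tau> \<theta> = H (\<psi> (\<omega> \<tau> \<theta>)) (\<psi>1 (\<omega> \<tau> \<theta>)) (\<psi>1 (\<omega> \<tau> \<theta>)) + D (\<psi> (\<omega> \<tau> \<theta>)) (\<psi>2 (\<omega> \<tau> \<theta>))" for \<tau> \<theta>
  \<comment> \<open>\<open>G2\<close> and \<open>G3\<close> are the second derivatives in \<tau> and
    \<theta>. In their sum the first-order terms cancel and a multiple of the Levi form remains,
    while \<open>G3\<close> has integral 0 by periodicity; hence the circular mean \<open>M0\<close>
    is convex.\<close>
  define G3 where "G3 \<tau> \<theta> = H (\<psi> (\<omega> \<tau> \<theta>)) (\<i> *s \<psi>1 (\<omega> \<tau> \<theta>)) (\<i> *s \<psi>1 (\<omega> \<tau> \<theta>)) + D (\<psi> (\<omega> \<tau> \<theta>)) (- \<psi>2 (\<omega> \<tau> \<theta>))" for \<tau> \<theta>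
  have im2: "(\<lambda>p. \<psi> (\<omega> (fst p) (snd p))) ` ({..<0} \<times> S) \<subseteq> U" for S using \<psi>U \<omega>P by auto
  have cG0: "continuous_on ({..<0} \<times> S) (\<lambda>(\<tau>, \<theta>). G0 \<tau> \<theta>)" for S
    unfolding G0_def case_prod_beta'
    by (rule continuous_on_compose2[OF continuous_g]) (use c\<psi>[of S] im2[of S] in \<open>auto simp: case_prod_beta'\<close>)
  have cG1: "continuous_on ({..<0} \<times> S) (\<lambda>(\<tau>, \<theta>). G1 \<tau> \<theta>)" for S
    unfolding G1_def case_prod_beta'
    using continuous_D[OF c\<psi>[of S, unfolded case_prod_beta'] c\<psi>1[of S, unfolded case_prod_beta'] im2] .
  have cG2: "continuous_on ({..<0} \<times> S) (\<lambda>(\<tau>, \<theta>). G2 \<tau> \<theta>)" for S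
    unfolding G2_def case_prod_beta'
    by (intro continuous_on_add continuous_D continuous_H im2
        c\<psi>[of S, unfolded case_prod_beta'] c\<psi>1[of S, unfolded case_prod_beta'] c\<psi>2[of S, unfolded case_prod_beta'])
  have slice: "continuous_on {0..2*pi} (\<lambda>\<theta>. G \<tau> \<theta>)" if "continuous_on ({..<0} \<times> {0..2*pi}) (\<lambda>(\<tau>, \<theta>). G \<tau> \<theta>)" "\<tau> < 0" for G :: "real \<Rightarrow> real \<Rightarrow> real" and \<tau>
    using continuous_on_compose2[OF that(1), of "{0..2*pi}" "\<lambda>\<theta>. (\<tau>, \<theta>)"] that(2) continuous_on_Pair[OF continuous_on_const[of "{0..2*pi}" \<tau>] continuous_on_id] by auto
  define M0 where "M0 \<tau> = integral {0..2*pi} (G0 \<tau>)" for \<tau>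
  define M1 where "M1 \<tau> = integral {0..2*pi} (G1 \<tau>)" for \<tau>
  define M2 where "M2 \<tau> = integral {0..2*pi} (G2 \<tau>)" for \<tau>
  have dM0: "(M0 has_real_derivative M1 \<tau>) (at \<tau>)" if "\<tau> < 0" for \<tau>
  proof -
    have "((\<lambda>\<tau>. integral (cbox 0 (2*pi)) (G0 \<tau>)) has_field_derivative integral (cbox 0 (2*pi)) (G1 \<tau>)) (at \<tau> within {..<0})"
    proof (rule leibniz_rule_field_derivative)
      show "((\<lambda>\<tau>. G0 \<tau> \<theta>) has_field_derivative G1 \<tau> \<theta>) (at \<tau> within {..<0})" if "\<tau> \<in> {..<0}" for \<tau> \<theta>
        unfolding G0_def G1_def has_real_derivative_iff_has_vector_derivative
        by (rule curve_derivative1[OF p0\<tau>]) (use that \<psi>U \<omega>P in auto)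
      show "G0 \<tau> integrable_on cbox 0 (2*pi)" if "\<tau> \<in> {..<0}" for \<tau>
        using slice[OF cG0, of \<tau>] that by (auto intro: integrable_continuous_interval)
      show "continuous_on ({..<0} \<times> cbox 0 (2*pi)) (\<lambda>(\<tau>, \<theta>). G1 \<tau> \<theta>)" by (rule cG1)
    qed (use that in auto)
    hence "(M0 has_real_derivative M1 \<tau>) (at \<tau> within {..<0})" unfolding M0_def M1_def by simp
    thus ?thesis using that by (simp add: at_within_open[of _ "{..<0}"])
  qed
  have dM1: "(M1 has_real_derivative M2 \<tau>) (at \<tau>)" if "\<tau> < 0" for \<tau>
  proof -
    have "((\<lambda>\<tau>. integral (cbox 0 (2*pi)) (G1 \<tau>)) has_field_derivative integral (cbox 0 (2*pi)) (G2 \<tau>)) (at \<tau> within {..<0})"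
    proof (rule leibniz_rule_field_derivative)
      show "((\<lambda>\<tau>. G1 \<tau> \<theta>) has_field_derivative G2 \<tau> \<theta>) (at \<tau> within {..<0})" if "\<tau> \<in> {..<0}" for \<tau> \<theta>
        unfolding G1_def G2_def has_real_derivative_iff_has_vector_derivative
        by (rule curve_derivative2[OF p0\<tau> p1\<tau>]) (use that \<psi>U \<omega>P in auto)
      show "G1 \<tau> integrable_on cbox 0 (2*pi)" if "\<tau> \<in> {..<0}" for \<tau>
        using slice[OF cG1, of \<tau>] that by (auto intro: integrable_continuous_interval)
      show "continuous_on ({..<0} \<times> cbox 0 (2*pi)) (\<lambda>(\<tau>, \<theta>). G2 \<tau> \<theta>)" by (rule cG2)
    qed (use that in auto)
    hence "(M1 has_real_derivative M2 \<tau>) (at \<tau> within {..<0})" unfolding M1_def M2_def by simp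
    thus ?thesis using that by (simp add: at_within_open[of _ "{..<0}"])
  qed
  have M2pos: "0 \<le> M2 \<tau>" if \<tau>: "\<tau> < 0" for \<tau>
  proof -
    have exp_per: "exp (\<omega> \<tau> (2*pi)) = exp (\<omega> \<tau> 0)" by (simp add: \<omega>_def exp_eq_polar)
    have "(G3 \<tau> has_integral (D (\<psi> (\<omega> \<tau> (2*pi))) (\<i> *s \<psi>1 (\<omega> \<tau> (2*pi))) - D (\<psi> (\<omega> \<tau> 0)) (\<i> *s \<psi>1 (\<omega> \<tau> 0)))) {0..2*pi}"
      unfolding G3_def
    proof (rule fundamental_theorem_of_calculus[where f = "\<lambda>\<theta>. D (\<psi> (\<omega> \<tau> \<theta>)) (\<i> *s \<psi>1 (\<omega> \<tau> \<theta>))"])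
      have "(\<lambda>\<theta>. \<psi> (\<omega> \<tau> \<theta>)) ` {0..2*pi} \<subseteq> U" using \<psi>U \<omega>P[OF \<tau>] by blast
      thus "((\<lambda>\<theta>. D (\<psi> (\<omega> \<tau> \<theta>)) (\<i> *s \<psi>1 (\<omega> \<tau> \<theta>))) has_vector_derivative
          H (\<psi> (\<omega> \<tau> \<theta>)) (\<i> *s \<psi>1 (\<omega> \<tau> \<theta>)) (\<i> *s \<psi>1 (\<omega> \<tau> \<theta>)) + D (\<psi> (\<omega> \<tau> \<theta>)) (- \<psi>2 (\<omega> \<tau> \<theta>))) (at \<theta> within {0..2*pi})"
        if "\<theta> \<in> {0..2*pi}" for \<theta>
        using curve_derivative2[OF p0\<theta>[OF \<tau>] p1\<theta>[OF \<tau>] that] by blast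
    qed simp
    hence G3: "(G3 \<tau> has_integral 0) {0..2*pi}" using exp_per by (simp add: \<psi>_def \<psi>1_def)
    have "continuous_on {0..2*pi} (G2 \<tau>)" using slice[OF cG2 \<tau>] .
    hence G2: "(G2 \<tau> has_integral M2 \<tau>) {0..2*pi}"
      unfolding M2_def by (intro integrable_integral integrable_continuous_interval)
    have "((\<lambda>\<theta>. G2 \<tau> \<theta> + G3 \<tau> \<theta>) has_integral M2 \<tau> + 0) {0..2*pi}" by (rule has_integral_add[OF G2 G3])
    hence "0 \<le> M2 \<tau> + 0"
    proof (rule has_integral_nonneg)
      fix \<theta>
      have u: "\<psi> (\<omega> \<tau> \<theta>) \<in> U" using \<psi>U \<omega>P[OF \<tau>] by auto
      show "0 \<le> G2 \<tau> \<theta> + G3 \<tau> \<theta>"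
        using psh[OF \<psi>\<Omega>[OF \<omega>P[OF \<tau>]]] by (simp add: G2_def G3_def linear_neg[OF linear_D[OF u]])
    qed
    thus ?thesis by simp
  qed
  have M0le: "M0 \<tau> \<le> 2 * pi * B" if \<tau>: "\<tau> < 0" for \<tau>
  proof -
    have "M0 \<tau> \<le> integral {0..2*pi} (\<lambda>_. B)" unfolding M0_def
      using slice[OF cG0 \<tau>] B \<psi>\<Omega>[OF \<omega>P[OF \<tau>]]
      by (intro integral_le integrable_continuous_interval) (auto simp: G0_def)
    thus ?thesis by (simp add: mult.commute)
  qed
  have M1mono: "M1 a \<le> M1 b" if "a \<le> b" "b < 0" for a b
  proof (rule DERIV_nonneg_imp_nondecreasing[OF that(1)])
    fix x assume "a \<le> x" "x \<le> b"
    hence "x < 0" using that(2) by simp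
    thus "\<exists>y. (M1 has_real_derivative y) (at x) \<and> 0 \<le> y" using dM1 M2pos by blast
  qed
  have M1pos: "0 \<le> M1 b" if b: "b < 0" for b
  proof (rule ccontr)
    assume "\<not> 0 \<le> M1 b"
    hence neg: "M1 b < 0" by simp
    \<comment> \<open>By convexity a negative slope at \<open>b\<close> persists to the left of
      \<open>b\<close>; \<open>k\<close> is so large that the mean at \<open>b - k\<close> would
      exceed its upper bound \<open>2 * pi * B\<close>.\<close>
    define k where "k = (\<bar>2 * pi * B - M0 b\<bar> + 1) / (- M1 b)"
    have k: "k > 0" using neg unfolding k_def by (intro divide_pos_pos) auto
    have "\<exists>z. z > b - k \<and> z < b \<and> M0 b - M0 (b - k) = (b - (b - k)) * M1 z"
      by (rule MVT2) (use k dM0 b in auto)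
    then obtain z where z: "z < b" "M0 b - M0 (b - k) = k * M1 z" by auto
    have "k * M1 z \<le> k * M1 b" using M1mono[of z b] z b k by (intro mult_left_mono) auto
    also have "\<dots> = - (\<bar>2 * pi * B - M0 b\<bar> + 1)" using neg by (simp add: k_def)
    finally have "M0 (b - k) \<ge> M0 b + \<bar>2 * pi * B - M0 b\<bar> + 1" using z by linarith
    thus False using M0le[of "b - k"] b k by linarith
  qed
  have M0mono: "M0 a \<le> M0 b" if "a \<le> b" "b < 0" for a b
  proof (rule DERIV_nonneg_imp_nondecreasing[OF that(1)])
    fix x assume "a \<le> x" "x \<le> b"
    hence "x < 0" using that(2) by simp
    thus "\<exists>y. (M0 has_real_derivative y) (at x) \<and> 0 \<le> y" using dM0 M1pos by blast
  qed
  define t where "t = ln s"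
  have t: "t < 0" using s by (simp add: t_def)
  have Ms: "M0 t = integral {0..2*pi} (\<lambda>\<theta>. g (\<phi> (of_real s * cis \<theta>)))"
    using s by (simp add: M0_def G0_def[abs_def] \<psi>_def \<omega>_def t_def exp_eq_polar)
  have "2 * pi * g (\<phi> 0) \<le> M0 t + e" if e: "e > 0" for e
  proof -
    define e' where "e' = e / (2 * pi)"
    have e': "e' > 0" using e by (simp add: e'_def)
    have "continuous_on (ball 0 1) \<phi>"
      by (rule vcont) (use hol holomorphic_on_imp_continuous_on in auto)
    hence "continuous_on (ball 0 1) (\<lambda>\<zeta>. g (\<phi> \<zeta>))"
      by (rule continuous_on_compose2[OF continuous_g]) (use im sub in auto)
    hence "isCont (\<lambda>\<zeta>. g (\<phi> \<zeta>)) 0" by (simp add: continuous_on_eq_continuous_at)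
    then obtain d where d: "d > 0" "\<And>\<zeta>. dist \<zeta> 0 < d \<Longrightarrow> dist (g (\<phi> \<zeta>)) (g (\<phi> 0)) < e'"
      unfolding continuous_at_eps_delta using e' by (metis dist_norm)
    \<comment> \<open>The circle of radius \<open>exp a\<close> is so close to the origin that its
      mean is nearly the central value; monotonicity carries the inequality over to radius
      \<open>s\<close>.\<close>
    define a where "a = min t (ln (d / 2))"
    have a: "a \<le> t" "exp a < d"
    proof -
      show "a \<le> t" by (simp add: a_def)
      have "exp a \<le> exp (ln (d / 2))" by (simp add: a_def)
      thus "exp a < d" using d(1) by simp
    qed
    have "2 * pi * (g (\<phi> 0) - e') = integral {0..2*pi} (\<lambda>_. g (\<phi> 0) - e')" by simp
    also have "\<dots> \<le> M0 a" unfolding M0_def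
    proof (intro integral_le integrable_continuous_interval)
      show "continuous_on {0..2*pi} (G0 a)" using slice[OF cG0, of a] a(1) t by simp
      show "g (\<phi> 0) - e' \<le> G0 a \<theta>" if "\<theta> \<in> {0..2*pi}" for \<theta>
      proof -
        have "norm (exp (\<omega> a \<theta>)) < d" using a(2) by (simp add: \<omega>_def)
        hence "dist (g (\<phi> (exp (\<omega> a \<theta>)))) (g (\<phi> 0)) < e'" by (intro d(2)) simp
        thus ?thesis by (simp add: G0_def \<psi>_def dist_real_def abs_less_iff)
      qed
    qed (intro continuous_intros)
    also have "\<dots> \<le> M0 t" using M0mono[OF a(1) t] .
    finally show ?thesis by (simp add: e'_def algebra_simps)
  qed
  hence "2 * pi * g (\<phi> 0) \<le> M0 t" by (rule field_le_epsilon)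
  thus ?thesis by (simp add: Ms)
qed

lemma circle_mean_holomorphic:
  assumes "F holomorphic_on ball 0 1" "0 < s" "s < 1"
  shows "((\<lambda>\<theta>. F (of_real s * cis \<theta>)) has_integral 2 * of_real pi * F 0) {0..2*pi}"
proof -
  have "F holomorphic_on cball 0 s" using assms by (auto intro: holomorphic_on_subset)
  hence "((\<lambda>u. F u / (u - 0)) has_contour_integral (2 * of_real pi * \<i> * F 0)) (part_circlepath 0 s 0 (2*pi))"
    using Cauchy_integral_circlepath_simple[of F 0 s 0] assms by (simp add: circlepath_def)
  hence "((\<lambda>t. F (of_real s * cis t) / (of_real s * cis t) * s * \<i> * cis t) has_integral (2 * of_real pi * \<i> * F 0)) {0..2*pi}"
    by (subst (asm) has_contour_integral_part_circlepath_iff) auto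
  moreover have "F (of_real s * cis t) / (of_real s * cis t) * s * \<i> * cis t = \<i> * F (of_real s * cis t)" for t
    using assms by (simp add: field_simps)
  ultimately have "((\<lambda>t. \<i> * F (of_real s * cis t)) has_integral (2 * of_real pi * \<i> * F 0)) {0..2*pi}" by (simp only:)
  from has_integral_mult_right[OF this, of "-\<i>"] show ?thesis by (simp add: mult_ac)
qed

text \<open>A Borel-Caratheodory estimate with an integrated one-sided bound. The derivative is a
  Fourier coefficient of \<open>F\<close>, and adding the vanishing integral \<open>I2\<close>
  replaces \<open>F\<close> by twice its real part. Since Re F has mean zero and is at most
  \<open>G\<close>, with G \<ge> 0, one can use 2 |Re F| \<le> 4 G - 2 Re F.\<close>

lemma deriv_bound_Re:
  fixes F :: "complex \<Rightarrow> complex" and G :: "real \<Rightarrow> real"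
  assumes hol: "F holomorphic_on ball 0 1" and F0: "F 0 = 0" and s: "0 < s" "s < 1"
    and G: "G integrable_on {0..2*pi}" and G0: "\<And>\<theta>. \<theta> \<in> {0..2*pi} \<Longrightarrow> 0 \<le> G \<theta>"
    and le: "\<And>\<theta>. \<theta> \<in> {0..2*pi} \<Longrightarrow> Re (F (of_real s * cis \<theta>)) \<le> G \<theta>"
  shows "2 * pi * s * norm (deriv F 0) \<le> 4 * integral {0..2*pi} G"
proof -
  define R where "R \<theta> = Re (F (of_real s * cis \<theta>))" for \<theta>
  have "((\<lambda>\<theta>. F (of_real s * cis \<theta>)) has_integral 0) {0..2*pi}"
    using circle_mean_holomorphic[OF hol s] F0 by simp
  from has_integral_linear[OF this bounded_linear_Re]
  have R0: "(R has_integral 0) {0..2*pi}" by (simp add: R_def[abs_def] o_def)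
  obtain h where h: "h holomorphic_on ball 0 1" "\<And>z. norm z < 1 \<Longrightarrow> F z = z * h z" "deriv F 0 = h 0"
    using Schwarz3[OF hol F0] by blast
  have I1: "((\<lambda>\<theta>. F (of_real s * cis \<theta>) * cnj (cis \<theta>)) has_integral of_real s * (2 * of_real pi * deriv F 0)) {0..2*pi}"
  proof -
    have "((\<lambda>\<theta>. of_real s * h (of_real s * cis \<theta>)) has_integral of_real s * (2 * of_real pi * h 0)) {0..2*pi}"
      by (intro has_integral_mult_right circle_mean_holomorphic h s)
    moreover have "of_real s * h (of_real s * cis \<theta>) = F (of_real s * cis \<theta>) * cnj (cis \<theta>)" for \<theta>
    proof -
      have eqF: "F (of_real s * cis \<theta>) = of_real s * cis \<theta> * h (of_real s * cis \<theta>)" using s by (intro h) (simp add: norm_mult)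
      have cc: "cis \<theta> * cnj (cis \<theta>) = 1" by (simp add: complex_norm_square[symmetric])
      have "F (of_real s * cis \<theta>) * cnj (cis \<theta>) = of_real s * h (of_real s * cis \<theta>) * (cis \<theta> * cnj (cis \<theta>))"
        unfolding eqF by (simp only: mult_ac)
      thus ?thesis by (simp only: cc mult_1_right)
    qed
    ultimately show ?thesis by (simp add: h(3))
  qed
  have I2: "((\<lambda>\<theta>. cnj (F (of_real s * cis \<theta>) * cis \<theta>)) has_integral 0) {0..2*pi}"
  proof -
    have "((\<lambda>\<theta>. of_real s * cis \<theta> * F (of_real s * cis \<theta>)) has_integral 2 * of_real pi * (0 * F 0)) {0..2*pi}"
      by (rule circle_mean_holomorphic[of "\<lambda>z. z * F z"]) (use hol s in \<open>auto intro!: holomorphic_intros\<close>)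
    from has_integral_mult_right[OF this, of "1 / of_real s"]
    have "((\<lambda>\<theta>. F (of_real s * cis \<theta>) * cis \<theta>) has_integral 0) {0..2*pi}" using s by (simp add: mult_ac)
    from has_integral_linear[OF this bounded_linear_cnj] show ?thesis by (simp add: o_def)
  qed
  have "((\<lambda>\<theta>. F (of_real s * cis \<theta>) * cnj (cis \<theta>) + cnj (F (of_real s * cis \<theta>) * cis \<theta>)) has_integral of_real s * (2 * of_real pi * deriv F 0) + 0) {0..2*pi}"
    by (rule has_integral_add[OF I1 I2])
  moreover have "F (of_real s * cis \<theta>) * cnj (cis \<theta>) + cnj (F (of_real s * cis \<theta>) * cis \<theta>) = of_real (2 * R \<theta>) * cnj (cis \<theta>)" for \<theta>
    by (simp add: R_def distrib_right[symmetric] complex_add_cnj)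
  ultimately have I3: "((\<lambda>\<theta>. of_real (2 * R \<theta>) * cnj (cis \<theta>)) has_integral of_real s * (2 * of_real pi * deriv F 0)) {0..2*pi}" by simp
  have "norm (of_real s * (2 * of_real pi * deriv F 0)) = norm (integral {0..2*pi} (\<lambda>\<theta>. of_real (2 * R \<theta>) * cnj (cis \<theta>)))"
    using I3 by (simp add: integral_unique)
  also have "\<dots> \<le> integral {0..2*pi} (\<lambda>\<theta>. 4 * G \<theta> - 2 * R \<theta>)"
  proof (rule integral_norm_bound_integral)
    show "(\<lambda>\<theta>. of_real (2 * R \<theta>) * cnj (cis \<theta>)) integrable_on {0..2*pi}" using I3 by blast
    show "(\<lambda>\<theta>. 4 * G \<theta> - 2 * R \<theta>) integrable_on {0..2*pi}"
      using G R0 by (intro integrable_diff integrable_on_cmult_left) auto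
    show "norm (of_real (2 * R \<theta>) * cnj (cis \<theta>)) \<le> 4 * G \<theta> - 2 * R \<theta>" if "\<theta> \<in> {0..2*pi}" for \<theta>
    proof -
      have "norm (of_real (2 * R \<theta>) * cnj (cis \<theta>)) = 2 * \<bar>R \<theta>\<bar>" by (simp add: norm_mult)
      thus ?thesis using le[OF that] G0[OF that] by (simp add: R_def)
    qed
  qed
  also have "\<dots> = 4 * integral {0..2*pi} G - 2 * integral {0..2*pi} R"
    using G R0 by (subst integral_diff) (auto intro: integrable_on_cmult_left)
  also have "integral {0..2*pi} R = 0" using R0 by (rule integral_unique)
  finally show ?thesis using s by (simp add: norm_mult mult_ac)
qed

section \<open>Strongly pseudoconvex domains\<close>

context C2_function
begin

lemma compact_bound_D:
  assumes "compact K" "K \<subseteq> U"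
  shows "\<exists>C\<ge>0. \<forall>x\<in>K. \<forall>v. \<bar>D x v\<bar> \<le> C * norm v"
proof -
  have "\<exists>c. \<forall>x\<in>K. \<bar>D x b\<bar> \<le> c" for b
  proof -
    have "compact ((\<lambda>x. D x b) ` K)"
      by (rule compact_continuous_image[OF continuous_on_subset[OF cont1 assms(2)] assms(1)])
    from compact_imp_bounded[OF this] show ?thesis unfolding bounded_iff by auto
  qed
  then obtain c where c: "\<And>b x. x \<in> K \<Longrightarrow> \<bar>D x b\<bar> \<le> c b" by metis
  show ?thesis
  proof (intro exI[of _ "\<Sum>b\<in>Basis. \<bar>c b\<bar>"] conjI ballI allI)
    fix x v assume x: "x \<in> K"
    have "\<bar>D x v\<bar> \<le> (\<Sum>b\<in>Basis. \<bar>(v \<bullet> b) * D x b\<bar>)"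
      using D_expand[of x v] x assms(2) sum_abs[of "\<lambda>b. (v \<bullet> b) * D x b" Basis] by auto
    also have "\<dots> \<le> (\<Sum>b\<in>Basis. norm v * \<bar>c b\<bar>)"
      unfolding abs_mult using c[OF x] by (intro sum_mono mult_mono) (auto simp: Basis_le_norm intro: order_trans[OF _ abs_ge_self])
    finally show "\<bar>D x v\<bar> \<le> (\<Sum>b\<in>Basis. \<bar>c b\<bar>) * norm v" by (simp add: sum_distrib_left mult.commute)
  qed (simp add: sum_nonneg)
qed

lemma compact_bound_H:
  assumes "compact K" "K \<subseteq> U"
  shows "\<exists>C\<ge>0. \<forall>x\<in>K. \<forall>u v. \<bar>H x u v\<bar> \<le> C * norm u * norm v"
proof -
  have "\<exists>c. \<forall>x\<in>K. \<bar>H x b b'\<bar> \<le> c" for b b'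
  proof -
    have "compact ((\<lambda>x. H x b b') ` K)"
      by (rule compact_continuous_image[OF continuous_on_subset[OF cont2 assms(2)] assms(1)])
    from compact_imp_bounded[OF this] show ?thesis unfolding bounded_iff by auto
  qed
  then obtain c where c: "\<And>b b' x. x \<in> K \<Longrightarrow> \<bar>H x b b'\<bar> \<le> c b b'" by metis
  show ?thesis
  proof (intro exI[of _ "\<Sum>b\<in>Basis. \<Sum>b'\<in>Basis. \<bar>c b b'\<bar>"] conjI ballI allI)
    fix x u v assume x: "x \<in> K"
    hence xU: "x \<in> U" using assms(2) by auto
    have "\<bar>H x u v\<bar> \<le> (\<Sum>b\<in>Basis. \<bar>\<Sum>b'\<in>Basis. (u \<bullet> b) * (v \<bullet> b') * H x b b'\<bar>)"
      unfolding H_expand[OF xU, of u v] by (rule sum_abs)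
    also have "\<dots> \<le> (\<Sum>b\<in>Basis. \<Sum>b'\<in>Basis. \<bar>(u \<bullet> b) * (v \<bullet> b') * H x b b'\<bar>)"
      by (intro sum_mono sum_abs)
    also have "\<dots> \<le> (\<Sum>b\<in>Basis. \<Sum>b'\<in>Basis. (norm u * norm v) * \<bar>c b b'\<bar>)"
      unfolding abs_mult using c[OF x] by (intro sum_mono mult_mono) (auto simp: Basis_le_norm intro: order_trans[OF _ abs_ge_self])
    finally show "\<bar>H x u v\<bar> \<le> (\<Sum>b\<in>Basis. \<Sum>b'\<in>Basis. \<bar>c b b'\<bar>) * norm u * norm v"
      by (simp add: sum_distrib_left mult.commute mult.left_commute)
  qed (simp add: sum_nonneg)
qed

text \<open>Both bounds come from the mean value inequality. For the second it is applied to
  \<open>g\<close> minus \<open>D z\<close> on the ball of radius |w - z|, where the derivative is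
  at most C |w - z| by the first.\<close>

lemma Taylor_bounds:
  assumes C: "\<And>x u v. x \<in> cball z r \<Longrightarrow> \<bar>H x u v\<bar> \<le> C * norm u * norm v" and sub: "cball z r \<subseteq> U"
    and w: "w \<in> cball z r" and C0: "C \<ge> 0"
  shows "\<bar>D w v - D z v\<bar> \<le> C * norm (w - z) * norm v"
    and "\<bar>g w - g z - D z (w - z)\<bar> \<le> C * (norm (w - z))\<^sup>2"
proof -
  have D_lip: "\<bar>D x v - D z v\<bar> \<le> C * norm (x - z) * norm v" if x: "x \<in> cball z r" for x v
  proof -
    have zc: "z \<in> cball z r" using x by (metis centre_in_cball dist_norm mem_cball norm_ge_zero order_trans)
    have "norm (D x v - D z v) \<le> (C * norm v) * norm (x - z)"
    proof (rule differentiable_bound[OF convex_cball, of z r "\<lambda>y. D y v" "\<lambda>y u. H y u v"])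
      show "((\<lambda>y. D y v) has_derivative (\<lambda>u. H y u v)) (at y within cball z r)" if "y \<in> cball z r" for y
        using der2[of y v] that sub has_derivative_at_withinI by blast
      show "onorm (\<lambda>u. H y u v) \<le> C * norm v" if "y \<in> cball z r" for y
        using C[OF that] C0 by (intro onorm_bound) (auto simp: mult_ac)
    qed (use x zc in auto)
    thus ?thesis by (simp add: mult_ac)
  qed
  show "\<bar>D w v - D z v\<bar> \<le> C * norm (w - z) * norm v" by (rule D_lip[OF w])
  define s where "s = norm (w - z)"
  have sr: "cball z s \<subseteq> cball z r" using w by (auto simp: s_def dist_norm norm_minus_commute)
  have "z \<in> cball z s" by (simp add: s_def)
  hence zc: "z \<in> U" using sr sub by blast
  have "norm ((g w - D z w) - (g z - D z z)) \<le> (C * s) * norm (w - z)"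
  proof (rule differentiable_bound[OF convex_cball, of z s "\<lambda>y. g y - D z y" "\<lambda>y u. D y u - D z u"])
    show "((\<lambda>y. g y - D z y) has_derivative (\<lambda>u. D y u - D z u)) (at y within cball z s)" if "y \<in> cball z s" for y
    proof -
      have "y \<in> U" using that sr sub by auto
      moreover have "bounded_linear (D z)" using der1[OF zc] by (rule has_derivative_bounded_linear)
      ultimately show ?thesis
        using has_derivative_diff[OF has_derivative_at_withinI[OF der1] bounded_linear_imp_has_derivative] by blast
    qed
    show "onorm (\<lambda>u. D y u - D z u) \<le> C * s" if y: "y \<in> cball z s" for y
    proof (rule onorm_bound)
      fix u
      have "\<bar>D y u - D z u\<bar> \<le> C * norm (y - z) * norm u" using D_lip y sr by blast
      also have "\<dots> \<le> C * s * norm u"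
        using y C0 by (intro mult_right_mono mult_left_mono) (auto simp: dist_norm norm_minus_commute)
      finally show "norm (D y u - D z u) \<le> C * s * norm u" by simp
    qed (use C0 in \<open>simp add: s_def\<close>)
  qed (auto simp: s_def dist_norm norm_minus_commute)
  thus "\<bar>g w - g z - D z (w - z)\<bar> \<le> C * (norm (w - z))\<^sup>2"
    by (simp add: s_def power2_eq_square mult.assoc linear_diff[OF linear_D[OF zc]] algebra_simps)
qed

end

lemma scalar_mult_decompose:
  "c *s v = Re c *\<^sub>R v + Im c *\<^sub>R (\<i> *s (v :: complex ^ 'n))"
  by (simp add: scaleR_eq_scalar_mult vec_eq_iff complex_eq_iff)

text \<open>\<open>H z v v + H z (\<i> *s v) (\<i> *s v)\<close> is four times the Levi form, namely
  the Laplacian of \<open>\<rho>\<close> along the complex line through \<open>z\<close> in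
  direction \<open>v\<close>. This real form is the one that the convexity of circular means calls
  for.\<close>

locale psh_domain = C2_function U \<rho> D H
  for U :: "(complex ^ 'n::finite) set" and \<rho> D H +
  fixes \<Omega> :: "(complex ^ 'n) set"
  assumes \<Omega>_open: "open \<Omega>" and \<Omega>_ne: "\<Omega> \<noteq> {}" and \<Omega>_bounded: "bounded \<Omega>" and closure_sub: "closure \<Omega> \<subseteq> U"
    and \<Omega>_eq: "\<Omega> = {z \<in> U. \<rho> z < 0}"
    and psh: "\<And>z v. z \<in> U \<Longrightarrow> v \<noteq> 0 \<Longrightarrow> 0 < H z v v + H z (\<i> *s v) (\<i> *s v)"
begin

text \<open>\<open>T z v = 2 \<partial>\<rho>(z) v\<close> is the complex linear functional with real part \<open>d\<rho>(z)\<close>.\<close>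

definition T :: "complex ^ 'n \<Rightarrow> complex ^ 'n \<Rightarrow> complex" where
  "T z v = complex_of_real (D z v) - \<i> * complex_of_real (D z (\<i> *s v))"

lemma \<Omega>_sub: "\<Omega> \<subseteq> U" using \<Omega>_eq by auto

lemma compact_closure: "compact (closure \<Omega>)"
  using \<Omega>_bounded by (simp add: compact_closure)

lemma T_add: "z \<in> U \<Longrightarrow> T z (v + w) = T z v + T z w"
  by (simp add: T_def linear_add[OF linear_D] vector_add_ldistrib algebra_simps)

lemma T_scale: assumes z: "z \<in> U" shows "T z (c *s v) = c * T z v"
proof -
  note L = linear_add[OF linear_D[OF z]] linear_scale[OF linear_D[OF z]] linear_neg[OF linear_D[OF z]]
  have 1: "D z (c *s v) = Re c * D z v + Im c * D z (\<i> *s v)"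
    by (subst scalar_mult_decompose) (simp add: L)
  have e: "\<i> *s (c *s v) = Re c *\<^sub>R (\<i> *s v) + Im c *\<^sub>R (- v)"
    by (simp add: scaleR_eq_scalar_mult vec_eq_iff complex_eq_iff)
  have 2: "D z (\<i> *s (c *s v)) = Re c * D z (\<i> *s v) - Im c * D z v"
    unfolding e by (simp only: L) simp
  show ?thesis unfolding T_def 1 2 by (simp add: complex_eq_iff algebra_simps)
qed

lemma Re_T: "Re (T z v) = D z v" by (simp add: T_def)

lemma T_sum: assumes z: "z \<in> U" shows "T z v = (\<Sum>i\<in>UNIV. v $ i * T z (axis i 1))"
proof -
  have T0: "T z 0 = 0" using T_scale[OF z, of 0 0] by simp
  have "T z (\<Sum>i\<in>I. (v $ i) *s axis i 1) = (\<Sum>i\<in>I. v $ i * T z (axis i 1))" if "finite I" for I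
    using that by (induction I) (auto simp: T0 T_add[OF z] T_scale[OF z])
  from this[of UNIV] show ?thesis by (simp add: basis_expansion)
qed

text \<open>Minimum over the compact product of \<open>closure \<Omega>\<close> and the unit sphere,
  extended by homogeneity of degree 2.\<close>

lemma strict_psh_bound: "\<exists>c>0. \<forall>z\<in>closure \<Omega>. \<forall>v. c * (norm v)\<^sup>2 \<le> H z v v + H z (\<i> *s v) (\<i> *s v)"
proof -
  define Q where "Q z v = H z v v + H z (\<i> *s v) (\<i> *s v)" for z v
  have smul: "continuous_on S (\<lambda>v::complex^'n. \<i> *s v)" for S
    unfolding vector_scalar_mult_def by (intro continuous_intros)
  have "continuous_on (closure \<Omega> \<times> sphere 0 1) (\<lambda>p. Q (fst p) (snd p))"
    unfolding Q_def using closure_sub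
    by (intro continuous_on_add continuous_H continuous_on_compose2[OF smul[of UNIV]] continuous_intros) auto
  moreover have "compact (closure \<Omega> \<times> sphere (0 :: complex ^ 'n) 1)" by (intro compact_Times compact_closure compact_sphere)
  moreover have "closure \<Omega> \<times> sphere (0 :: complex ^ 'n) 1 \<noteq> {}" using \<Omega>_ne by auto
  ultimately obtain p where p: "p \<in> closure \<Omega> \<times> sphere 0 1"
    "\<And>p'. p' \<in> closure \<Omega> \<times> sphere 0 1 \<Longrightarrow> Q (fst p) (snd p) \<le> Q (fst p') (snd p')"
    using continuous_attains_inf[of "closure \<Omega> \<times> sphere 0 1" "\<lambda>p. Q (fst p) (snd p)"] by blast
  define c where "c = Q (fst p) (snd p)"
  have "c > 0" unfolding c_def Q_def by (rule psh) (use p(1) closure_sub in auto)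
  moreover have "c * (norm v)\<^sup>2 \<le> Q z v" if z: "z \<in> closure \<Omega>" for z v
  proof (cases "v = 0")
    case True
    have zU: "z \<in> U" using z closure_sub by auto
    show ?thesis using True linear_0[OF linear_H2[OF zU, of 0]] by (simp add: Q_def)
  next
    case False
    define u where "u = (1 / norm v) *\<^sub>R v"
    have v: "v = norm v *\<^sub>R u" and u: "norm u = 1" using False by (auto simp: u_def)
    have zU: "z \<in> U" using z closure_sub by auto
    have iv: "\<i> *s v = norm v *\<^sub>R (\<i> *s u)" by (subst v) (simp add: scaleR_eq_scalar_mult vec_eq_iff)
    have "c \<le> Q z u" unfolding c_def using p(2)[of "(z, u)"] z u by simp
    hence "(norm v)\<^sup>2 * c \<le> (norm v)\<^sup>2 * Q z u" by (intro mult_left_mono) auto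
    also have "\<dots> = H z (norm v *\<^sub>R u) (norm v *\<^sub>R u) + H z (norm v *\<^sub>R (\<i> *s u)) (norm v *\<^sub>R (\<i> *s u))"
      by (simp add: Q_def linear_scale[OF linear_H2[OF zU]] linear_scale[OF linear_H1[OF zU]] power2_eq_square algebra_simps)
    also have "\<dots> = Q z v" unfolding Q_def by (simp only: v[symmetric] iv[symmetric])
    finally show ?thesis by (simp add: mult.commute)
  qed
  ultimately show ?thesis unfolding Q_def by blast
qed

text \<open>The constants live on a compact neighbourhood of \<open>closure \<Omega>\<close> inside
  \<open>U\<close>, because the segment from \<open>z\<close> to a nearby point may leave
  \<Omega>.\<close>

lemma uniform_constants:
  obtains d C where "d > 0" "C > 0"
    "\<And>z w. z \<in> \<Omega> \<Longrightarrow> norm (w - z) \<le> d \<Longrightarrow> w \<in> U"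
    "\<And>z w v. z \<in> \<Omega> \<Longrightarrow> norm (w - z) \<le> d \<Longrightarrow> \<bar>D w v - D z v\<bar> \<le> C * norm (w - z) * norm v"
    "\<And>z w. z \<in> \<Omega> \<Longrightarrow> norm (w - z) \<le> d \<Longrightarrow> \<bar>\<rho> w - \<rho> z - D z (w - z)\<bar> \<le> C * (norm (w - z))\<^sup>2"
    "\<And>z v. z \<in> \<Omega> \<Longrightarrow> \<bar>D z v\<bar> \<le> C * norm v"
proof -
  have cne: "closure \<Omega> \<noteq> {}" using \<Omega>_ne by simp
  obtain d where d: "d > 0" "{x. infdist x (closure \<Omega>) \<le> d} \<subseteq> U"
    using compact_in_open_separated[OF cne compact_closure open_U closure_sub] by blast
  define K where "K = {x. infdist x (closure \<Omega>) \<le> d}"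
  have Kc: "compact K"
  proof -
    have "closed K" unfolding K_def by (intro closed_Collect_le continuous_intros)
    moreover have "bounded K"
    proof -
      obtain a R where R: "closure \<Omega> \<subseteq> cball a R" using \<Omega>_bounded bounded_closure by (meson bounded_subset_cball)
      have "K \<subseteq> cball a (R + d)"
      proof
        fix x assume "x \<in> K"
        moreover obtain y where y: "y \<in> closure \<Omega>" "infdist x (closure \<Omega>) = dist x y"
          using infdist_attains_inf[OF closed_closure cne] by blast
        ultimately have "dist x y \<le> d" by (simp add: K_def)
        moreover have "dist a y \<le> R" using R y(1) by auto
        ultimately show "x \<in> cball a (R + d)" using dist_triangle[of a x y] by (simp add: dist_commute)
      qed
      thus ?thesis using bounded_cball bounded_subset by blast
    qed
    ultimately show ?thesis by (simp add: compact_eq_bounded_closed)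
  qed
  have KU: "K \<subseteq> U" using d by (simp add: K_def)
  have ball: "cball z d \<subseteq> K" if "z \<in> \<Omega>" for z
  proof
    fix x assume "x \<in> cball z d"
    moreover have "infdist x (closure \<Omega>) \<le> dist x z" using that closure_subset by (intro infdist_le) auto
    ultimately show "x \<in> K" by (simp add: K_def dist_commute)
  qed
  obtain C1 where C1: "C1 \<ge> 0" "\<And>x v. x \<in> K \<Longrightarrow> \<bar>D x v\<bar> \<le> C1 * norm v" using compact_bound_D[OF Kc KU] by blast
  obtain C2 where C2: "C2 \<ge> 0" "\<And>x u v. x \<in> K \<Longrightarrow> \<bar>H x u v\<bar> \<le> C2 * norm u * norm v" using compact_bound_H[OF Kc KU] by blast
  define C where "C = C1 + C2 + 1"
  have CH: "\<bar>H x u v\<bar> \<le> C * norm u * norm v" if "x \<in> K" for x u v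
  proof -
    have "C2 * norm u * norm v \<le> C * norm u * norm v" using C1 C2 by (intro mult_right_mono) (auto simp: C_def)
    thus ?thesis using C2(2)[OF that, of u v] by linarith
  qed
  have wc: "w \<in> cball z d" if "norm (w - z) \<le> d" for w z :: "complex ^ 'n"
    using that by (simp add: dist_norm norm_minus_commute)
  show thesis
  proof (rule that[of d C])
    show "d > 0" by fact
    show C0: "C > 0" using C1 C2 by (simp add: C_def)
    fix z v :: "complex ^ 'n" assume z: "z \<in> \<Omega>"
    have "z \<in> K" using ball[OF z] d by auto
    have "C1 * norm v \<le> C * norm v" using C2 by (intro mult_right_mono) (auto simp: C_def)
    thus "\<bar>D z v\<bar> \<le> C * norm v" using C1(2)[OF \<open>z \<in> K\<close>, of v] by linarith
    fix w assume w: "norm (w - z) \<le> d"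
    show "w \<in> U" using ball[OF z] KU wc[OF w] by blast
    have sub: "cball z d \<subseteq> U" using ball[OF z] KU by blast
    have CHz: "\<And>x u v. x \<in> cball z d \<Longrightarrow> \<bar>H x u v\<bar> \<le> C * norm u * norm v" using CH ball[OF z] by blast
    show "\<bar>D w v - D z v\<bar> \<le> C * norm (w - z) * norm v"
      by (rule Taylor_bounds(1)[OF CHz sub wc[OF w]]) (use C0 in auto)
    show "\<bar>\<rho> w - \<rho> z - D z (w - z)\<bar> \<le> C * (norm (w - z))\<^sup>2"
      by (rule Taylor_bounds(2)[OF CHz sub wc[OF w]]) (use C0 in auto)
  qed
qed

lemma C2_minus_square: "C2_function U (\<lambda>w. \<rho> w - c * (norm (w - z))\<^sup>2) (\<lambda>x v. D x v - 2 * c * ((x - z) \<bullet> v)) (\<lambda>x u v. H x u v - 2 * c * (u \<bullet> v))"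
proof
  show "open U" by (rule open_U)
  fix x v assume x: "x \<in> U"
  have "((\<lambda>w. \<rho> w - c * ((w - z) \<bullet> (w - z))) has_derivative (\<lambda>v. D x v - c * ((x - z) \<bullet> v + v \<bullet> (x - z)))) (at x)"
    by (auto intro!: derivative_eq_intros der1[OF x])
  thus "((\<lambda>w. \<rho> w - c * (norm (w - z))\<^sup>2) has_derivative (\<lambda>v. D x v - 2 * c * ((x - z) \<bullet> v))) (at x)"
    by (simp add: power2_norm_eq_inner inner_commute mult_ac)
  show "((\<lambda>y. D y v - 2 * c * ((y - z) \<bullet> v)) has_derivative (\<lambda>u. H x u v - 2 * c * (u \<bullet> v))) (at x)"
    by (auto intro!: derivative_eq_intros der2[OF x])
next
  fix u v
  show "continuous_on U (\<lambda>x. H x u v - 2 * c * (u \<bullet> v))" by (intro continuous_intros cont2)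
qed

text \<open>Plurisubharmonicity of \<open>\<rho> - c |\<sqdot> - z|\<^sup>2\<close> along the disc bounds the mean of \<open>|\<phi> - z|\<^sup>2\<close> by a multiple of
  \<open>- \<rho> z\<close>. Since \<open>Re (T z (\<phi> - z)) \<le> - \<rho> z + C |\<phi> - z|\<^sup>2\<close> by Taylor expansion of \<open>\<rho> < 0\<close>, the complex normal
  component is controlled by \<open>- \<rho> z\<close> itself.\<close>

lemma disc_derivative_bounds:
  "\<exists>C1 C2. C1 > 0 \<and> C2 > 0 \<and> (\<forall>z\<in>\<Omega>. \<forall>\<phi>. (\<forall>i. (\<lambda>\<zeta>. \<phi> \<zeta> $ i) holomorphic_on ball 0 1) \<longrightarrow> \<phi> ` ball 0 1 \<subseteq> \<Omega> \<longrightarrow> \<phi> 0 = z \<longrightarrow>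
     (\<forall>i. norm (deriv (\<lambda>\<zeta>. \<phi> \<zeta> $ i) 0) \<le> C1 * sqrt (- \<rho> z)) \<and>
     norm (T z (\<chi> i. deriv (\<lambda>\<zeta>. \<phi> \<zeta> $ i) 0)) \<le> C2 * (- \<rho> z))"
proof -
  obtain d C where d: "d > 0" "C > 0" and
    Tay: "\<And>z w. z \<in> \<Omega> \<Longrightarrow> norm (w - z) \<le> d \<Longrightarrow> \<bar>\<rho> w - \<rho> z - D z (w - z)\<bar> \<le> C * (norm (w - z))\<^sup>2" and
    DC: "\<And>z v. z \<in> \<Omega> \<Longrightarrow> \<bar>D z v\<bar> \<le> C * norm v"
    using uniform_constants by metis
  obtain c1 where c1: "c1 > 0" "\<And>z v. z \<in> closure \<Omega> \<Longrightarrow> c1 * (norm v)\<^sup>2 \<le> H z v v + H z (\<i> *s v) (\<i> *s v)"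
    using strict_psh_bound by blast
  \<comment> \<open>The directions \<open>v\<close> and \<open>\<i> *s v\<close> each subtract 2 c
    |v|^2 from the form, which therefore stays nonnegative.\<close>
  define c where "c = c1 / 4"
  have c: "c > 0" using c1 by (simp add: c_def)
  \<comment> \<open>The summand \<open>C / d\<close> covers points farther away than
    \<open>d\<close>, where the linear bound on \<open>D z\<close> is dominated by the square of the
    distance.\<close>
  define C5 where "C5 = C + C / d"
  have C5: "C5 > 0" using d by (simp add: C5_def add_pos_pos)
  have Dle: "D z (w - z) \<le> - \<rho> z + C5 * (norm (w - z))\<^sup>2" if z: "z \<in> \<Omega>" and w: "w \<in> \<Omega>" for z w
  proof (cases "norm (w - z) \<le> d")
    case True
    have "C * (norm (w - z))\<^sup>2 \<le> C5 * (norm (w - z))\<^sup>2" using d by (intro mult_right_mono) (auto simp: C5_def)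
    moreover have "\<rho> w < 0" using w \<Omega>_eq by auto
    ultimately show ?thesis using Tay[OF z True] by linarith
  next
    case False
    have "D z (w - z) \<le> C * norm (w - z)" using DC[OF z, of "w - z"] by linarith
    also have "\<dots> = C / d * (d * norm (w - z))" using d by simp
    also have "\<dots> \<le> C / d * (norm (w - z) * norm (w - z))" using False d by (intro mult_left_mono mult_right_mono) auto
    also have "\<dots> \<le> C5 * (norm (w - z))\<^sup>2" unfolding power2_eq_square using d by (intro mult_right_mono) (auto simp: C5_def)
    finally have "D z (w - z) \<le> C5 * (norm (w - z))\<^sup>2" .
    moreover have "\<rho> z < 0" using z \<Omega>_eq by auto
    ultimately show ?thesis by linarith
  qed
  show ?thesis
  proof (rule exI[of _ "4 * (1 + 1 / c)"], rule exI[of _ "8 * (1 + C5 / c)"], intro conjI ballI allI impI)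
    show "0 < 4 * (1 + 1 / c)" "0 < 8 * (1 + C5 / c)" using c C5 by (auto intro!: mult_pos_pos add_pos_pos)
    fix z and \<phi> :: "complex \<Rightarrow> complex ^ 'n"
    assume z: "z \<in> \<Omega>" and hol: "\<forall>i. (\<lambda>\<zeta>. \<phi> \<zeta> $ i) holomorphic_on ball 0 1" and im: "\<phi> ` ball 0 1 \<subseteq> \<Omega>" and \<phi>0: "\<phi> 0 = z"
    have zU: "z \<in> U" using z \<Omega>_sub by auto
    define \<delta> where "\<delta> = - \<rho> z"
    have \<delta>: "\<delta> > 0" using z \<Omega>_eq by (auto simp: \<delta>_def)
    define x where "x \<theta> = \<phi> (of_real (1/2) * cis \<theta>)" for \<theta>
    have x\<Omega>: "x \<theta> \<in> \<Omega>" for \<theta> using im by (auto simp: x_def norm_mult)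
    have xc: "continuous_on {0..2*pi} x"
    proof -
      have "continuous_on (ball 0 1) \<phi>"
        using continuous_on_vec_lambda[of "ball 0 1" "\<lambda>i \<zeta>. \<phi> \<zeta> $ i"] hol holomorphic_on_imp_continuous_on by auto
      thus ?thesis unfolding x_def
        by (rule continuous_on_compose2) (auto intro!: continuous_intros simp: norm_mult)
    qed
    define I where "I = integral {0..2*pi} (\<lambda>\<theta>. (norm (x \<theta> - z))\<^sup>2)"
    have Iint: "(\<lambda>\<theta>. (norm (x \<theta> - z))\<^sup>2) integrable_on {0..2*pi}"
      by (intro integrable_continuous_interval continuous_intros xc)
    have \<rho>int: "(\<lambda>\<theta>. \<rho> (x \<theta>)) integrable_on {0..2*pi}"
      by (intro integrable_continuous_interval continuous_on_compose2[OF continuous_g xc]) (use x\<Omega> \<Omega>_sub in auto)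
    have I: "I \<le> 2 * pi * \<delta> / c"
    proof -
      have "2 * pi * (\<rho> (\<phi> 0) - c * (norm (\<phi> 0 - z))\<^sup>2) \<le>
         integral {0..2*pi} (\<lambda>\<theta>. \<rho> (\<phi> (of_real (1/2) * cis \<theta>)) - c * (norm (\<phi> (of_real (1/2) * cis \<theta>) - z))\<^sup>2)"
      proof (rule circle_mean_ge_center[OF C2_minus_square, where \<Omega> = \<Omega> and B = 0])
        show "0 \<le> H x v v - 2 * c * (v \<bullet> v) + (H x (\<i> *s v) (\<i> *s v) - 2 * c * ((\<i> *s v) \<bullet> (\<i> *s v)))" if "x \<in> \<Omega>" for x v
          using c1(2)[of x v] that closure_subset[of \<Omega>]
          by (auto simp: power2_norm_eq_inner[symmetric] norm_scalar_mult c_def)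
        show "\<rho> x - c * (norm (x - z))\<^sup>2 \<le> 0" if "x \<in> \<Omega>" for x
        proof -
          have "\<rho> x < 0" using that \<Omega>_eq by auto
          moreover have "0 \<le> c * (norm (x - z))\<^sup>2" using c by simp
          ultimately show ?thesis by linarith
        qed
      qed (use hol im \<Omega>_sub in auto)
      also have "\<dots> = integral {0..2*pi} (\<lambda>\<theta>. \<rho> (x \<theta>)) - c * I"
      proof -
        have "(\<lambda>\<theta>. c * (norm (x \<theta> - z))\<^sup>2) integrable_on {0..2*pi}"
          by (intro integrable_continuous_interval continuous_intros xc)
        thus ?thesis unfolding x_def[symmetric] I_def using \<rho>int by (subst integral_diff) auto
      qed
      also have "integral {0..2*pi} (\<lambda>\<theta>. \<rho> (x \<theta>)) \<le> integral {0..2*pi} (\<lambda>\<theta>. 0)"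
        using x\<Omega> \<Omega>_eq by (intro integral_le \<rho>int) (auto intro: less_imp_le)
      finally have "c * I \<le> 2 * pi * \<delta>" using \<phi>0 by (simp add: \<delta>_def)
      thus ?thesis using c by (simp add: field_simps)
    qed
    have half: "(0::real) < 1/2" "(1/2::real) < 1" by auto
    show "norm (deriv (\<lambda>\<zeta>. \<phi> \<zeta> $ i) 0) \<le> 4 * (1 + 1 / c) * sqrt (- \<rho> z)" for i
    proof -
      define F where "F \<zeta> = \<phi> \<zeta> $ i - z $ i" for \<zeta>
      \<comment> \<open>AM-GM with weight \<open>sqrt \<delta>\<close> replaces the distance by its
        square, whose integral \<open>I\<close> is of order \<delta>; both terms then integrate to
        the order \<open>sqrt \<delta>\<close>.\<close>
      define G where "G \<theta> = (sqrt \<delta> + (norm (x \<theta> - z))\<^sup>2 / sqrt \<delta>) / 2" for \<theta>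
      have Fh: "F holomorphic_on ball 0 1" unfolding F_def using hol by (intro holomorphic_intros) auto
      have e: "deriv F 0 = deriv (\<lambda>\<zeta>. \<phi> \<zeta> $ i) 0"
      proof -
        have "((\<lambda>\<zeta>. \<phi> \<zeta> $ i) has_field_derivative deriv (\<lambda>\<zeta>. \<phi> \<zeta> $ i) 0) (at 0)"
          using hol by (intro holomorphic_derivI[of _ "ball 0 1"]) auto
        hence "(F has_field_derivative deriv (\<lambda>\<zeta>. \<phi> \<zeta> $ i) 0) (at 0)"
          unfolding F_def by (auto intro!: derivative_eq_intros)
        thus ?thesis by (rule DERIV_imp_deriv)
      qed
      have A: "2 * pi * (1/2) * norm (deriv F 0) \<le> 4 * integral {0..2*pi} G"
      proof (rule deriv_bound_Re[OF Fh _ half])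
        show "F 0 = 0" using \<phi>0 by (simp add: F_def)
        show "G integrable_on {0..2*pi}" unfolding G_def
          by (intro integrable_continuous_interval continuous_intros xc) (use \<delta> in auto)
        show "0 \<le> G \<theta>" for \<theta> using \<delta> by (simp add: G_def)
        show "Re (F (of_real (1/2) * cis \<theta>)) \<le> G \<theta>" for \<theta>
        proof -
          have "Re (F (of_real (1/2) * cis \<theta>)) \<le> norm ((x \<theta> - z) $ i)"
            using complex_Re_le_cmod[of "(x \<theta> - z) $ i"] by (simp add: F_def x_def)
          also have "\<dots> \<le> norm (x \<theta> - z)" by (rule Finite_Cartesian_Product.norm_nth_le)
          also have "\<dots> \<le> G \<theta>"
          proof -
            define n where "n = norm (x \<theta> - z)"
            have "0 \<le> (sqrt \<delta> - n)\<^sup>2" by simp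
            hence "2 * n * sqrt \<delta> \<le> sqrt \<delta> * sqrt \<delta> + n\<^sup>2" by (simp add: power2_eq_square algebra_simps)
            hence "2 * n * sqrt \<delta> / sqrt \<delta> \<le> (sqrt \<delta> * sqrt \<delta> + n\<^sup>2) / sqrt \<delta>" using \<delta> by (intro divide_right_mono) auto
            also have "\<dots> = sqrt \<delta> + n\<^sup>2 / sqrt \<delta>" using \<delta> by (simp add: add_divide_distrib real_div_sqrt)
            finally show ?thesis using \<delta> by (simp add: G_def n_def)
          qed
          finally show ?thesis .
        qed
      qed
      have Bd: "integral {0..2*pi} G \<le> pi * sqrt \<delta> * (1 + 1 / c)"
      proof -
        have "(G has_integral (2 * pi * sqrt \<delta> + I / sqrt \<delta>) / 2) {0..2*pi}"
          unfolding G_def I_def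
          using has_integral_divide[OF has_integral_add[OF has_integral_const_real[of "sqrt \<delta>" 0 "2*pi"] has_integral_divide[OF integrable_integral[OF Iint], of "sqrt \<delta>"]], of 2]
          by simp
        hence "integral {0..2*pi} G = (2 * pi * sqrt \<delta> + I / sqrt \<delta>) / 2" by (rule integral_unique)
        also have "\<dots> \<le> (2 * pi * sqrt \<delta> + (2 * pi * \<delta> / c) / sqrt \<delta>) / 2"
          using I \<delta> by (intro divide_right_mono add_left_mono) auto
        also have "(2 * pi * \<delta> / c) / sqrt \<delta> = 2 * pi * sqrt \<delta> / c"
          using \<delta> c real_sqrt_mult_self[of \<delta>] by (simp add: field_simps)
        also have "(2 * pi * sqrt \<delta> + 2 * pi * sqrt \<delta> / c) / 2 = pi * sqrt \<delta> * (1 + 1 / c)"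
          using c by (simp add: field_simps)
        finally show ?thesis .
      qed
      have "pi * norm (deriv (\<lambda>\<zeta>. \<phi> \<zeta> $ i) 0) \<le> 4 * (pi * sqrt \<delta> * (1 + 1 / c))"
        using A Bd unfolding e by linarith
      also have "\<dots> = pi * (4 * (1 + 1 / c) * sqrt \<delta>)" by simp
      finally show ?thesis unfolding \<delta>_def by (rule mult_left_le_imp_le) simp
    qed
    show "norm (T z (\<chi> i. deriv (\<lambda>\<zeta>. \<phi> \<zeta> $ i) 0)) \<le> 8 * (1 + C5 / c) * (- \<rho> z)"
    proof -
      define F where "F \<zeta> = T z (\<phi> \<zeta> - z)" for \<zeta>
      define G where "G \<theta> = \<delta> + C5 * (norm (x \<theta> - z))\<^sup>2" for \<theta>
      have Fe: "F = (\<lambda>\<zeta>. \<Sum>i\<in>UNIV. (\<phi> \<zeta> $ i - z $ i) * T z (axis i 1))"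
        by (simp add: F_def fun_eq_iff T_sum[OF zU, of "_ - _"])
      have Fh: "F holomorphic_on ball 0 1" unfolding Fe using hol by (intro holomorphic_intros) auto
      have "(F has_field_derivative (\<Sum>i\<in>UNIV. deriv (\<lambda>\<zeta>. \<phi> \<zeta> $ i) 0 * T z (axis i 1))) (at 0)"
        unfolding Fe
      proof (intro DERIV_sum)
        fix i
        have "((\<lambda>\<zeta>. \<phi> \<zeta> $ i) has_field_derivative deriv (\<lambda>\<zeta>. \<phi> \<zeta> $ i) 0) (at 0)"
          using hol by (intro holomorphic_derivI[of _ "ball 0 1"]) auto
        thus "((\<lambda>\<zeta>. (\<phi> \<zeta> $ i - z $ i) * T z (axis i 1)) has_field_derivative deriv (\<lambda>\<zeta>. \<phi> \<zeta> $ i) 0 * T z (axis i 1)) (at 0)"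
          by (auto intro!: derivative_eq_intros)
      qed
      hence e: "deriv F 0 = T z (\<chi> i. deriv (\<lambda>\<zeta>. \<phi> \<zeta> $ i) 0)"
        by (subst T_sum[OF zU]) (simp add: DERIV_imp_deriv)
      have A: "2 * pi * (1/2) * norm (deriv F 0) \<le> 4 * integral {0..2*pi} G"
      proof (rule deriv_bound_Re[OF Fh _ half])
        show "F 0 = 0" using \<phi>0 by (simp add: Fe)
        show "G integrable_on {0..2*pi}" unfolding G_def
          by (intro integrable_continuous_interval continuous_intros xc)
        show "0 \<le> G \<theta>" for \<theta> using \<delta> C5 by (simp add: G_def)
        show "Re (F (of_real (1/2) * cis \<theta>)) \<le> G \<theta>" for \<theta>
          using Dle[OF z x\<Omega>[of \<theta>]] by (simp add: F_def Re_T G_def \<delta>_def x_def)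
      qed
      have Bd: "integral {0..2*pi} G \<le> 2 * pi * \<delta> * (1 + C5 / c)"
      proof -
        have "(G has_integral (2 * pi * \<delta> + C5 * I)) {0..2*pi}"
          unfolding G_def I_def
          using has_integral_add[OF has_integral_const_real[of "\<delta>" 0 "2*pi"] has_integral_mult_right[OF integrable_integral[OF Iint], of C5]] by simp
        hence "integral {0..2*pi} G = 2 * pi * \<delta> + C5 * I" by (rule integral_unique)
        also have "\<dots> \<le> 2 * pi * \<delta> + C5 * (2 * pi * \<delta> / c)"
          using I C5 by (intro add_left_mono mult_left_mono) auto
        finally show ?thesis by (simp add: algebra_simps)
      qed
      have "pi * norm (T z (\<chi> i. deriv (\<lambda>\<zeta>. \<phi> \<zeta> $ i) 0)) \<le> 4 * (2 * pi * \<delta> * (1 + C5 / c))"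
        using A Bd unfolding e by linarith
      also have "\<dots> = pi * (8 * (1 + C5 / c) * \<delta>)" by simp
      finally show ?thesis unfolding \<delta>_def by (rule mult_left_le_imp_le) simp
    qed
  qed
qed

end

section \<open>The norm field of the domain and the lower bound for the Kobayashi metric\<close>

context psh_domain
begin

text \<open>The norm is realised through a linear map into a product, as the argument on curves
  requires; it is the Euclidean combination of an isotropic and a complex normal part. A large
  factor \<kappa> shrinks the unit balls until \<open>\<rho>\<close> and \<open>T\<close> vary
  slowly on them.\<close>

definition \<Lambda> :: "real \<Rightarrow> complex ^ 'n \<Rightarrow> complex ^ 'n \<Rightarrow> (complex ^ 'n) \<times> complex" where
  "\<Lambda> \<kappa> z v = ((\<kappa> / sqrt (- \<rho> z)) *\<^sub>R v, (\<kappa> / (- \<rho> z)) *\<^sub>R T z v)"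

lemma \<rho>_neg: "z \<in> \<Omega> \<Longrightarrow> \<rho> z < 0" using \<Omega>_eq by auto

lemma norm_\<Lambda>_ge:
  assumes "\<kappa> > 0" "z \<in> \<Omega>"
  shows "\<kappa> * (norm v / sqrt (- \<rho> z)) \<le> norm (\<Lambda> \<kappa> z v)" "\<kappa> * (norm (T z v) / (- \<rho> z)) \<le> norm (\<Lambda> \<kappa> z v)"
proof -
  have r: "\<rho> z < 0" by (rule \<rho>_neg[OF assms(2)])
  show "\<kappa> * (norm v / sqrt (- \<rho> z)) \<le> norm (\<Lambda> \<kappa> z v)"
    using norm_fst_le[of "(\<kappa> / sqrt (- \<rho> z)) *\<^sub>R v" "(\<kappa> / (- \<rho> z)) *\<^sub>R T z v"] assms(1) r by (simp add: \<Lambda>_def)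
  show "\<kappa> * (norm (T z v) / (- \<rho> z)) \<le> norm (\<Lambda> \<kappa> z v)"
    using norm_snd_le[of "(\<kappa> / (- \<rho> z)) *\<^sub>R T z v" "(\<kappa> / sqrt (- \<rho> z)) *\<^sub>R v"] assms(1) r by (simp add: \<Lambda>_def abs_div_pos)
qed

lemma norm_\<Lambda>_le:
  assumes "\<kappa> > 0" "z \<in> \<Omega>"
  shows "norm (\<Lambda> \<kappa> z v) \<le> \<kappa> * (norm v / sqrt (- \<rho> z) + norm (T z v) / (- \<rho> z))"
proof -
  have r: "\<rho> z < 0" by (rule \<rho>_neg[OF assms(2)])
  have "norm (\<Lambda> \<kappa> z v) \<le> norm ((\<kappa> / sqrt (- \<rho> z)) *\<^sub>R v) + norm ((\<kappa> / (- \<rho> z)) *\<^sub>R T z v)"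
    unfolding \<Lambda>_def by (rule norm_Pair_le)
  also have "\<dots> = \<kappa> * (norm v / sqrt (- \<rho> z) + norm (T z v) / (- \<rho> z))"
    using assms(1) r by (simp add: right_diff_distrib abs_div_pos)
  finally show ?thesis .
qed

lemma linear_\<Lambda>: assumes z: "z \<in> \<Omega>" shows "linear (\<Lambda> \<kappa> z)"
proof (rule linearI)
  have zU: "z \<in> U" using z \<Omega>_sub by auto
  show "\<Lambda> \<kappa> z (v + w) = \<Lambda> \<kappa> z v + \<Lambda> \<kappa> z w" for v w
    by (simp add: \<Lambda>_def T_add[OF zU] scaleR_add_right)
  show "\<Lambda> \<kappa> z (r *\<^sub>R v) = r *\<^sub>R \<Lambda> \<kappa> z v" for r v
  proof -
    have "T z (r *\<^sub>R v) = r *\<^sub>R T z v" by (simp add: scaleR_eq_scalar_mult T_scale[OF zU] scaleR_conv_of_real)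
    thus ?thesis by (simp add: \<Lambda>_def)
  qed
qed

lemma bounded_linear_\<Lambda>: "z \<in> \<Omega> \<Longrightarrow> bounded_linear (\<Lambda> \<kappa> z)"
  using linear_\<Lambda> linear_conv_bounded_linear by blast

lemma complex_norm_\<Lambda>: assumes \<kappa>: "\<kappa> > 0" and z: "z \<in> \<Omega>" shows "complex_norm (\<lambda>v. norm (\<Lambda> \<kappa> z v))"
proof
  have zU: "z \<in> U" using z \<Omega>_sub by auto
  show "norm (\<Lambda> \<kappa> z (v + w)) \<le> norm (\<Lambda> \<kappa> z v) + norm (\<Lambda> \<kappa> z w)" for v w
    by (simp add: linear_add[OF linear_\<Lambda>[OF z]] norm_triangle_ineq)
  show "norm (\<Lambda> \<kappa> z (c *s v)) = norm c * norm (\<Lambda> \<kappa> z v)" for c v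
  proof -
    have 1: "norm ((\<kappa> / sqrt (- \<rho> z)) *\<^sub>R (c *s v)) = norm c * norm ((\<kappa> / sqrt (- \<rho> z)) *\<^sub>R v)"
      by (simp add: norm_scalar_mult)
    have 2: "norm ((\<kappa> / (- \<rho> z)) *\<^sub>R T z (c *s v)) = norm c * norm ((\<kappa> / (- \<rho> z)) *\<^sub>R T z v)"
      by (simp add: T_scale[OF zU] norm_mult)
    show ?thesis
      unfolding \<Lambda>_def norm_Pair 1 2 power_mult_distrib distrib_left[symmetric] real_sqrt_mult by simp
  qed
  show "\<exists>c. \<forall>v. norm v \<le> c * norm (\<Lambda> \<kappa> z v)"
  proof (intro exI[of _ "sqrt (- \<rho> z) / \<kappa>"] allI)
    fix v
    show "norm v \<le> sqrt (- \<rho> z) / \<kappa> * norm (\<Lambda> \<kappa> z v)"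
      using norm_\<Lambda>_ge(1)[OF \<kappa> z, of v] \<rho>_neg[OF z] \<kappa> by (simp add: field_simps)
  qed
  show "\<exists>c. \<forall>v. norm (\<Lambda> \<kappa> z v) \<le> c * norm v"
    using bounded_linear.bounded[OF bounded_linear_\<Lambda>[OF z]] by (metis mult.commute)
qed

lemma continuous_norm_\<Lambda>: "continuous_on (\<Omega> \<times> UNIV) (\<lambda>p. norm (\<Lambda> \<kappa> (fst p) (snd p)))"
proof -
  have smul: "continuous_on S (\<lambda>v::complex^'n. \<i> *s v)" for S
    unfolding vector_scalar_mult_def by (intro continuous_intros)
  have \<rho>c: "continuous_on (\<Omega> \<times> UNIV) (\<lambda>p. \<rho> (fst p))"
    by (rule continuous_on_compose2[OF continuous_g]) (use \<Omega>_sub in \<open>auto intro!: continuous_intros\<close>)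
  have nz: "\<forall>p\<in>\<Omega> \<times> UNIV. \<rho> (fst p) \<noteq> 0" using \<rho>_neg by force
  have Tc: "continuous_on (\<Omega> \<times> UNIV) (\<lambda>p. T (fst p) (snd p))"
    unfolding T_def
    by (intro continuous_intros continuous_D continuous_on_compose2[OF smul[of UNIV]]) (use \<Omega>_sub in auto)
  show ?thesis unfolding \<Lambda>_def
    by (intro continuous_intros \<rho>c Tc) (use nz in auto)
qed

text \<open>The change of \<open>T\<close> is at most a multiple of \<open>sqrt (- \<rho> a)\<close>
  times |v|; divided by \<open>- \<rho> a\<close> it is a multiple of the isotropic component. This
  is why the isotropic scale is the square root. The constant 12 is 10 for the isotropic plus 2 for
  the normal component, and the factor 2 in the bound on \<open>k\<close> permits interchanging the
  two points.\<close>

lemma \<Lambda>_compare: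
  assumes \<kappa>: "\<kappa> > 0" and a: "a \<in> \<Omega>" and b: "b \<in> \<Omega>" and ab: "- \<rho> a \<le> 2 * (- \<rho> b)"
    and T: "norm (T b v - T a v) \<le> 2 * k * norm v" and k: "k \<le> 2 * sqrt (- \<rho> a)"
  shows "norm (\<Lambda> \<kappa> b v) \<le> 12 * norm (\<Lambda> \<kappa> a v)"
proof -
  define r s where "r = - \<rho> a" and "s = - \<rho> b"
  have r: "r > 0" and s: "s > 0" using \<rho>_neg[OF a] \<rho>_neg[OF b] by (auto simp: r_def s_def)
  have rs: "r \<le> 2 * s" using ab by (simp add: r_def s_def)
  have sr: "sqrt r * sqrt r = r" using r by simp
  have "sqrt r \<le> sqrt (4 * s)" using rs s by (intro real_sqrt_le_mono) auto
  hence "sqrt r \<le> 2 * sqrt s" by (simp add: real_sqrt_mult)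
  hence 1: "norm v / sqrt s \<le> 2 * (norm v / sqrt r)"
    using r s mult_left_mono[of "sqrt r" "2 * sqrt s" "norm v"] by (simp add: field_simps)
  have "norm (T b v) \<le> norm (T a v) + norm (T b v - T a v)" using norm_triangle_sub[of "T b v" "T a v"] by simp
  also have "\<dots> \<le> norm (T a v) + 4 * sqrt r * norm v"
    using T mult_right_mono[OF k, of "norm v"] by (simp add: r_def)
  finally have "norm (T b v) / s \<le> (norm (T a v) + 4 * sqrt r * norm v) / s" using s by (intro divide_right_mono) auto
  also have "\<dots> \<le> (norm (T a v) + 4 * sqrt r * norm v) / (r / 2)"
    using r s rs by (intro divide_left_mono) auto
  also have "\<dots> = 2 * (norm (T a v) / r) + 8 * (norm v / sqrt r)"
  proof -
    have "sqrt r * norm v / r = norm v / sqrt r" using r sr by (simp add: field_simps)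
    moreover have "(norm (T a v) + 4 * sqrt r * norm v) / (r / 2) = 2 * (norm (T a v) / r) + 8 * (sqrt r * norm v / r)"
      using r by (simp add: field_simps)
    ultimately show ?thesis by (simp only:)
  qed
  finally have 2: "norm (T b v) / s \<le> 2 * (norm (T a v) / r) + 8 * (norm v / sqrt r)" .
  have "norm (\<Lambda> \<kappa> b v) \<le> \<kappa> * (norm v / sqrt s + norm (T b v) / s)" unfolding s_def by (rule norm_\<Lambda>_le[OF \<kappa> b])
  also have "\<dots> \<le> \<kappa> * (10 * (norm v / sqrt r) + 2 * (norm (T a v) / r))" using 1 2 \<kappa> by (intro mult_left_mono) auto
  also have "\<dots> = 10 * (\<kappa> * (norm v / sqrt r)) + 2 * (\<kappa> * (norm (T a v) / r))" by (simp add: algebra_simps)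
  also have "\<dots> \<le> 10 * norm (\<Lambda> \<kappa> a v) + 2 * norm (\<Lambda> \<kappa> a v)"
    unfolding r_def by (intro add_mono mult_left_mono norm_\<Lambda>_ge \<kappa> a) auto
  finally show ?thesis by simp
qed

lemma complex_norm_field_\<Lambda>:
  "\<exists>\<kappa>>0. complex_norm_field \<Omega> (\<lambda>z v. norm (\<Lambda> \<kappa> z v)) (\<lambda>z. - \<rho> z) 12"
proof -
  obtain d C where d: "d > 0" "C > 0" and
    inU: "\<And>z w. z \<in> \<Omega> \<Longrightarrow> norm (w - z) \<le> d \<Longrightarrow> w \<in> U" and
    Lip: "\<And>z w v. z \<in> \<Omega> \<Longrightarrow> norm (w - z) \<le> d \<Longrightarrow> \<bar>D w v - D z v\<bar> \<le> C * norm (w - z) * norm v" and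
    Tay: "\<And>z w. z \<in> \<Omega> \<Longrightarrow> norm (w - z) \<le> d \<Longrightarrow> \<bar>\<rho> w - \<rho> z - D z (w - z)\<bar> \<le> C * (norm (w - z))\<^sup>2"
    using uniform_constants by metis
  have "compact (\<rho> ` closure \<Omega>)"
    by (rule compact_continuous_image[OF continuous_on_subset[OF continuous_g closure_sub] compact_closure])
  from compact_imp_bounded[OF this] obtain C0 where C0: "\<And>z. z \<in> closure \<Omega> \<Longrightarrow> \<bar>\<rho> z\<bar> \<le> C0"
    unfolding bounded_iff by auto
  have \<rho>C0: "- \<rho> z \<le> C0" if "z \<in> \<Omega>" for z using C0[of z] that closure_subset by force
  have C0pos: "C0 > 0" using \<rho>C0 \<rho>_neg \<Omega>_ne by force
  \<comment> \<open>1/4 bounds the change of \<open>\<rho>\<close> by half of its modulus at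
    \<open>z\<close>, \<open>d / sqrt C0\<close> keeps the unit ball within the range of the Taylor
    bounds, and \<open>1 / C\<close> makes the quadratic Taylor term as small as the linear
    one.\<close>
  define \<epsilon> where "\<epsilon> = min (1/4) (min (d / sqrt C0) (1 / C))"
  have \<epsilon>: "\<epsilon> > 0" "\<epsilon> \<le> 1/4" "\<epsilon> * sqrt C0 \<le> d" "C * \<epsilon> \<le> 1"
  proof -
    show "\<epsilon> > 0" using d C0pos by (simp add: \<epsilon>_def)
    show "\<epsilon> \<le> 1/4" unfolding \<epsilon>_def by (rule min.cobounded1)
    have "\<epsilon> \<le> d / sqrt C0" "\<epsilon> \<le> 1 / C" by (auto simp: \<epsilon>_def)
    thus "\<epsilon> * sqrt C0 \<le> d" "C * \<epsilon> \<le> 1" using d C0pos by (simp_all add: field_simps)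
  qed
  define \<kappa> where "\<kappa> = 1 / \<epsilon>"
  have \<kappa>: "\<kappa> > 0" using \<epsilon> by (simp add: \<kappa>_def)
  have key: "w \<in> \<Omega> \<and> - \<rho> w \<le> 2 * (- \<rho> z) \<and> - \<rho> z \<le> 2 * (- \<rho> w) \<and>
      (\<forall>v. norm (T w v - T z v) \<le> 2 * (C * norm (w - z)) * norm v) \<and> C * norm (w - z) \<le> sqrt (- \<rho> z)"
    if z: "z \<in> \<Omega>" and N: "norm (\<Lambda> \<kappa> z (w - z)) < 1" for z w
  proof -
    define r where "r = - \<rho> z"
    have r: "r > 0" using \<rho>_neg[OF z] by (simp add: r_def)
    have "\<kappa> * (norm (w - z) / sqrt r) < 1" using norm_\<Lambda>_ge(1)[OF \<kappa> z, of "w - z"] N by (simp add: r_def)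
    hence 1: "norm (w - z) < \<epsilon> * sqrt r" using r \<epsilon> by (simp add: \<kappa>_def field_simps)
    have "\<kappa> * (norm (T z (w - z)) / r) < 1" using norm_\<Lambda>_ge(2)[OF \<kappa> z, of "w - z"] N by (simp add: r_def)
    hence 2: "norm (T z (w - z)) < \<epsilon> * r" using r \<epsilon> by (simp add: \<kappa>_def field_simps)
    have "sqrt r \<le> sqrt C0" using \<rho>C0[OF z] by (simp add: r_def)
    hence "\<epsilon> * sqrt r \<le> \<epsilon> * sqrt C0" using \<epsilon> by (intro mult_left_mono) auto
    hence wd: "norm (w - z) \<le> d" using 1 \<epsilon>(3) by linarith
    have "(norm (w - z))\<^sup>2 \<le> (\<epsilon> * sqrt r)\<^sup>2" using 1 by (intro power_mono) auto
    also have "\<dots> = \<epsilon> * \<epsilon> * r" using r by (simp add: power_mult_distrib power2_eq_square)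
    finally have "C * (norm (w - z))\<^sup>2 \<le> (C * \<epsilon>) * (\<epsilon> * r)" using d mult_left_mono[of _ _ C] by (simp add: mult_ac)
    also have "\<dots> \<le> 1 * (\<epsilon> * r)" using \<epsilon> r by (intro mult_right_mono) auto
    finally have 3: "C * (norm (w - z))\<^sup>2 \<le> \<epsilon> * r" by simp
    have 4: "\<epsilon> * r \<le> r / 4" using \<epsilon>(2) r mult_right_mono[of \<epsilon> "1/4" r] by simp
    have "\<bar>D z (w - z)\<bar> \<le> norm (T z (w - z))" using abs_Re_le_cmod[of "T z (w - z)"] by (simp add: Re_T)
    hence "\<bar>\<rho> w - \<rho> z\<bar> \<le> r / 2" using Tay[OF z wd] 2 3 4 by linarith
    hence 5: "\<bar>\<rho> w + r\<bar> \<le> r / 2" by (simp add: r_def)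
    hence "\<rho> w < 0" using r by linarith
    hence w: "w \<in> \<Omega>" using inU[OF z wd] \<Omega>_eq by auto
    have "norm (T w v - T z v) \<le> 2 * (C * norm (w - z)) * norm v" for v
    proof -
      have "T w v - T z v = of_real (D w v - D z v) - \<i> * of_real (D w (\<i> *s v) - D z (\<i> *s v))"
        by (simp add: T_def algebra_simps)
      also have "norm \<dots> \<le> \<bar>D w v - D z v\<bar> + \<bar>D w (\<i> *s v) - D z (\<i> *s v)\<bar>"
        by (rule order_trans[OF norm_triangle_ineq4]) (simp add: norm_mult del: of_real_diff)
      also have "\<dots> \<le> C * norm (w - z) * norm v + C * norm (w - z) * norm v"
      proof -
        have "norm (\<i> *s v) = norm v" by (simp add: norm_scalar_mult)
        thus ?thesis using Lip[OF z wd, of v] Lip[OF z wd, of "\<i> *s v"] by (intro add_mono) simp_all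
      qed
      finally show ?thesis by (simp add: algebra_simps)
    qed
    moreover have "C * norm (w - z) \<le> sqrt r"
    proof -
      have "C * norm (w - z) \<le> C * (\<epsilon> * sqrt r)" using 1 d by (intro mult_left_mono) auto
      also have "\<dots> \<le> 1 * sqrt r" using \<epsilon> r unfolding mult.assoc[symmetric] by (intro mult_right_mono) auto
      finally show ?thesis by simp
    qed
    ultimately show ?thesis using w 5 r unfolding r_def by (auto simp: abs_le_iff)
  qed
  have "complex_norm_field \<Omega> (\<lambda>z v. norm (\<Lambda> \<kappa> z v)) (\<lambda>z. - \<rho> z) 12"
  proof (rule complex_norm_field.intro)
    show "open \<Omega>" by (rule \<Omega>_open)
    show "complex_norm (\<lambda>v. norm (\<Lambda> \<kappa> z v))" if "z \<in> \<Omega>" for z using complex_norm_\<Lambda>[OF \<kappa> that] .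
    show "continuous_on (\<Omega> \<times> UNIV) (\<lambda>p. norm (\<Lambda> \<kappa> (fst p) (snd p)))" by (rule continuous_norm_\<Lambda>)
    show "0 < - \<rho> z" if "z \<in> \<Omega>" for z using \<rho>_neg[OF that] by simp
    show "continuous_on \<Omega> (\<lambda>z. - \<rho> z)" by (intro continuous_intros continuous_on_subset[OF continuous_g \<Omega>_sub])
    show "(1::real) \<le> 12" by simp
    fix z w v assume z: "z \<in> \<Omega>" and N: "norm (\<Lambda> \<kappa> z (w - z)) < 1"
    note k = key[OF z N]
    show "w \<in> \<Omega>" using k by blast
    show "- \<rho> w \<le> 12 * - \<rho> z \<and> - \<rho> z \<le> 12 * - \<rho> w"
    proof -
      have "w \<in> \<Omega>" "- \<rho> w \<le> 2 * (- \<rho> z)" "- \<rho> z \<le> 2 * (- \<rho> w)" using k by blast+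
      thus ?thesis using \<rho>_neg[OF z] \<rho>_neg[of w] by linarith
    qed
    have w: "w \<in> \<Omega>" and le1: "- \<rho> w \<le> 2 * (- \<rho> z)" and le2: "- \<rho> z \<le> 2 * (- \<rho> w)"
      and T1: "norm (T w v - T z v) \<le> 2 * (C * norm (w - z)) * norm v" and s1: "C * norm (w - z) \<le> sqrt (- \<rho> z)"
      using k by blast+
    have z0: "0 \<le> sqrt (- \<rho> z)" using \<rho>_neg[OF z] by simp
    have "sqrt (- \<rho> z) \<le> sqrt (4 * (- \<rho> w))" using le2 \<rho>_neg[OF w] by (intro real_sqrt_le_mono) auto
    also have "\<dots> = 2 * sqrt (- \<rho> w)" unfolding real_sqrt_mult by simp
    finally have s2: "sqrt (- \<rho> z) \<le> 2 * sqrt (- \<rho> w)" .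
    show "norm (\<Lambda> \<kappa> w v) \<le> 12 * norm (\<Lambda> \<kappa> z v) \<and> norm (\<Lambda> \<kappa> z v) \<le> 12 * norm (\<Lambda> \<kappa> w v)"
    proof
      show "norm (\<Lambda> \<kappa> w v) \<le> 12 * norm (\<Lambda> \<kappa> z v)"
        by (rule \<Lambda>_compare[OF \<kappa> z w le2 T1]) (use s1 z0 in linarith)
      show "norm (\<Lambda> \<kappa> z v) \<le> 12 * norm (\<Lambda> \<kappa> w v)"
        by (rule \<Lambda>_compare[OF \<kappa> w z le1 T1[unfolded norm_minus_commute[of "T w v"]]]) (use s1 s2 in linarith)
    qed
  qed
  thus ?thesis using \<kappa> by blast
qed

text \<open>For every competing disc the derivative \<open>v\<close> at 0 has norm at most
  \<open>k\<close> by \<open>disc_derivative_bounds\<close>, and \<xi> = \<alpha> v; so each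
  admissible \<alpha> is at least the norm of \<xi> divided by \<open>k\<close>.\<close>

lemma kobayashi_metric_ge:
  assumes \<kappa>: "\<kappa> > 0"
  shows "\<exists>c>0. \<forall>z\<in>\<Omega>. \<forall>\<xi>. c * norm (\<Lambda> \<kappa> z \<xi>) \<le> kobayashi_metric \<Omega> z \<xi>"
proof -
  obtain C1 C2 where C: "C1 > 0" "C2 > 0" and
    bd: "\<forall>z\<in>\<Omega>. \<forall>\<phi>. (\<forall>i. (\<lambda>\<zeta>. \<phi> \<zeta> $ i) holomorphic_on ball 0 1) \<longrightarrow> \<phi> ` ball 0 1 \<subseteq> \<Omega> \<longrightarrow> \<phi> 0 = z \<longrightarrow>
     (\<forall>i. norm (deriv (\<lambda>\<zeta>. \<phi> \<zeta> $ i) 0) \<le> C1 * sqrt (- \<rho> z)) \<and>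
     norm (T z (\<chi> i. deriv (\<lambda>\<zeta>. \<phi> \<zeta> $ i) 0)) \<le> C2 * (- \<rho> z)"
    using disc_derivative_bounds by (elim exE conjE)
  define k where "k = \<kappa> * (real CARD('n) * C1 + C2)"
  have k: "k > 0" using \<kappa> C by (simp add: k_def add_nonneg_pos)
  show ?thesis
  proof (intro exI[of _ "1 / k"] conjI ballI allI)
    show "0 < 1 / k" using k by simp
    fix z \<xi> assume z: "z \<in> \<Omega>"
    interpret N: complex_norm "\<lambda>v. norm (\<Lambda> \<kappa> z v)" by (rule complex_norm_\<Lambda>[OF \<kappa> z])
    have r: "- \<rho> z > 0" using \<rho>_neg[OF z] by simp
    define S where "S = {\<alpha>. \<alpha> > 0 \<and> (\<exists>\<phi> :: complex \<Rightarrow> complex ^ 'n.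
          (\<forall>i. (\<lambda>\<zeta>. \<phi> \<zeta> $ i) holomorphic_on ball 0 1) \<and> \<phi> ` ball 0 1 \<subseteq> \<Omega> \<and>
          \<phi> 0 = z \<and> (\<forall>i. deriv (\<lambda>\<zeta>. \<phi> \<zeta> $ i) 0 = \<xi> $ i / complex_of_real \<alpha>))}"
    \<comment> \<open>A lower bound passes to \<open>Inf\<close> on the reals only for a nonempty
      set; an affine disc in a Euclidean ball inside \<Omega> is a witness.\<close>
    have "S \<noteq> {}"
    proof -
      obtain e where e: "e > 0" "ball z e \<subseteq> \<Omega>" using \<Omega>_open z open_contains_ball by blast
      define \<alpha> where "\<alpha> = (norm \<xi> + 1) / e"
      have \<alpha>: "\<alpha> > 0" "norm \<xi> / \<alpha> < e"
      proof -
        show "\<alpha> > 0" using e by (simp add: \<alpha>_def add_nonneg_pos)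
        have "norm \<xi> / \<alpha> = e * (norm \<xi> / (norm \<xi> + 1))" by (simp add: \<alpha>_def)
        also have "\<dots> < e * 1" using e by (intro mult_strict_left_mono) (auto simp: divide_less_eq add_nonneg_pos)
        finally show "norm \<xi> / \<alpha> < e" by simp
      qed
      have "\<alpha> \<in> S" unfolding S_def
      proof (intro CollectI conjI exI[of _ "\<lambda>\<zeta>. z + (\<zeta> / of_real \<alpha>) *s \<xi>"] allI)
        fix i
        show "(\<lambda>\<zeta>. (z + (\<zeta> / of_real \<alpha>) *s \<xi>) $ i) holomorphic_on ball 0 1"
          using \<alpha> by (auto intro!: holomorphic_intros)
        have "((\<lambda>\<zeta>. (z + (\<zeta> / of_real \<alpha>) *s \<xi>) $ i) has_field_derivative \<xi> $ i / of_real \<alpha>) (at 0)"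
          using \<alpha>(1) by (auto intro!: derivative_eq_intros)
        thus "deriv (\<lambda>\<zeta>. (z + (\<zeta> / of_real \<alpha>) *s \<xi>) $ i) 0 = \<xi> $ i / of_real \<alpha>" by (rule DERIV_imp_deriv)
        show "(\<lambda>\<zeta>. z + (\<zeta> / of_real \<alpha>) *s \<xi>) ` ball 0 1 \<subseteq> \<Omega>"
        proof
          fix x assume "x \<in> (\<lambda>\<zeta>. z + (\<zeta> / of_real \<alpha>) *s \<xi>) ` ball 0 1"
          then obtain \<zeta> where \<zeta>: "norm \<zeta> < 1" "x = z + (\<zeta> / of_real \<alpha>) *s \<xi>" by auto
          have "norm (x - z) = norm \<zeta> * (norm \<xi> / \<alpha>)" using \<alpha> by (simp add: \<zeta>(2) norm_scalar_mult norm_divide)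
          also have "\<dots> \<le> 1 * (norm \<xi> / \<alpha>)" using \<zeta>(1) \<alpha> by (intro mult_right_mono) auto
          finally show "x \<in> \<Omega>" using \<alpha>(2) e(2) by (auto simp: dist_norm norm_minus_commute)
        qed
      qed (use \<alpha> in auto)
      thus ?thesis by auto
    qed
    moreover have "1 / k * norm (\<Lambda> \<kappa> z \<xi>) \<le> \<alpha>" if \<alpha>S: "\<alpha> \<in> S" for \<alpha>
    proof -
      obtain \<phi> :: "complex \<Rightarrow> complex ^ 'n" where \<alpha>: "\<alpha> > 0" and \<phi>: "\<forall>i. (\<lambda>\<zeta>. \<phi> \<zeta> $ i) holomorphic_on ball 0 1" "\<phi> ` ball 0 1 \<subseteq> \<Omega>"
          "\<phi> 0 = z" "\<forall>i. deriv (\<lambda>\<zeta>. \<phi> \<zeta> $ i) 0 = \<xi> $ i / complex_of_real \<alpha>"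
        using \<alpha>S unfolding S_def by blast
      define v where "v = (\<chi> i. deriv (\<lambda>\<zeta>. \<phi> \<zeta> $ i) 0)"
      note b = bd[THEN bspec, OF z, THEN spec, THEN mp, OF \<phi>(1), THEN mp, OF \<phi>(2), THEN mp, OF \<phi>(3)]
      have "norm v \<le> (\<Sum>i\<in>UNIV. norm (v $ i))" unfolding norm_vec_def by (rule L2_set_le_sum) simp
      also have "\<dots> \<le> (\<Sum>i\<in>(UNIV::'n set). C1 * sqrt (- \<rho> z))" using b by (intro sum_mono) (simp add: v_def)
      finally have "norm v / sqrt (- \<rho> z) \<le> real CARD('n) * C1" using r by (simp add: divide_le_eq)
      moreover have "norm (T z v) / (- \<rho> z) \<le> C2" unfolding pos_divide_le_eq[OF r] using b by (simp add: v_def)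
      ultimately have "\<kappa> * (norm v / sqrt (- \<rho> z) + norm (T z v) / (- \<rho> z)) \<le> k"
        unfolding k_def using \<kappa> by (intro mult_left_mono add_mono) auto
      hence vk: "norm (\<Lambda> \<kappa> z v) \<le> k" using norm_\<Lambda>_le[OF \<kappa> z, of v] by linarith
      have "\<xi> = of_real \<alpha> *s v" using \<phi>(4) \<alpha> by (simp add: v_def vec_eq_iff)
      hence "norm (\<Lambda> \<kappa> z \<xi>) = \<alpha> * norm (\<Lambda> \<kappa> z v)" using N.scale[of "of_real \<alpha>" v] \<alpha> by simp
      also have "\<dots> \<le> \<alpha> * k" using vk \<alpha> by (intro mult_left_mono) auto
      finally show ?thesis using k by (simp add: field_simps)
    qed
    ultimately have "1 / k * norm (\<Lambda> \<kappa> z \<xi>) \<le> Inf S" by (rule cInf_greatest)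
    thus "1 / k * norm (\<Lambda> \<kappa> z \<xi>) \<le> kobayashi_metric \<Omega> z \<xi>" unfolding kobayashi_metric_def S_def .
  qed
qed

end

section \<open>Levi form and real second derivatives; conclusion\<close>

lemma smooth_on_C2_function:
  assumes "open U" "smooth_on U \<rho>"
  shows "C2_function U \<rho> (\<lambda>x. frechet_derivative \<rho> (at x))
    (\<lambda>x u v. frechet_derivative (\<lambda>y. frechet_derivative \<rho> (at y) v) (at x) u)"
proof
  have "Ck_on (Suc (Suc 0)) U \<rho>" using assms(2) by (simp add: smooth_on_def)
  hence s: "\<And>x. x \<in> U \<Longrightarrow> \<rho> differentiable (at x)"
    "\<And>x v. x \<in> U \<Longrightarrow> (\<lambda>x. frechet_derivative \<rho> (at x) v) differentiable (at x)"
    "\<And>u v. continuous_on U (\<lambda>x. frechet_derivative (\<lambda>x. frechet_derivative \<rho> (at x) v) (at x) u)"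
    by auto
  show "open U" by fact
  show "(\<rho> has_derivative frechet_derivative \<rho> (at x)) (at x)" if "x \<in> U" for x
    using s(1)[OF that] frechet_derivative_works by blast
  show "((\<lambda>y. frechet_derivative \<rho> (at y) v) has_derivative
      (\<lambda>u. frechet_derivative (\<lambda>y. frechet_derivative \<rho> (at y) v) (at x) u)) (at x)" if "x \<in> U" for x v
    using s(2)[OF that, of v] frechet_derivative_works by blast
  show "continuous_on U (\<lambda>x. frechet_derivative (\<lambda>y. frechet_derivative \<rho> (at y) v) (at x) u)" for u v
    by (rule s(3))
qed

text \<open>\<open>L\<close> is the sesquilinear form whose matrix consists of the mixed Wirtinger
  derivatives. On the diagonal its cross terms are \<i> times real numbers, so the real part keeps
  the two pure second derivatives, divided by 4.\<close>

lemma levi_form_eq: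
  fixes U :: "(complex ^ 'n::finite) set"
  assumes C2: "C2_function U \<rho> D H" and z: "z \<in> U"
  shows "4 * levi_form \<rho> z \<xi> = H z \<xi> \<xi> + H z (\<i> *s \<xi>) (\<i> *s \<xi>)"
proof -
  interpret C2_function U \<rho> D H by fact
  define L where "L v w = (of_real (H z v w) + \<i> * of_real (H z v (\<i> *s w)) - \<i> * of_real (H z (\<i> *s v) w) + of_real (H z (\<i> *s v) (\<i> *s w))) / 4" for v w
  note H1 = linear_add[OF linear_H1[OF z]] linear_scale[OF linear_H1[OF z]] linear_neg[OF linear_H1[OF z]]
  note H2 = linear_add[OF linear_H2[OF z]] linear_scale[OF linear_H2[OF z]] linear_neg[OF linear_H2[OF z]]
  have ic: "\<i> *s (c *s v) = Re c *\<^sub>R (\<i> *s v) + Im c *\<^sub>R (- v)" for c and v :: "complex ^ 'n"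
    by (simp add: scaleR_eq_scalar_mult vec_eq_iff complex_eq_iff)
  have scale1: "L (c *s v) w = c * L v w" for c v w
  proof -
    have 1: "H z (c *s v) u = Re c * H z v u + Im c * H z (\<i> *s v) u" for u
      by (subst scalar_mult_decompose) (simp add: H1)
    have 2: "H z (\<i> *s (c *s v)) u = Re c * H z (\<i> *s v) u - Im c * H z v u" for u
      unfolding ic by (simp only: H1) simp
    show ?thesis unfolding L_def 1 2 by (simp add: complex_eq_iff algebra_simps add_divide_distrib diff_divide_distrib)
  qed
  have scale2: "L v (c *s w) = cnj c * L v w" for c v w
  proof -
    have 1: "H z u (c *s w) = Re c * H z u w + Im c * H z u (\<i> *s w)" for u
      by (subst scalar_mult_decompose) (simp add: H2)
    have 2: "H z u (\<i> *s (c *s w)) = Re c * H z u (\<i> *s w) - Im c * H z u w" for u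
      unfolding ic by (simp only: H2) simp
    show ?thesis unfolding L_def 1 2 by (simp add: complex_eq_iff algebra_simps add_divide_distrib diff_divide_distrib)
  qed
  have add1: "L (v + v') w = L v w + L v' w" for v v' w
    by (simp add: L_def vector_add_ldistrib H1 complex_eq_iff add_divide_distrib diff_divide_distrib)
  have add2: "L v (w + w') = L v w + L v w'" for v w w'
    by (simp add: L_def vector_add_ldistrib H2 complex_eq_iff add_divide_distrib diff_divide_distrib)
  have sum1: "L (\<Sum>i\<in>I. f i) w = (\<Sum>i\<in>I. L (f i) w)" if "finite I" for I and f :: "'n \<Rightarrow> complex ^ 'n" and w
    using that scale1[of 0 0 w] by (induction I) (auto simp: add1)
  have sum2: "L v (\<Sum>i\<in>I. f i) = (\<Sum>i\<in>I. L v (f i))" if "finite I" for I and f :: "'n \<Rightarrow> complex ^ 'n" and v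
    using that scale2[of v 0 0] by (induction I) (auto simp: add2)
  have ax: "axis k \<i> = \<i> *s axis k (1::complex)" for k :: 'n by (simp add: vec_eq_iff axis_def)
  have fd: "frechet_derivative (\<lambda>w. complex_of_real (\<rho> w)) (at w) v = of_real (D w v)" if "w \<in> U" for w v
  proof -
    have "((\<lambda>w. complex_of_real (\<rho> w)) has_derivative (\<lambda>v. of_real (D w v))) (at w)"
      by (rule bounded_linear.has_derivative[OF bounded_linear_of_real der1[OF that]])
    from frechet_derivative_at[OF this, symmetric] show ?thesis by simp
  qed
  have wb: "wirt_bar k (\<lambda>w. complex_of_real (\<rho> w)) w = (of_real (D w (axis k 1)) + \<i> * of_real (D w (\<i> *s axis k 1))) / 2"
    if "w \<in> U" for w k
    by (simp add: wirt_bar_def fd[OF that] ax)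
  have wd: "frechet_derivative (wirt_bar k (\<lambda>w. complex_of_real (\<rho> w))) (at z) u
     = (of_real (H z u (axis k 1)) + \<i> * of_real (H z u (\<i> *s axis k 1))) / 2" for k u
  proof -
    have of: "((\<lambda>w. complex_of_real (D w v)) has_derivative (\<lambda>u. of_real (H z u v))) (at z)" for v
      by (rule bounded_linear.has_derivative[OF bounded_linear_of_real der2[OF z]])
    have "((\<lambda>w. (of_real (D w (axis k 1)) + \<i> * of_real (D w (\<i> *s axis k 1))) / 2) has_derivative
       (\<lambda>u. (of_real (H z u (axis k 1)) + \<i> * of_real (H z u (\<i> *s axis k 1))) / 2)) (at z)"
      using bounded_linear.has_derivative[OF bounded_linear_mult_left[of "1/2::complex"]
          has_derivative_add[OF of[of "axis k 1"] bounded_linear.has_derivative[OF bounded_linear_mult_right[of \<i>] of[of "\<i> *s axis k 1"]]]]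
      by simp
    hence "(wirt_bar k (\<lambda>w. complex_of_real (\<rho> w)) has_derivative
       (\<lambda>u. (of_real (H z u (axis k 1)) + \<i> * of_real (H z u (\<i> *s axis k 1))) / 2)) (at z)"
      by (rule has_derivative_transform_within_open[OF _ open_U z]) (simp add: wb)
    from frechet_derivative_at[OF this, symmetric] show ?thesis by simp
  qed
  have wirtL: "wirt j (wirt_bar k (\<lambda>w. complex_of_real (\<rho> w))) z = L (axis j 1) (axis k 1)" for j k
    by (simp add: wirt_def wd ax L_def algebra_simps add_divide_distrib diff_divide_distrib)
  have r: "L v \<xi> = (\<Sum>k\<in>UNIV. cnj (\<xi> $ k) * L v (axis k 1))" for v
  proof -
    have "L v \<xi> = L v (\<Sum>k\<in>UNIV. (\<xi> $ k) *s axis k 1)" by (simp add: basis_expansion)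
    thus ?thesis by (simp add: sum2 scale2)
  qed
  have "L \<xi> \<xi> = L (\<Sum>j\<in>UNIV. (\<xi> $ j) *s axis j 1) \<xi>" by (simp add: basis_expansion)
  also have "\<dots> = (\<Sum>j\<in>UNIV. \<xi> $ j * L (axis j 1) \<xi>)" by (simp add: sum1 scale1)
  also have "\<dots> = (\<Sum>j\<in>UNIV. \<Sum>k\<in>UNIV. L (axis j 1) (axis k 1) * (\<xi> $ j) * cnj (\<xi> $ k))"
    unfolding r by (simp add: sum_distrib_left mult_ac)
  finally have "levi_form \<rho> z \<xi> = Re (L \<xi> \<xi>)" by (simp add: levi_form_def wirtL)
  thus ?thesis by (simp add: L_def)
qed

lemma strongly_pseudoconvex_psh_domain:
  assumes "strongly_pseudoconvex_domain \<Omega> \<rho>"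
  obtains U D H where "psh_domain U \<rho> D H \<Omega>"
proof -
  obtain U where U: "open U" "closure \<Omega> \<subseteq> U" "smooth_on U \<rho>" "strictly_psh_on U \<rho>" "\<Omega> = {z \<in> U. \<rho> z < 0}"
    and \<Omega>: "open \<Omega>" "\<Omega> \<noteq> {}" "bounded \<Omega>"
    using assms unfolding strongly_pseudoconvex_domain_def by blast
  define D where "D x = frechet_derivative \<rho> (at x)" for x
  define H where "H x u v = frechet_derivative (\<lambda>y. frechet_derivative \<rho> (at y) v) (at x) u" for x u v
  have C2: "C2_function U \<rho> D H" using smooth_on_C2_function[OF U(1,3)] unfolding D_def H_def .
  have "0 < H z v v + H z (\<i> *s v) (\<i> *s v)" if "z \<in> U" "v \<noteq> 0" for z v
  proof -
    have "0 < levi_form \<rho> z v" using U(4) that by (simp add: strictly_psh_on_def)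
    thus ?thesis using levi_form_eq[OF C2 that(1), of v] by linarith
  qed
  hence "psh_domain U \<rho> D H \<Omega>"
    using C2 U \<Omega> by (intro psh_domain.intro psh_domain_axioms.intro) auto
  thus thesis by (rule that)
qed

theorem proposition3p6:
  fixes \<Omega> :: "(complex ^ 'n) set" and \<rho> :: "complex ^ 'n \<Rightarrow> real"
    and r \<alpha> :: real and p :: ennreal
  assumes "strongly_pseudoconvex_domain \<Omega> \<rho>"
    and "0 < r" and "r < 1" and "1 \<le> p" and "\<alpha> > -1"
  shows "\<exists>C q :: real. C > 0 \<and> q > 0 \<and>
    (\<forall>\<gamma>::real. 0 < \<gamma> \<longrightarrow> \<gamma> < 1 \<longrightarrow>
      (\<forall>E \<in> sets lebesgue. E \<subseteq> \<Omega> \<longrightarrow>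
        (\<forall>z\<in>\<Omega>. measure lebesgue (E \<inter> kobayashi_ball \<Omega> z r)
                  / measure lebesgue (kobayashi_ball \<Omega> z r) \<ge> \<gamma>) \<longrightarrow>
        (\<forall>f \<in> bergman_space \<Omega> \<rho> p \<alpha>.
           Lp_norm p (weighted_measure \<rho> \<alpha> \<Omega>) f
             \<le> ennreal (C * \<gamma> powr (- q)) * Lp_norm p (weighted_measure \<rho> \<alpha> E) f)))"
proof -
  obtain U D H where "psh_domain U \<rho> D H \<Omega>" using strongly_pseudoconvex_psh_domain[OF assms(1)] by blast
  then interpret psh_domain U \<rho> D H \<Omega> .
  obtain \<kappa> where \<kappa>: "\<kappa> > 0" "complex_norm_field \<Omega> (\<lambda>z v. norm (\<Lambda> \<kappa> z v)) (\<lambda>z. - \<rho> z) 12"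
    using complex_norm_field_\<Lambda> by blast
  interpret N: complex_norm_field \<Omega> "\<lambda>z v. norm (\<Lambda> \<kappa> z v)" "\<lambda>z. - \<rho> z" 12 by (rule \<kappa>(2))
  obtain c where c: "c > 0" "\<forall>z\<in>\<Omega>. \<forall>\<xi>. c * norm (\<Lambda> \<kappa> z \<xi>) \<le> kobayashi_metric \<Omega> z \<xi>"
    using kobayashi_metric_ge[OF \<kappa>(1)] by blast
  show ?thesis
  proof (rule N.dominating_kobayashi_balls)
    show "bounded_linear (\<Lambda> \<kappa> z)" if "z \<in> \<Omega>" for z by (rule bounded_linear_\<Lambda>[OF that])
    show "c * norm (\<Lambda> \<kappa> z \<xi>) \<le> kobayashi_metric \<Omega> z \<xi>" if "z \<in> \<Omega>" for z \<xi> using c(2) that by blast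
    show "\<forall>z\<in>\<Omega>. - \<rho> z = \<bar>\<rho> z\<bar>" using \<rho>_neg by force
  qed (use c assms in auto)
qed

end
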